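(* Let $J\geqslant 3$ be an integer and $j_0\in\{0,\dots,J-1\}$. Then $$\Big|\Big\{n\leqslant x:\ P^+(n+j_0)=\min_{0\leqslant j\leqslant J-1}P^+(n+j)\Big\}\Big|\geqslant \{C_3(J)+o(1)\}\,x$$ as $x\to\infty$, where $$C_3(J):=\max_{0<\alpha<\frac{1}{2(J-1)}}\rho\Big(\frac1\alpha\Big)\Big(\alpha\log\frac{1}{2\alpha(J-1)}\Big)^{J-1}>0.$$
   Context: $n$ ranges over positive integers. $P^+(n)$ denotes the largest prime factor of $n$, with $P^+(1)=1$. $\rho$ is the Dickman function: the unique continuous solution of $\rho(u)=1$ for $0\leqslant u\leqslant 1$ and $u\rho'(u)=-\rho(u-1)$ for $u>1$. *)

theory Defs
  imports "HOL-Number_Theory.Number_Theory" "HOL-Library.Landau_Symbols"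
begin

definition Pplus :: "nat \<Rightarrow> nat" where
  "Pplus n = (if n \<le> 1 then 1 else Max (prime_factors n))"

(* The value 0 on the negative half-line only serves to make the description unique
   as a total function on the reals. *)
definition is_dickman :: "(real \<Rightarrow> real) \<Rightarrow> bool" where
  "is_dickman r \<longleftrightarrow>
     continuous_on {0..} r \<and>
     (\<forall>u<0. r u = 0) \<and>
     (\<forall>u\<in>{0..1}. r u = 1) \<and>
     (\<forall>u>1. \<exists>D. (r has_real_derivative D) (at u) \<and> u * D = - r (u - 1))"

definition dickman :: "real \<Rightarrow> real" where
  "dickman = (THE r. is_dickman r)"

definition C3_range :: "nat \<Rightarrow> real set" where
  "C3_range J = {0<..<1 / (2 * (real J - 1))}"

definition C3_fun :: "nat \<Rightarrow> real \<Rightarrow> real" where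
  "C3_fun J \<alpha> = dickman (1 / \<alpha>) * (\<alpha> * ln (1 / (2 * \<alpha> * (real J - 1)))) ^ (J - 1)"

(* A maximum over an infinite set, hence GREATEST instead of Max (which is for finite sets). *)
definition C3 :: "nat \<Rightarrow> real" where
  "C3 J = (GREATEST c. c \<in> C3_fun J ` C3_range J)"

definition min_at_count :: "nat \<Rightarrow> nat \<Rightarrow> real \<Rightarrow> nat" where
  "min_at_count J j0 x =
     card {n. 1 \<le> n \<and> real n \<le> x \<and>
              Pplus (n + j0) = Min ((\<lambda>j. Pplus (n + j)) ` {0..J - 1})}"

end

theory Submission
  imports Defs "HOL-Analysis.Analysis" "HOL-Real_Asymp.Real_Asymp"
begin

text \<open>
  Fix \<open>0 < \<alpha> < \<beta> < 1 / (2 (J - 1))\<close> and let \<open>I\<close> be the set of primes in \<open>(N\<^sup>\<alpha>, N\<^sup>\<beta>]\<close>. If \<open>m = n + j0\<close> is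
  \<open>N\<^sup>\<alpha>\<close>-smooth and every \<open>n + j\<close> with \<open>j \<noteq> j0\<close> has a prime factor in \<open>I\<close>, then \<open>n\<close> is counted. An
  integer of size \<open>N\<close> has at most about \<open>1 / \<alpha>\<close> prime factors in \<open>I\<close>, so the count is at least about
  \<open>\<alpha>\<^sup>J\<^sup>-\<^sup>1\<close> times the sum of \<open>G m = (\<Prod>j\<noteq>j0. \<omega>\<^sub>I (n + j))\<close> over smooth \<open>m \<le> N\<close>. The mean value of \<open>G\<close> over all
  \<open>m\<close> is about \<open>(ln (\<beta> / \<alpha>))\<^sup>J\<^sup>-\<^sup>1\<close> by Mertens, and the smooth numbers have density \<open>\<rho> (1 / \<alpha>)\<close> by Buchstab's
  identity; it remains to see that \<open>G\<close> minus its mean is asymptotically orthogonal to the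
  indicator of the smooth numbers. No level of distribution is needed for this: the indicator is
  invariant under multiplication by a fixed prime, so the Katai criterion reduces the claim to the
  correlations of \<open>G (p a)\<close> and \<open>G (q a)\<close> over all integers \<open>a\<close>. The moduli there are products
  of \<open>2 (J - 1)\<close> primes from \<open>I\<close>, at most a fixed power of \<open>N\<close> with exponent below one, so the Chinese
  remainder theorem suffices.
\<close>

section \<open>Reciprocal sums of primes\<close>

text \<open>The factor 2 in the range of \<alpha> is the price of Cauchy's inequality in the Katai
  criterion: it turns a mean value of G into a correlation of two dilates and so doubles the number
  of prime moduli. As \<beta> approaches 1 / (2 (J - 1)), ln (\<beta> / \<alpha>) becomes the
  logarithm in \<open>C3_fun\<close>. This endpoint and the bound 1 / \<alpha> for the number of
  window primes are only approached, so the count is bounded below by c x for each c below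
  \<open>C3 J\<close>. Smoothness bound and window both move with N. The criterion tolerates this
  because its auxiliary primes form a finite set chosen before N grows: invariance under dilation by
  p holds once N^\<alpha> exceeds p, and each correlation estimate is required only eventually for a
  fixed pair of primes, without uniformity in the pair. The criterion also demands bounded
  functions. This holds because the window starts at a fixed power of N, so that an integer of size
  N has boundedly many prime factors in it.\<close>

definition primes_in :: "real \<Rightarrow> real \<Rightarrow> nat set" where
  "primes_in a b = {p. prime p \<and> a < real p \<and> real p \<le> b}"

lemma finite_primes_in [simp]: "finite (primes_in a b)"
proof (rule finite_subset)
  show "primes_in a b \<subseteq> {..nat \<lfloor>b\<rfloor>}"
    by (auto simp: primes_in_def le_nat_floor)
qed simp

lemma primes_in_Un:
  assumes "a \<le> b" "b \<le> c"
  shows "primes_in a c = primes_in a b \<union> primes_in b c" "primes_in a b \<inter> primes_in b c = {}"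
  using assms by (auto simp: primes_in_def)

section \<open>Chebyshev's bound for the product of the primes up to n\<close>

lemma prod_primes_dvd:
  fixes n :: nat
  assumes "finite A" "\<And>p. p \<in> A \<Longrightarrow> prime p" "\<And>p. p \<in> A \<Longrightarrow> p dvd n"
  shows "\<Prod>A dvd n"
  using assms
proof (induction A rule: finite_induct)
  case (insert p A)
  have "coprime p (\<Prod>A)"
    by (rule prod_coprime_right) (metis insert insertCI primes_coprime)
  then have "p * \<Prod>A dvd n" using insert by (intro divides_mult) auto
  then show ?case using insert by simp
qed simp

text \<open>The coefficient occurs twice in its row, at \<open>m\<close> and at
  \<open>m + 1\<close>, and the row sums to \<open>2 * 4 ^ m\<close>.\<close>

lemma choose_odd_le: "(2 * m + 1) choose m \<le> 4 ^ m"
proof -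
  have "2 * ((2 * m + 1) choose m) = ((2 * m + 1) choose m) + ((2 * m + 1) choose (m + 1))"
    using binomial_symmetric[of m "2 * m + 1"] by (simp add: algebra_simps)
  also have "\<dots> = (\<Sum>k\<in>{m, m + 1}. (2 * m + 1) choose k)" by simp
  also have "\<dots> \<le> (\<Sum>k\<le>2 * m + 1. (2 * m + 1) choose k)"
    by (rule sum_mono2) auto
  also have "\<dots> = 2 * 4 ^ m"
    using choose_row_sum[of "2 * m + 1"] by (simp add: power_mult)
  finally show ?thesis by simp
qed

text \<open>Erdos's argument. For \<open>n = 2 * m + 1\<close> the primes between
  \<open>m + 2\<close> and \<open>n\<close> all divide \<open>n choose m\<close>, which is at most
  \<open>4 ^ m\<close>, and the induction hypothesis at \<open>m + 1\<close> supplies the remaining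
  \<open>4 ^ (m + 1)\<close>. An even \<open>n\<close> above 2 is not prime and adds no
  factor.\<close>

lemma primorial_le: "\<Prod>{p. prime p \<and> p \<le> (n::nat)} \<le> 4 ^ n"
proof (induction n rule: less_induct)
  case (less n)
  let ?P = "\<lambda>n. {p::nat. prime p \<and> p \<le> n}"
  have fin: "finite (?P k)" for k by (rule finite_subset[of _ "{..k}"]) auto
  consider "n \<le> 1" | "n = 2" | "n \<ge> 3" "even n" | "n \<ge> 3" "odd n" by force
  then show ?case
  proof cases
    case 1
    have "?P n = {}"
    proof (rule ccontr)
      assume "?P n \<noteq> {}"
      then obtain p where "prime p" "p \<le> n" by blast
      with 1 show False using prime_ge_2_nat[of p] by simp
    qed
    then show ?thesis by (simp only: prod.empty) simp
  next
    case 2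
    have "?P n = {2}"
    proof (intro equalityI subsetI)
      fix p assume "p \<in> ?P n"
      then show "p \<in> {2}" using 2 prime_ge_2_nat[of p] by simp
    qed (use 2 in simp)
    then have "\<Prod>(?P n) = 2" by simp
    then show ?thesis using 2 by simp
  next
    case 3
    then have "\<not> prime n" using prime_odd_nat[of n] by auto
    then have "?P n = ?P (n - 1)" using 3 by (auto simp: le_eq_less_or_eq)
    then have "\<Prod>(?P n) \<le> 4 ^ (n - 1)" using less[of "n - 1"] 3 by simp
    also have "\<dots> \<le> 4 ^ n" by (intro power_increasing) auto
    finally show ?thesis .
  next
    case 4
    then obtain m where m: "n = 2 * m + 1" by (auto elim: oddE)
    with 4 have "m \<ge> 1" by auto
    let ?Q = "{p. prime p \<and> m + 1 < p \<and> p \<le> n}"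
    have un: "?P n = ?P (m + 1) \<union> ?Q" using m by auto
    have finQ: "finite ?Q" by (rule finite_subset[OF _ fin[of n]]) auto
    have "\<Prod>?Q dvd n choose m"
    proof (rule prod_primes_dvd[OF finQ])
      fix p assume p: "p \<in> ?Q"
      then show "prime p" by auto
      have "fact n = fact m * fact (n - m) * (n choose m)"
        using binomial_fact_lemma[of m n] m by (simp add: mult_ac)
      moreover have "p dvd fact n" "\<not> p dvd fact m" "\<not> p dvd fact (n - m)"
        using p m by (simp_all add: prime_dvd_fact_iff del: fact_Suc)
      ultimately show "p dvd n choose m" using p by (auto simp: prime_dvd_mult_iff)
    qed
    then have "\<Prod>?Q \<le> n choose m" using m by (intro dvd_imp_le) auto
    also have "\<dots> \<le> 4 ^ m" using choose_odd_le m by simp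
    finally have Q: "\<Prod>?Q \<le> 4 ^ m" .
    have "\<Prod>(?P n) = \<Prod>(?P (m + 1)) * \<Prod>?Q"
      unfolding un by (rule prod.union_disjoint) (use fin finQ in auto)
    also have "\<dots> \<le> 4 ^ (m + 1) * 4 ^ m"
      using less[of "m + 1"] \<open>m \<ge> 1\<close> m Q by (intro mult_mono) auto
    also have "\<dots> = 4 ^ n" by (simp add: m power_add mult_2)
    finally show ?thesis .
  qed
qed

lemma ln_prod_nat:
  assumes "finite A" "\<And>p. p \<in> A \<Longrightarrow> (p::nat) > 0"
  shows "ln (real (\<Prod>A)) = (\<Sum>p\<in>A. ln (real p))"
  using assms by (simp add: ln_prod)

lemma theta_le: "(\<Sum>p | prime p \<and> p \<le> n. ln (real p)) \<le> real n * ln 4"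
proof -
  have fin: "finite {p::nat. prime p \<and> p \<le> n}" by (rule finite_subset[of _ "{..n}"]) auto
  have "(\<Sum>p | prime p \<and> p \<le> n. ln (real p)) = ln (real (\<Prod>{p. prime p \<and> p \<le> n}))"
    by (rule ln_prod_nat[symmetric]) (use fin prime_gt_0_nat in auto)
  also have "\<dots> \<le> ln (real (4 ^ n))"
    using primorial_le[of n] fin prime_gt_0_nat by (subst ln_le_cancel_iff) (auto intro!: prod_pos simp del: of_nat_prod)
  also have "\<dots> = real n * ln 4" by (simp add: ln_realpow)
  finally show ?thesis .
qed

section \<open>Mertens' first theorem, from the size of ln n!\<close>

lemma ln_fact_sum: "ln (fact n) = (\<Sum>k=1..n. ln (real k))"
proof -
  have "ln (fact n) = ln (real (\<Prod>{1..n}))" by (simp add: fact_prod)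
  also have "\<dots> = (\<Sum>k=1..n. ln (real k))" by (rule ln_prod_nat) auto
  finally show ?thesis .
qed

lemma ln_fact_upper: "n \<ge> 1 \<Longrightarrow> ln (fact n) \<le> real n * ln (real n)"
proof -
  assume "n \<ge> 1"
  have "(\<Sum>k=1..n. ln (real k)) \<le> (\<Sum>k=1..n. ln (real n))" by (rule sum_mono) auto
  then show ?thesis by (simp add: ln_fact_sum)
qed

lemma ln_fact_lower: "n \<ge> 1 \<Longrightarrow> ln (fact n) \<ge> real n * ln (real n) - real n"
proof (induction n rule: dec_induct)
  case (step n)
  have "real n * ln (1 + 1 / real n) \<le> real n * (1 / real n)"
    using step by (intro mult_left_mono ln_add_one_self_le_self) auto
  moreover have "1 + 1 / real n = real (Suc n) / real n"
    using step by (simp add: field_simps)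
  then have "ln (1 + 1 / real n) = ln (real (Suc n)) - ln (real n)"
    using step by (simp add: ln_div)
  ultimately have "real n * ln (real (Suc n)) \<le> real n * ln (real n) + 1"
    using step by (simp add: algebra_simps)
  moreover have "ln (fact (Suc n)) = ln (real (Suc n)) + ln (fact n)"
    by (simp add: ln_mult del: of_nat_Suc)
  ultimately show ?case using step by (simp add: algebra_simps)
qed simp

lemma card_multiples: "d > 0 \<Longrightarrow> card {k\<in>{1..n}. d dvd k} = n div (d::nat)"
proof -
  assume d: "d > 0"
  have "{k\<in>{1..n}. d dvd k} = (\<lambda>i. d * i) ` {1..n div d}"
  proof (intro equalityI subsetI)
    fix k assume "k \<in> {k\<in>{1..n}. d dvd k}"
    then obtain i where i: "k = d * i" "1 \<le> k" "k \<le> n" by auto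
    then have "i \<ge> 1" "i \<le> n div d" using d by (auto simp: less_eq_div_iff_mult_less_eq mult_ac Suc_le_eq)
    then show "k \<in> (\<lambda>i. d * i) ` {1..n div d}" using i by auto
  next
    fix k assume "k \<in> (\<lambda>i. d * i) ` {1..n div d}"
    then show "k \<in> {k\<in>{1..n}. d dvd k}"
      using d by (auto simp: less_eq_div_iff_mult_less_eq mult_ac Suc_le_eq)
  qed
  moreover have "inj_on (\<lambda>i. d * i) {1..n div d}" using d by (auto intro: inj_onI)
  ultimately show ?thesis by (simp add: card_image)
qed

lemma sum_over_divisors:
  assumes "finite P" "\<And>p. p \<in> P \<Longrightarrow> d p > 0"
  shows "(\<Sum>k=1..n. \<Sum>p\<in>{p\<in>P. d p dvd k}. (f p :: real)) = (\<Sum>p\<in>P. f p * real (n div (d p)))"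
proof -
  have "(\<Sum>k=1..n. \<Sum>p\<in>{p\<in>P. d p dvd k}. f p) = (\<Sum>k=1..n. \<Sum>p\<in>P. if d p dvd k then f p else 0)"
    using assms(1) by (intro sum.cong refl sum.inter_filter)
  also have "\<dots> = (\<Sum>p\<in>P. \<Sum>k=1..n. if d p dvd k then f p else 0)" by (rule sum.swap)
  also have "\<dots> = (\<Sum>p\<in>P. f p * real (n div (d p)))"
  proof (rule sum.cong[OF refl])
    fix p assume "p \<in> P"
    have "(\<Sum>k=1..n. if d p dvd k then f p else 0) = (\<Sum>k\<in>{k\<in>{1..n}. d p dvd k}. f p)"
      by (rule sum.inter_filter[symmetric]) simp
    then have "(\<Sum>k=1..n. if d p dvd k then f p else 0) = f p * real (card {k\<in>{1..n}. d p dvd k})"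
      by simp
    then show "(\<Sum>k=1..n. if d p dvd k then f p else 0) = f p * real (n div (d p))"
      using card_multiples assms \<open>p \<in> P\<close> by simp
  qed
  finally show ?thesis .
qed

definition mertens :: "nat \<Rightarrow> real" where
  "mertens n = (\<Sum>p | prime p \<and> p \<le> n. ln (real p) / real p)"

lemma finite_primes_le [simp]: "finite {p::nat. prime p \<and> p \<le> n}"
  by (rule finite_subset[of _ "{..n}"]) auto

text \<open>The distinct primes dividing \<open>k\<close> multiply to at most \<open>k\<close>, so
  ln n! dominates the sum of \<open>ln p * (n div p)\<close>. Removing the rounding in
  \<open>n div p\<close> costs at most the sum of all \<open>ln p\<close>, which
  \<open>theta_le\<close> bounds by \<open>n * ln 4\<close>.\<close>

lemma mertens_upper:
  assumes "n \<ge> 1" shows "mertens n \<le> ln (real n) + ln 4"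
proof -
  let ?P = "{p::nat. prime p \<and> p \<le> n}"
  have pos: "p > 0" if "p \<in> ?P" for p using that prime_gt_0_nat by auto
  have "real n * mertens n - real n * ln 4 \<le> (\<Sum>p\<in>?P. real n * (ln (real p) / real p)) - (\<Sum>p\<in>?P. ln (real p))"
    using theta_le[of n] by (simp add: mertens_def sum_distrib_left)
  also have "\<dots> = (\<Sum>p\<in>?P. ln (real p) * (real n / real p - 1))"
    by (simp add: sum_subtractf[symmetric] algebra_simps)
  also have "\<dots> \<le> (\<Sum>p\<in>?P. ln (real p) * real (n div p))"
  proof (intro sum_mono mult_left_mono)
    fix p assume "p \<in> ?P"
    with pos have "p > 0" by blast
    then have "n \<le> p + n div p * p" by (intro less_imp_le dividend_less_div_times)
    then have "real n \<le> real p + real (n div p) * real p" by (simp flip: of_nat_mult of_nat_add)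
    with \<open>p > 0\<close> show "real n / real p - 1 \<le> real (n div p)" by (simp add: field_simps)
    show "0 \<le> ln (real p)" using \<open>p > 0\<close> by simp
  qed
  also have "\<dots> = (\<Sum>k=1..n. \<Sum>p\<in>{p\<in>?P. p dvd k}. ln (real p))"
    by (rule sum_over_divisors[symmetric]) (use pos in auto)
  also have "\<dots> \<le> (\<Sum>k=1..n. ln (real k))"
  proof (rule sum_mono)
    fix k assume k: "k \<in> {1..n}"
    have "(\<Sum>p\<in>{p\<in>?P. p dvd k}. ln (real p)) = ln (real (\<Prod>{p\<in>?P. p dvd k}))"
      by (rule ln_prod_nat[symmetric]) (use prime_gt_0_nat in auto)
    also have "\<Prod>{p\<in>?P. p dvd k} dvd k" by (rule prod_primes_dvd) auto
    then have "ln (real (\<Prod>{p\<in>?P. p dvd k})) \<le> ln (real k)"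
      using k prime_gt_0_nat by (subst ln_le_cancel_iff) (auto intro!: prod_pos dvd_imp_le simp del: of_nat_prod)
    finally show "(\<Sum>p\<in>{p\<in>?P. p dvd k}. ln (real p)) \<le> ln (real k)" .
  qed
  also have "\<dots> = ln (fact n)" by (simp add: ln_fact_sum)
  also have "\<dots> \<le> real n * ln (real n)" using assms by (rule ln_fact_upper)
  finally have "real n * mertens n \<le> real n * (ln (real n) + ln 4)" by (simp add: algebra_simps)
  then show ?thesis using assms by simp
qed

text \<open>The logarithm as the divisor sum of the von Mangoldt function, with prime powers kept as
  pairs. Their range depends on \<open>n\<close> but not on \<open>k\<close>, so that a sum over
  \<open>k\<close> can be exchanged with it.\<close>

lemma ln_eq_sum_prime_powers:
  assumes "k \<ge> 1" "k \<le> n"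
  shows "ln (real k) = (\<Sum>(p,i)\<in>{(p,i)\<in>{p. prime p \<and> p \<le> n} \<times> {1..n}. p ^ i dvd k}. ln (real p))"
proof -
  let ?P = "{p::nat. prime p \<and> p \<le> n}"
  have mult: "{i\<in>{1..n}. p ^ i dvd k} = {1..multiplicity p k}" if "p \<in> ?P" for p
  proof -
    have 1: "p ^ i dvd k \<longleftrightarrow> i \<le> multiplicity p k" for i
      using assms that by (intro power_dvd_iff_le_multiplicity) auto
    have "multiplicity p k < p ^ multiplicity p k"
      using that prime_gt_1_nat by (intro power_gt_expt) auto
    also have "\<dots> \<le> k" using assms by (intro dvd_imp_le multiplicity_dvd) auto
    finally have 2: "multiplicity p k < k" .
    show ?thesis
    proof (intro equalityI subsetI)
      fix i assume "i \<in> {i\<in>{1..n}. p ^ i dvd k}"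
      then show "i \<in> {1..multiplicity p k}" using 1[of i] by simp
    next
      fix i assume "i \<in> {1..multiplicity p k}"
      then show "i \<in> {i\<in>{1..n}. p ^ i dvd k}" using 1[of i] 2 assms by simp
    qed
  qed
  have eq: "{(p,i)\<in>?P \<times> {1..n}. p ^ i dvd k} = Sigma ?P (\<lambda>p. {i\<in>{1..n}. p ^ i dvd k})" by auto
  have "(\<Sum>(p,i)\<in>{(p,i)\<in>?P \<times> {1..n}. p ^ i dvd k}. ln (real p)) =
        (\<Sum>p\<in>?P. \<Sum>i\<in>{i\<in>{1..n}. p ^ i dvd k}. ln (real p))"
    unfolding eq by (rule sum.Sigma[symmetric]) auto
  also have "\<dots> = (\<Sum>p\<in>?P. real (multiplicity p k) * ln (real p))"
    by (intro sum.cong refl) (simp only: mult, simp)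
  also have "\<dots> = (\<Sum>p\<in>prime_factors k. real (multiplicity p k) * ln (real p))"
  proof (rule sum.mono_neutral_right)
    show "prime_factors k \<subseteq> ?P"
    proof
      fix p assume "p \<in> prime_factors k"
      then have "prime p" "p dvd k" by auto
      then show "p \<in> ?P" using assms dvd_imp_le[of p k] by auto
    qed
    show "\<forall>p\<in>?P - prime_factors k. real (multiplicity p k) * ln (real p) = 0"
      by (auto simp: prime_factors_multiplicity)
  qed simp
  also have "\<dots> = ln (real (\<Prod>p\<in>prime_factors k. p ^ multiplicity p k))"
    using prime_gt_0_nat by (subst of_nat_prod, subst ln_prod) (auto simp: ln_realpow intro!: sum.cong)
  also have "\<dots> = ln (real k)" using assms prime_factorization_nat[of k] by simp
  finally show ?thesis by simp
qed

text \<open>Here all prime powers are kept. The geometric series over the exponents turns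
  \<open>ln p / p\<close> into \<open>ln p / (p - 1)\<close>; the excess
  \<open>ln p / (p * (p - 1))\<close> is summable and enters only the constant.\<close>

lemma mertens_lower: "\<exists>C. \<forall>n\<ge>1. mertens n \<ge> ln (real n) - C"
proof -
  have sm: "summable (\<lambda>k::nat. ln (real k) / (real k * (real k - 1)))"
  proof (rule summable_comparison_test_bigo)
    show "summable (\<lambda>n::nat. norm (real n powr (- 3/2)))" by (simp add: summable_real_powr_iff)
    show "(\<lambda>k::nat. ln (real k) / (real k * (real k - 1))) \<in> O(\<lambda>n. real n powr (- 3/2))"
      by real_asymp
  qed
  define c where "c = (\<Sum>k::nat. ln (real k) / (real k * (real k - 1)))"
  have "mertens n \<ge> ln (real n) - (1 + c)" if n: "n \<ge> 1" for n
  proof -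
    let ?P = "{p::nat. prime p \<and> p \<le> n}"
    have ge2: "p \<ge> 2" if "p \<in> ?P" for p using that prime_ge_2_nat by auto
    have "real n * ln (real n) - real n \<le> ln (fact n)" using n by (rule ln_fact_lower)
    also have "\<dots> = (\<Sum>k=1..n. \<Sum>(p,i)\<in>{(p,i)\<in>?P \<times> {1..n}. p ^ i dvd k}. ln (real p))"
      unfolding ln_fact_sum by (intro sum.cong refl ln_eq_sum_prime_powers) auto
    also have "\<dots> = (\<Sum>k=1..n. \<Sum>q\<in>{q\<in>?P \<times> {1..n}. fst q ^ snd q dvd k}. ln (real (fst q)))"
      by (intro sum.cong refl) (auto simp: case_prod_beta)
    also have "\<dots> = (\<Sum>q\<in>?P \<times> {1..n}. ln (real (fst q)) * real (n div (fst q ^ snd q)))"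
      by (rule sum_over_divisors) (auto intro: prime_gt_0_nat)
    also have "\<dots> = (\<Sum>p\<in>?P. \<Sum>i=1..n. ln (real p) * real (n div p ^ i))"
      by (simp add: sum.cartesian_product case_prod_beta)
    also have "\<dots> \<le> (\<Sum>p\<in>?P. real n * (ln (real p) / (real p - 1)))"
    proof (rule sum_mono)
      fix p assume p: "p \<in> ?P"
      have geo: "(\<Sum>i=1..m. (1 / real p) ^ i) \<le> 1 / (real p - 1)" for m
      proof -
        have "(real p - 1) * (\<Sum>i=1..m. (1 / real p) ^ i) = 1 - (1 / real p) ^ m"
        proof (induction m)
          case (Suc m)
          have "(real p - 1) * (1 / real p) ^ Suc m = (1 / real p) ^ m - (1 / real p) ^ Suc m"
            using ge2[OF p] by (simp add: field_simps)
          then show ?case using Suc by (simp add: algebra_simps)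
        qed simp
        then have "(real p - 1) * (\<Sum>i=1..m. (1 / real p) ^ i) \<le> 1" by simp
        then show ?thesis using ge2[OF p] by (simp add: field_simps)
      qed
      have "(\<Sum>i=1..n. ln (real p) * real (n div p ^ i)) \<le> (\<Sum>i=1..n. ln (real p) * (real n * (1 / real p) ^ i))"
        proof (intro sum_mono mult_left_mono)
        fix i
        show "real (n div p ^ i) \<le> real n * (1 / real p) ^ i"
          using of_nat_div_le_of_nat[of n "p ^ i", where 'a=real] by (simp add: power_one_over)
      qed (use ge2[OF p] in auto)
      also have "\<dots> = ln (real p) * real n * (\<Sum>i=1..n. (1 / real p) ^ i)"
        by (simp add: sum_distrib_left mult_ac)
      also have "\<dots> \<le> ln (real p) * real n * (1 / (real p - 1))"
        using ge2[OF p] geo by (intro mult_left_mono) auto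
      finally show "(\<Sum>i=1..n. ln (real p) * real (n div p ^ i)) \<le> real n * (ln (real p) / (real p - 1))"
        by (simp add: mult_ac)
    qed
    also have "\<dots> = real n * (\<Sum>p\<in>?P. ln (real p) / real p + ln (real p) / (real p * (real p - 1)))"
    proof -
      have "ln (real p) / (real p - 1) = ln (real p) / real p + ln (real p) / (real p * (real p - 1))" if "p \<in> ?P" for p
      proof -
        have "real p > 1" using ge2[OF that] by simp
        then show ?thesis by (simp add: field_simps)
      qed
      then show ?thesis by (simp add: sum_distrib_left)
    qed
    also have "\<dots> = real n * (mertens n + (\<Sum>p\<in>?P. ln (real p) / (real p * (real p - 1))))"
      by (simp add: mertens_def sum.distrib)
    also have "\<dots> \<le> real n * (mertens n + c)"
    proof (intro mult_left_mono add_left_mono)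
      have "0 \<le> ln (real k) / (real k * (real k - 1))" for k :: nat
        by (cases "k \<le> 1") (auto simp: le_Suc_eq intro!: divide_nonneg_nonneg)
      then show "(\<Sum>p\<in>?P. ln (real p) / (real p * (real p - 1))) \<le> c"
        unfolding c_def by (intro sum_le_suminf sm) auto
    qed simp
    finally have "real n * (ln (real n) - 1) \<le> real n * (mertens n + c)" by (simp add: algebra_simps)
    then show ?thesis using n by simp
  qed
  then show ?thesis by blast
qed

lemma mertens_first: "\<exists>C. \<forall>x\<ge>1. \<bar>mertens (nat \<lfloor>x\<rfloor>) - ln x\<bar> \<le> C"
proof -
  obtain C where C: "\<And>n. n \<ge> 1 \<Longrightarrow> mertens n \<ge> ln (real n) - C" using mertens_lower by blast
  have "\<bar>mertens (nat \<lfloor>x\<rfloor>) - ln x\<bar> \<le> \<bar>C\<bar> + ln 4 + ln 2" if x: "x \<ge> 1" for x :: real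
  proof -
    let ?n = "nat \<lfloor>x\<rfloor>"
    have n: "?n \<ge> 1" using x by (simp add: le_nat_iff)
    have le: "real ?n \<le> x" using x by simp
    have "x < real ?n + 1" using x by linarith
    also have "\<dots> \<le> 2 * real ?n" using n by simp
    finally have "ln x \<le> ln (2 * real ?n)" using x by simp
    also have "\<dots> = ln 2 + ln (real ?n)" using n by (subst ln_mult) auto
    finally have "ln x \<le> ln 2 + ln (real ?n)" .
    moreover have "ln (real ?n) \<le> ln x" using le n by simp
    moreover have "ln (2::real) \<ge> 0" "ln (4::real) \<ge> 0" by auto
    ultimately show ?thesis using C[OF n] mertens_upper[OF n] by linarith
  qed
  then show ?thesis by blast
qed

lemma mertens_diff:
  assumes "a \<le> b"
  shows "mertens (nat \<lfloor>b\<rfloor>) - mertens (nat \<lfloor>a\<rfloor>) = (\<Sum>p\<in>primes_in a b. ln (real p) / real p)"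
proof -
  let ?P = "\<lambda>x. {p::nat. prime p \<and> p \<le> nat \<lfloor>x\<rfloor>}"
  have le_floor: "p \<le> nat \<lfloor>x\<rfloor> \<longleftrightarrow> real p \<le> x" if "p > 0" for p x
    using that by (cases "x \<ge> 0") (simp_all add: le_nat_iff le_floor_iff)
  have P: "?P x = primes_in 0 x" for x :: real
    using le_floor[OF prime_gt_0_nat] prime_gt_0_nat by (auto simp: primes_in_def)
  have "?P b = ?P a \<union> primes_in a b" "?P a \<inter> primes_in a b = {}"
    unfolding P using assms prime_gt_0_nat by (auto simp: primes_in_def)
  then show ?thesis by (simp add: mertens_def sum.union_disjoint)
qed

section \<open>Mertens' second theorem on windows between two powers of x\<close>

lemma mertens_diff_tendsto:
  assumes "0 < a" "a < b"
  shows "((\<lambda>x. (\<Sum>p\<in>primes_in (x powr a) (x powr b). ln (real p) / real p) / ln x) \<longlongrightarrow> b - a) at_top"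
proof -
  obtain C where C: "\<And>x::real. x \<ge> 1 \<Longrightarrow> \<bar>mertens (nat \<lfloor>x\<rfloor>) - ln x\<bar> \<le> C" using mertens_first by blast
  have "((\<lambda>x. (\<Sum>p\<in>primes_in (x powr a) (x powr b). ln (real p) / real p) / ln x - (b - a)) \<longlongrightarrow> 0) at_top"
  proof (rule Lim_null_comparison)
    show "((\<lambda>x. 2 * C / ln x) \<longlongrightarrow> 0) at_top" by real_asymp
    show "\<forall>\<^sub>F x in at_top. norm ((\<Sum>p\<in>primes_in (x powr a) (x powr b). ln (real p) / real p) / ln x - (b - a)) \<le> 2 * C / ln x"
      using eventually_gt_at_top[of 1]
    proof eventually_elim
      case (elim x)
      have 1: "x powr a \<ge> 1" "x powr b \<ge> 1" "x powr a \<le> x powr b" "ln x > 0"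
        using elim assms by (auto intro!: ge_one_powr_ge_zero)
      have "\<bar>mertens (nat \<lfloor>x powr b\<rfloor>) - mertens (nat \<lfloor>x powr a\<rfloor>) - (b - a) * ln x\<bar> \<le> 2 * C"
        using C[OF 1(1)] C[OF 1(2)] elim by (simp add: ln_powr algebra_simps)
      then have "\<bar>(mertens (nat \<lfloor>x powr b\<rfloor>) - mertens (nat \<lfloor>x powr a\<rfloor>) - (b - a) * ln x) / ln x\<bar> \<le> 2 * C / ln x"
        using 1 by (simp add: divide_right_mono)
      then show ?case using 1 by (simp add: mertens_diff diff_divide_distrib)
    qed
  qed
  then show ?thesis by (simp add: LIM_zero_iff)
qed

definition recip_sum :: "nat set \<Rightarrow> real" where
  "recip_sum P = (\<Sum>p\<in>P. 1 / real p)"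

text \<open>On the window \<open>ln p\<close> lies between \<open>a * ln x\<close> and
  \<open>b * ln x\<close>, so trading the weight \<open>ln p / p\<close> for \<open>1 / p\<close> is
  exact up to the factor \<open>b / a\<close>.\<close>

lemma recip_sum_primes_bounds:
  assumes "0 < a" "a < b" "x > 1"
  shows "(\<Sum>p\<in>primes_in (x powr a) (x powr b). ln (real p) / real p) / ln x / b \<le> recip_sum (primes_in (x powr a) (x powr b))"
    and "recip_sum (primes_in (x powr a) (x powr b)) \<le> (\<Sum>p\<in>primes_in (x powr a) (x powr b). ln (real p) / real p) / ln x / a"
proof -
  let ?P = "primes_in (x powr a) (x powr b)"
  have lx: "ln x > 0" using assms by simp
  have b: "p > 0 \<and> a * ln x \<le> ln (real p) \<and> ln (real p) \<le> b * ln x" if "p \<in> ?P" for p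
  proof -
    have p: "p > 0" "x powr a < real p" "real p \<le> x powr b" using that prime_gt_0_nat by (auto simp: primes_in_def)
    have "ln (x powr a) \<le> ln (real p)" "ln (real p) \<le> ln (x powr b)"
      using p assms by (auto simp del: ln_powr)
    then show ?thesis using p assms by (simp add: ln_powr)
  qed
  have "(\<Sum>p\<in>?P. ln (real p) / real p) / ln x / b = (\<Sum>p\<in>?P. (ln (real p) / (b * ln x)) * (1 / real p))"
    by (simp add: sum_divide_distrib field_simps)
  also have "\<dots> \<le> (\<Sum>p\<in>?P. 1 * (1 / real p))"
    using b lx assms by (intro sum_mono mult_right_mono) (auto simp: field_simps)
  finally show "(\<Sum>p\<in>?P. ln (real p) / real p) / ln x / b \<le> recip_sum ?P" by (simp add: recip_sum_def)
  have "recip_sum ?P = (\<Sum>p\<in>?P. 1 * (1 / real p))" by (simp add: recip_sum_def)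
  also have "\<dots> \<le> (\<Sum>p\<in>?P. (ln (real p) / (a * ln x)) * (1 / real p))"
    using b lx assms by (intro sum_mono mult_right_mono) (auto simp: field_simps)
  also have "\<dots> = (\<Sum>p\<in>?P. ln (real p) / real p) / ln x / a"
    by (simp add: sum_divide_distrib field_simps)
  finally show "recip_sum ?P \<le> (\<Sum>p\<in>?P. ln (real p) / real p) / ln x / a" .
qed

lemma recip_sum_primes_subdivide:
  assumes "0 < a" "1 \<le> r" "x > 1"
  shows "recip_sum (primes_in (x powr a) (x powr (a * r ^ n))) =
    (\<Sum>i<n. recip_sum (primes_in (x powr (a * r ^ i)) (x powr (a * r ^ Suc i))))"
proof (induction n)
  case 0
  have "primes_in (x powr a) (x powr a) = {}" by (auto simp: primes_in_def)
  then show ?case by (simp add: recip_sum_def)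
next
  case (Suc n)
  have "x powr a \<le> x powr (a * r ^ n)" "x powr (a * r ^ n) \<le> x powr (a * r ^ Suc n)"
    using assms by (auto intro!: powr_mono simp: mult_le_cancel_left1 mult_left_mono)
  from primes_in_Un[OF this] Suc show ?case by (simp add: recip_sum_def sum.union_disjoint)
qed

text \<open>Subdivision replaces partial summation. Cutting the exponents into \<open>n\<close>
  pieces of ratio \<open>r n\<close>, an \<open>n\<close>-th root of \<open>c\<close>, makes the
  loss on each piece a factor \<open>r n\<close>. In the limit the total lies between
  \<open>n * ((r n - 1) / r n)\<close> and \<open>n * (r n - 1)\<close>, and both tend to
  \<open>ln c\<close> as \<open>n\<close> grows.\<close>

lemma recip_sum_primes_tendsto:
  assumes "0 < a" "a < b"
  shows "((\<lambda>x. recip_sum (primes_in (x powr a) (x powr b))) \<longlongrightarrow> ln (b / a)) at_top"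
proof -
  define c where "c = b / a"
  have c: "c > 1" "b = a * c" using assms by (auto simp: c_def)
  define r where "r = (\<lambda>n. c powr (1 / real n))"
  define M where "M = (\<lambda>a b x. (\<Sum>p\<in>primes_in (x powr a) (x powr b). ln (real p) / real p) / ln x)"
  have r: "r n > 1" "r n ^ n = c" if "n > 0" for n
    using c that by (auto simp: r_def powr_powr simp flip: powr_realpow)
  \<comment> \<open>The factor \<open>d\<close> selects the end of each piece that replaces the
    exponent of \<open>p\<close>: \<open>d = r n\<close> is the right end, for the lower bound, and
    \<open>d = 1\<close> the left end, for the upper bound.\<close>
  have M: "((\<lambda>x. \<Sum>i<n. M (a * r n ^ i) (a * r n ^ Suc i) x / (d * (a * r n ^ i))) \<longlongrightarrow> real n * ((r n - 1) / d)) at_top"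
    if "n > 0" "d > 0" for n d
  proof -
    have "((\<lambda>x. \<Sum>i<n. M (a * r n ^ i) (a * r n ^ Suc i) x / (d * (a * r n ^ i))) \<longlongrightarrow>
       (\<Sum>i<n. (a * r n ^ Suc i - a * r n ^ i) / (d * (a * r n ^ i)))) at_top"
      unfolding M_def
      using assms r(1)[OF that(1)] that by (intro tendsto_sum tendsto_divide mertens_diff_tendsto tendsto_const) auto
    also have "(\<Sum>i<n. (a * r n ^ Suc i - a * r n ^ i) / (d * (a * r n ^ i))) = (\<Sum>i<n. (r n - 1) / d)"
      using assms r(1)[OF that(1)] that by (intro sum.cong) (auto simp: field_simps)
    finally show ?thesis by simp
  qed
  have lim1: "(\<lambda>n. real n * ((r n - 1) / 1)) \<longlonglongrightarrow> ln c"
    unfolding r_def using c(1) by real_asymp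
  have lim2: "(\<lambda>n. real n * ((r n - 1) / r n)) \<longlonglongrightarrow> ln c"
    unfolding r_def using c(1) by real_asymp
  have sub: "recip_sum (primes_in (x powr a) (x powr b)) =
    (\<Sum>i<n. recip_sum (primes_in (x powr (a * r n ^ i)) (x powr (a * r n ^ Suc i))))" if "n > 0" "x > 1" for n x
    using recip_sum_primes_subdivide[of a "r n" x n] that assms r[of n] c by simp
  have "((\<lambda>x. recip_sum (primes_in (x powr a) (x powr b))) \<longlongrightarrow> ln c) at_top"
  proof (rule order_tendstoI)
    fix e assume "e < ln c"
    then have "\<forall>\<^sub>F n in sequentially. e < real n * ((r n - 1) / r n) \<and> n > 0"
      using lim2 by (intro eventually_conj order_tendstoD eventually_gt_at_top)
    then obtain n where n: "e < real n * ((r n - 1) / r n)" "n > 0" by (auto dest!: eventually_happens'[OF sequentially_bot])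
    then have "\<forall>\<^sub>F x in at_top. e < (\<Sum>i<n. M (a * r n ^ i) (a * r n ^ Suc i) x / (r n * (a * r n ^ i)))"
      using r[of n] by (intro order_tendstoD(1)[OF M]) auto
    with eventually_gt_at_top[of 1] show "\<forall>\<^sub>F x in at_top. e < recip_sum (primes_in (x powr a) (x powr b))"
    proof eventually_elim
      case (elim x)
      have "(\<Sum>i<n. M (a * r n ^ i) (a * r n ^ Suc i) x / (r n * (a * r n ^ i))) \<le> recip_sum (primes_in (x powr a) (x powr b))"
        unfolding sub[OF n(2) elim(1)] M_def
      proof (rule sum_mono)
        fix i
        show "(\<Sum>p\<in>primes_in (x powr (a * r n ^ i)) (x powr (a * r n ^ Suc i)). ln (real p) / real p) / ln x / (r n * (a * r n ^ i))
         \<le> recip_sum (primes_in (x powr (a * r n ^ i)) (x powr (a * r n ^ Suc i)))"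
          using recip_sum_primes_bounds(1)[of "a * r n ^ i" "a * r n ^ Suc i" x] assms r(1)[OF n(2)] elim
          by (simp add: mult_ac)
      qed
      with elim show ?case by linarith
    qed
  next
    fix e assume "e > ln c"
    then have "\<forall>\<^sub>F n in sequentially. e > real n * ((r n - 1) / 1) \<and> n > 0"
      using lim1 by (intro eventually_conj order_tendstoD eventually_gt_at_top)
    then obtain n where n: "e > real n * ((r n - 1) / 1)" "n > 0" by (auto dest!: eventually_happens'[OF sequentially_bot])
    then have "\<forall>\<^sub>F x in at_top. e > (\<Sum>i<n. M (a * r n ^ i) (a * r n ^ Suc i) x / (1 * (a * r n ^ i)))"
      using r[of n] by (intro order_tendstoD(2)[OF M]) auto
    with eventually_gt_at_top[of 1] show "\<forall>\<^sub>F x in at_top. e > recip_sum (primes_in (x powr a) (x powr b))"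
    proof eventually_elim
      case (elim x)
      have "(\<Sum>i<n. M (a * r n ^ i) (a * r n ^ Suc i) x / (1 * (a * r n ^ i))) \<ge> recip_sum (primes_in (x powr a) (x powr b))"
        unfolding sub[OF n(2) elim(1)] M_def
      proof (rule sum_mono)
        fix i
        show "(\<Sum>p\<in>primes_in (x powr (a * r n ^ i)) (x powr (a * r n ^ Suc i)). ln (real p) / real p) / ln x / (1 * (a * r n ^ i))
         \<ge> recip_sum (primes_in (x powr (a * r n ^ i)) (x powr (a * r n ^ Suc i)))"
          using recip_sum_primes_bounds(2)[of "a * r n ^ i" "a * r n ^ Suc i" x] assms r(1)[OF n(2)] elim
          by (simp add: mult_ac)
      qed
      with elim show ?case by linarith
    qed
  qed
  then show ?thesis by (simp add: c_def)
qed

text \<open>Euler's divergence in the form that feeds the orthogonality criterion. A window from x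
  to x^b has reciprocal sum near \<open>ln b\<close>, which exceeds \<open>B\<close> by the choice
  of \<open>b\<close>, and it may begin beyond \<open>k\<close>.\<close>

lemma recip_sum_primes_unbounded:
  "\<exists>P. finite P \<and> (\<forall>p\<in>P. prime p \<and> p > (k::nat)) \<and> recip_sum P > B"
proof -
  define b where "b = exp (\<bar>B\<bar> + 1)"
  have "b > 1" by (simp add: b_def)
  then have "((\<lambda>x. recip_sum (primes_in (x powr 1) (x powr b))) \<longlongrightarrow> ln (b / 1)) at_top"
    by (intro recip_sum_primes_tendsto) auto
  then have "\<forall>\<^sub>F x in at_top. B < recip_sum (primes_in (x powr 1) (x powr b)) \<and> x > max 1 (real k)"
    by (intro eventually_conj order_tendstoD eventually_gt_at_top) (auto simp: b_def)
  then obtain x where x: "B < recip_sum (primes_in (x powr 1) (x powr b))" "x > max 1 (real k)"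
    by (auto dest!: eventually_happens'[OF trivial_limit_at_top_linorder])
  show ?thesis
  proof (intro exI conjI ballI)
    show "B < recip_sum (primes_in (x powr 1) (x powr b))" by (rule x)
    fix p assume "p \<in> primes_in (x powr 1) (x powr b)"
    then show "prime p" "p > k" using x by (auto simp: primes_in_def)
  qed simp
qed

section \<open>The Dickman function\<close>

definition dickman_step :: "(real \<Rightarrow> real) \<Rightarrow> real \<Rightarrow> real" where
  "dickman_step f u = (if u < 0 then 0 else 1 - integral {1..u} (\<lambda>v. f (v - 1) / v))"

lemma dickman_step_le_1: "0 \<le> u \<Longrightarrow> u \<le> 1 \<Longrightarrow> dickman_step f u = 1"
  by (cases "u = 1") (auto simp: dickman_step_def)

lemma dickman_step_integral_deriv:
  assumes "continuous_on {0..} f" "1 \<le> u" "u \<le> b"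
  shows "((\<lambda>u. integral {1..u} (\<lambda>v. f (v - 1) / v)) has_real_derivative f (u - 1) / u) (at u within {1..b})"
proof (rule integral_has_real_derivative)
  show "continuous_on {1..b} (\<lambda>v. f (v - 1) / v)"
    by (intro continuous_intros continuous_on_compose2[OF assms(1)]) auto
qed (use assms in auto)

lemma dickman_step_deriv:
  assumes "continuous_on {0..} f" "1 < u"
  shows "(dickman_step f has_real_derivative - f (u - 1) / u) (at u)"
proof -
  have "((\<lambda>u. integral {1..u} (\<lambda>v. f (v - 1) / v)) has_real_derivative f (u - 1) / u) (at u)"
    using dickman_step_integral_deriv[of f u "u + 1"] assms
    by (simp add: at_within_interior[of u "{1..u + 1}"])
  then have "((\<lambda>u. 1 - integral {1..u} (\<lambda>v. f (v - 1) / v)) has_real_derivative - f (u - 1) / u) (at u)"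
    by (auto intro!: derivative_eq_intros)
  then show ?thesis
    by (rule has_field_derivative_transform_within_open[of _ _ _ "{0<..}"])
      (use assms in \<open>auto simp: dickman_step_def\<close>)
qed

lemma dickman_step_continuous:
  assumes "continuous_on {0..} f"
  shows "continuous_on {0..} (dickman_step f)"
proof -
  have "continuous_on ({0..1} \<union> {1..}) (dickman_step f)"
  proof (rule continuous_on_closed_Un)
    have "continuous_on {0..1} (\<lambda>_. 1 :: real)" by simp
    then show "continuous_on {0..1} (dickman_step f)"
      by (rule continuous_on_eq) (simp add: dickman_step_le_1)
    have "continuous (at u within {1..}) (\<lambda>u. integral {1..u} (\<lambda>v. f (v - 1) / v))" if "u \<ge> 1" for u
    proof -
      have "at u within {1..} = at u within {1..u + 1}"
        by (rule at_within_nhd[of _ "{..<u + 1}"]) auto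
      then show ?thesis
        using dickman_step_integral_deriv[OF assms that, of "u + 1"] by (auto intro: DERIV_continuous)
    qed
    then have "continuous_on {1..} (\<lambda>u. 1 - integral {1..u} (\<lambda>v. f (v - 1) / v))"
      by (intro continuous_intros) (auto simp: continuous_on_eq_continuous_within)
    then show "continuous_on {1..} (dickman_step f)"
      by (rule continuous_on_eq) (auto simp: dickman_step_def)
  qed auto
  also have "{0..1} \<union> {1..} = {0::real..}" by auto
  finally show ?thesis .
qed

text \<open>This is the delay: the value at \<open>u\<close> reads \<open>f\<close> only up to
  \<open>u - 1\<close>. Each application of \<open>dickman_step\<close>, the integrated form of the
  delay equation, therefore extends the range of final values by one.\<close>

lemma dickman_step_cong:
  assumes "\<And>u. u \<le> c \<Longrightarrow> f u = g u" "u \<le> c + 1"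
  shows "dickman_step f u = dickman_step g u"
proof -
  have "integral {1..u} (\<lambda>v. f (v - 1) / v) = integral {1..u} (\<lambda>v. g (v - 1) / v)"
    by (rule Henstock_Kurzweil_Integration.integral_cong) (use assms in auto)
  then show ?thesis by (simp add: dickman_step_def)
qed

definition dickman_iter :: "nat \<Rightarrow> real \<Rightarrow> real" where
  "dickman_iter n = (dickman_step ^^ n) (\<lambda>u. if u < 0 then 0 else 1)"

lemma dickman_iter_Suc: "dickman_iter (Suc n) = dickman_step (dickman_iter n)"
  by (simp add: dickman_iter_def)

lemma dickman_iter_continuous: "continuous_on {0..} (dickman_iter n)"
proof (induction n)
  case 0
  have "continuous_on {0::real..} (\<lambda>_. 1 :: real)" by simp
  then show ?case by (rule continuous_on_eq) (auto simp: dickman_iter_def)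
qed (simp add: dickman_iter_Suc dickman_step_continuous)

lemma dickman_iter_stable_Suc: "u \<le> real n \<Longrightarrow> dickman_iter (Suc n) u = dickman_iter n u"
proof (induction n arbitrary: u)
  case 0
  then show ?case by (auto simp: dickman_iter_def dickman_step_le_1) (simp add: dickman_step_def)
next
  case (Suc n)
  then show ?case
    unfolding dickman_iter_Suc[of "Suc n"] dickman_iter_Suc[of n]
    by (intro dickman_step_cong[of "real n"]) (auto simp: dickman_iter_Suc)
qed

lemma dickman_iter_stable: "n \<le> m \<Longrightarrow> u \<le> real n \<Longrightarrow> dickman_iter m u = dickman_iter n u"
  by (induction m rule: dec_induct) (auto simp: dickman_iter_stable_Suc)

lemma dickman_exists: "\<exists>r. is_dickman r"
proof -
  \<comment> \<open>The iterate of index \<open>n\<close> is final on arguments up to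
    \<open>n\<close>. Around each point \<open>r\<close> thus coincides with a single iterate and
    inherits continuity and derivative from it.\<close>
  define r where "r = (\<lambda>u. dickman_iter (nat \<lceil>u\<rceil>) u)"
  have r: "r u = dickman_iter n u" if "u \<le> real n" for u n
    unfolding r_def by (rule dickman_iter_stable[symmetric]) (use that in linarith)+
  have "is_dickman r"
    unfolding is_dickman_def
  proof (intro conjI allI ballI impI)
    show "continuous_on {0..} r"
      unfolding continuous_on_eq_continuous_within
    proof
      fix u :: real assume u: "u \<in> {0..}"
      obtain n where n: "real n > u" using reals_Archimedean2 by blast
      have "continuous (at u within {0..}) (dickman_iter n)"
        using dickman_iter_continuous[of n] u by (simp add: continuous_on_eq_continuous_within)
      then show "continuous (at u within {0..}) r"
        by (rule continuous_transform_within[of _ _ _ "real n - u"])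
          (use u n r[of _ n] in \<open>auto simp: dist_real_def\<close>)
    qed
  next
    fix u :: real assume "u < 0"
    then show "r u = 0" using r[of u 0] by (simp add: dickman_iter_def)
  next
    fix u :: real assume "u \<in> {0..1}"
    then show "r u = 1" using r[of u 1] by (simp add: dickman_iter_def dickman_step_le_1)
  next
    fix u :: real assume u: "u > 1"
    obtain n where n: "real n > u" using reals_Archimedean2 by blast
    have "(dickman_iter (Suc n) has_real_derivative - dickman_iter n (u - 1) / u) (at u)"
      unfolding dickman_iter_Suc by (rule dickman_step_deriv[OF dickman_iter_continuous u])
    then have "(r has_real_derivative - dickman_iter n (u - 1) / u) (at u)"
      by (rule has_field_derivative_transform_within_open[of _ _ _ "{..<real n + 1}"])
        (use n r[of _ "Suc n"] in auto)
    then show "\<exists>D. (r has_real_derivative D) (at u) \<and> u * D = - r (u - 1)"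
      using u n r[of "u - 1" n] by (intro exI[of _ "- dickman_iter n (u - 1) / u"]) auto
  qed
  then show ?thesis by blast
qed

text \<open>On the part beyond 1 the derivatives of both solutions are determined by the values one
  unit earlier, which agree by induction; the difference is then constant, and it vanishes at
  1.\<close>

lemma dickman_unique:
  assumes "is_dickman r" "is_dickman s"
  shows "r = s"
proof -
  have "\<forall>u\<le>real n + 1. r u = s u" for n
  proof (induction n)
    case 0
    then show ?case using assms unfolding is_dickman_def by (metis atLeastAtMost_iff add_0 linorder_not_le of_nat_0)
  next
    case (Suc n)
    show ?case
    proof (intro allI impI)
      fix u assume u: "u \<le> real (Suc n) + 1"
      show "r u = s u"
      proof (cases "u \<le> real n + 1")
        case False
        then have u1: "u > 1" by simp
        have "r u - s u = r 1 - s 1"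
        proof (rule DERIV_isconst_end[OF u1])
          show "continuous_on {1..u} (\<lambda>u. r u - s u)"
            using assms unfolding is_dickman_def
            by (intro continuous_intros) (auto intro: continuous_on_subset)
          fix v assume v: "1 < v" "v < u"
          obtain D1 D2 where D: "(r has_real_derivative D1) (at v)" "v * D1 = - r (v - 1)"
            "(s has_real_derivative D2) (at v)" "v * D2 = - s (v - 1)"
            using assms v unfolding is_dickman_def by blast
          have "r (v - 1) = s (v - 1)" using Suc v u by auto
          then have "D1 = D2" using D v by (metis mult_cancel_left not_one_less_zero)
          then show "((\<lambda>u. r u - s u) has_real_derivative 0) (at v)"
            using DERIV_diff[OF D(1) D(3)] by simp
        qed
        also have "r 1 - s 1 = 0" using assms by (simp add: is_dickman_def)
        finally show ?thesis by simp
      qed (use Suc in auto)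
    qed
  qed
  moreover have "\<exists>n. u \<le> real n + 1" for u
    using reals_Archimedean2[of u] by (metis add_increasing2 less_imp_le zero_le_one)
  ultimately show ?thesis by (metis ext)
qed

section \<open>Positivity, monotonicity and increments of the Dickman function\<close>

lemma is_dickman_dickman: "is_dickman dickman"
  unfolding dickman_def using dickman_exists dickman_unique by (metis theI)

lemma dickman_continuous: "continuous_on {0..} dickman"
  and dickman_eq_1: "0 \<le> u \<Longrightarrow> u \<le> 1 \<Longrightarrow> dickman u = 1"
  using is_dickman_dickman by (auto simp: is_dickman_def)

lemma dickman_deriv:
  assumes "u > 1" shows "(dickman has_real_derivative - dickman (u - 1) / u) (at u)"
proof -
  obtain D where "(dickman has_real_derivative D) (at u)" "u * D = - dickman (u - 1)"
    using is_dickman_dickman assms unfolding is_dickman_def by blast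
  moreover from this assms have "D = - dickman (u - 1) / u" by (simp add: field_simps)
  ultimately show ?thesis by simp
qed

lemma dickman_integral_deriv:
  assumes "u > 0"
  shows "((\<lambda>u. integral {0..u} dickman) has_real_derivative dickman u) (at u)"
proof -
  have "((\<lambda>u. integral {0..u} dickman) has_real_derivative dickman u) (at u within {0..u + 1})"
    using assms by (intro integral_has_real_derivative continuous_on_subset[OF dickman_continuous]) auto
  then show ?thesis using assms by (simp add: at_within_interior[of u "{0..u + 1}"])
qed

lemma dickman_integral_unit: "integral {0..1} dickman = 1"
proof (rule integral_unique)
  have "((\<lambda>_. 1) has_integral (1 :: real)) {0..1::real}"
    using has_integral_const_real[of "1 :: real" 0 1] by simp
  then show "(dickman has_integral 1) {0..1}"
    by (rule has_integral_eq[rotated]) (simp add: dickman_eq_1)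
qed

text \<open>By the delay equation \<open>u * dickman u\<close> has derivative
  \<open>dickman u - dickman (u - 1)\<close>, as has the right side, and the two agree at 1. This
  form reveals the sign: the value is an integral over the preceding unit interval, divided by
  \<open>u\<close>.\<close>

lemma dickman_integral_eq:
  assumes "u \<ge> 1"
  shows "u * dickman u = integral {0..u} dickman - integral {0..u - 1} dickman"
proof (cases "u = 1")
  case True
  then show ?thesis by (simp add: dickman_eq_1 dickman_integral_unit)
next
  case False
  then have u: "u > 1" using assms by simp
  define I where "I = (\<lambda>u. integral {0..u} dickman)"
  have I: "continuous_on {0..u} I"
    unfolding I_def by (intro indefinite_integral_continuous_1 integrable_continuous_interval
        continuous_on_subset[OF dickman_continuous]) auto
  have "u * dickman u - I u + I (u - 1) = 1 * dickman 1 - I 1 + I (1 - 1)"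
  proof (rule DERIV_isconst_end[OF u])
    show "continuous_on {1..u} (\<lambda>u. u * dickman u - I u + I (u - 1))"
      by (intro continuous_intros continuous_on_subset[OF dickman_continuous] continuous_on_subset[OF I]
        continuous_on_compose2[OF I]) auto
    fix v assume v: "1 < v" "v < u"
    have I': "((\<lambda>u. I (u - 1)) has_real_derivative dickman (v - 1)) (at v)"
      using DERIV_shift[of I "dickman (v - 1)" v "-1"] dickman_integral_deriv[of "v - 1"] v by (simp add: I_def)
    have "((\<lambda>u. u * dickman u - I u + I (u - 1)) has_real_derivative
        1 * dickman v + (- dickman (v - 1) / v) * v - dickman v + dickman (v - 1)) (at v)"
      by (intro derivative_intros DERIV_mult dickman_deriv I' v)
        (use dickman_integral_deriv[of v] v in \<open>auto simp: I_def\<close>)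
    then show "((\<lambda>u. u * dickman u - I u + I (u - 1)) has_real_derivative 0) (at v)"
      using v by simp
  qed
  then show ?thesis by (simp add: I_def dickman_eq_1 dickman_integral_unit)
qed

text \<open>At the first point \<open>z\<close> where positivity fails, \<open>z * dickman z\<close>
  is the integral over the unit interval before \<open>z\<close>, on whose interior the function is
  still positive.\<close>

lemma dickman_pos:
  assumes "u \<ge> 0" shows "dickman u > 0"
proof (rule ccontr)
  assume neg: "\<not> dickman u > 0"
  define S where "S = {v\<in>{0..}. dickman v \<le> 0}"
  define z where "z = Inf S"
  have "closed S" unfolding S_def
    by (intro continuous_on_closed_Collect_le dickman_continuous continuous_on_const closed_atLeast)
  moreover have S: "S \<noteq> {}" "bdd_below S" using assms neg by (auto simp: S_def intro!: bdd_belowI[of _ 0])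
  ultimately have "z \<in> S" unfolding z_def by (intro closed_contains_Inf)
  then have z: "z \<ge> 0" "dickman z \<le> 0" by (auto simp: S_def)
  then have "z > 1" using dickman_eq_1[of z] by (cases "z \<le> 1") auto
  have "integral {0..z - 1} dickman < integral {0..z} dickman"
  proof (rule DERIV_pos_imp_increasing_open[of "z - 1" z "\<lambda>u. integral {0..u} dickman"])
    show "continuous_on {z - 1..z} (\<lambda>u. integral {0..u} dickman)"
      by (rule continuous_on_subset[of "{0..z}"], intro indefinite_integral_continuous_1 integrable_continuous_interval
        continuous_on_subset[OF dickman_continuous]) (use \<open>z > 1\<close> in auto)
    fix v assume v: "z - 1 < v" "v < z"
    then have "v \<notin> S" unfolding z_def using cInf_lower[OF _ S(2)] by force
    then have "dickman v > 0" using v \<open>z > 1\<close> by (auto simp: S_def)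
    then show "\<exists>y. ((\<lambda>u. integral {0..u} dickman) has_real_derivative y) (at v) \<and> 0 < y"
      using dickman_integral_deriv[of v] v \<open>z > 1\<close> by auto
  qed simp
  with dickman_integral_eq[of z] \<open>z > 1\<close> have "z * dickman z > 0" by simp
  with z \<open>z > 1\<close> show False by (simp add: zero_less_mult_iff)
qed

lemma dickman_antimono:
  assumes "0 \<le> u" "u \<le> v" shows "dickman v \<le> dickman u"
proof -
  have 1: "dickman v \<le> dickman u" if "1 \<le> u" "u < v" for u v
  proof -
    have "dickman u \<ge> dickman v"
    proof (rule DERIV_nonpos_imp_decreasing_open[of u v dickman])
      show "continuous_on {u..v} dickman" using that by (intro continuous_on_subset[OF dickman_continuous]) auto
      fix x assume "u < x" "x < v"
      then show "\<exists>y. (dickman has_real_derivative y) (at x) \<and> y \<le> 0"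
        using dickman_deriv[of x] dickman_pos[of "x - 1"] that by (intro exI conjI) (auto simp: divide_simps)
    qed (use that in auto)
    then show ?thesis .
  qed
  consider "u = v" | "v \<le> 1" | "1 \<le> u" "u < v" | "u < 1" "1 < v" using assms by linarith
  then show ?thesis
  proof cases
    case 2
    then show ?thesis using assms by (simp add: dickman_eq_1)
  next
    case 4
    then show ?thesis using 1[of 1 v] assms by (simp add: dickman_eq_1)
  qed (use 1 in auto)
qed

lemma dickman_le_1: "u \<ge> 0 \<Longrightarrow> dickman u \<le> 1"
  using dickman_antimono[of 0 u] by (simp add: dickman_eq_1)

text \<open>Since the function decreases, minus its derivative at \<open>x\<close> lies between
  \<open>dickman (v - 1) / x\<close> and \<open>dickman (u - 1) / x\<close>. The Buchstab sum over a
  window of primes obeys asymptotically the same two bounds, and \<open>smooth_error_step\<close>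
  compares them.\<close>

lemma dickman_diff_bounds:
  assumes "1 \<le> u" "u \<le> v"
  shows "dickman (v - 1) * ln (v / u) \<le> dickman u - dickman v"
    and "dickman u - dickman v \<le> dickman (u - 1) * ln (v / u)"
proof -
  have c: "continuous_on {u..v} (\<lambda>x. dickman x + c * ln x)" for c
    using assms by (intro continuous_intros continuous_on_subset[OF dickman_continuous]) auto
  have d: "((\<lambda>x. dickman x + c * ln x) has_real_derivative (c - dickman (x - 1)) / x) (at x)" if "x > 1" for c x
    using that dickman_deriv[OF that]
    by (auto intro!: derivative_eq_intros simp: field_simps)
  have ln: "ln (v / u) = ln v - ln u" using assms by (simp add: ln_div)
  have "dickman v + dickman (v - 1) * ln v \<le> dickman u + dickman (v - 1) * ln u"
  proof (rule DERIV_nonpos_imp_decreasing_open[OF assms(2) _ c])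
    fix x assume "u < x" "x < v"
    then show "\<exists>y. ((\<lambda>x. dickman x + dickman (v - 1) * ln x) has_real_derivative y) (at x) \<and> y \<le> 0"
      using assms d[of x "dickman (v - 1)"] dickman_antimono[of "x - 1" "v - 1"]
      by (intro exI conjI) (auto intro!: divide_nonpos_pos)
  qed
  then show "dickman (v - 1) * ln (v / u) \<le> dickman u - dickman v" by (simp add: ln algebra_simps)
  have "dickman u + dickman (u - 1) * ln u \<le> dickman v + dickman (u - 1) * ln v"
  proof (rule DERIV_nonneg_imp_increasing_open[OF assms(2) _ c])
    fix x assume "u < x" "x < v"
    then show "\<exists>y. ((\<lambda>x. dickman x + dickman (u - 1) * ln x) has_real_derivative y) (at x) \<and> y \<ge> 0"
      using assms d[of x "dickman (u - 1)"] dickman_antimono[of "u - 1" "x - 1"]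
      by (intro exI conjI) auto
  qed
  then show "dickman u - dickman v \<le> dickman (u - 1) * ln (v / u)" by (simp add: ln algebra_simps)
qed

section \<open>The maximum defining \<open>C3\<close>\<close>

lemma C3_fun_pos:
  assumes "J \<ge> 3" "\<alpha> \<in> C3_range J" shows "C3_fun J \<alpha> > 0"
proof -
  have a: "\<alpha> > 0" "2 * \<alpha> * (real J - 1) < 1" "real J > 1"
    using assms by (auto simp: C3_range_def field_simps)
  then have "1 / (2 * \<alpha> * (real J - 1)) > 1" by (simp add: field_simps)
  then show ?thesis using a by (simp add: C3_fun_def dickman_pos)
qed

text \<open>The range is open, so compactness applies only after both ends are excluded. Near 0 the
  power of \<open>\<alpha> * ln (c / \<alpha>)\<close> tends to 0 while the Dickman factor is at
  most 1; at the right end the logarithm vanishes. The positive value at the midpoint beats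
  both.\<close>

lemma C3_attained:
  assumes "J \<ge> 3"
  shows "\<exists>\<alpha>\<in>C3_range J. C3 J = C3_fun J \<alpha> \<and> (\<forall>\<beta>\<in>C3_range J. C3_fun J \<beta> \<le> C3 J)"
proof -
  define c where "c = 1 / (2 * (real J - 1))"
  have c: "c > 0" using assms by (simp add: c_def)
  have range: "C3_range J = {0<..<c}" by (simp add: C3_range_def c_def)
  have arg: "1 / (2 * \<alpha> * (real J - 1)) = c / \<alpha>" for \<alpha> by (simp add: c_def)
  have mid: "c / 2 \<in> C3_range J" using c by (simp add: range)
  have lim: "((\<lambda>\<alpha>. (\<alpha> * ln (c / \<alpha>)) ^ (J - 1)) \<longlongrightarrow> 0) (at_right 0)"
  proof -
    have "((\<lambda>\<alpha>. \<alpha> * ln (c / \<alpha>)) \<longlongrightarrow> 0) (at_right 0)" using c by real_asymp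
    from tendsto_power[OF this, of "J - 1"] show ?thesis using assms by (simp add: power_0_left)
  qed
  have "\<forall>\<^sub>F \<alpha> in at_right 0. (\<alpha> * ln (c / \<alpha>)) ^ (J - 1) < C3_fun J (c / 2)"
    using C3_fun_pos[OF assms mid] by (rule order_tendstoD(2)[OF lim])
  then obtain d where d: "d > 0" "\<And>\<alpha>. 0 < \<alpha> \<Longrightarrow> \<alpha> < d \<Longrightarrow> (\<alpha> * ln (c / \<alpha>)) ^ (J - 1) < C3_fun J (c / 2)"
    by (auto simp: eventually_at_right_field)
  define e where "e = min d (c / 2)"
  have e: "e > 0" "e \<le> c / 2" "e \<le> d" using d c by (auto simp: e_def)
  have "continuous_on {e..c} (C3_fun J)"
    unfolding C3_fun_def arg using e c
    by (intro continuous_intros continuous_on_compose2[OF dickman_continuous]) auto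
  then obtain a where a: "a \<in> {e..c}" "\<And>b. b \<in> {e..c} \<Longrightarrow> C3_fun J b \<le> C3_fun J a"
    using continuous_attains_sup[of "{e..c}" "C3_fun J"] e c by auto
  have ge: "C3_fun J (c / 2) \<le> C3_fun J a" using e c by (intro a) auto
  have "C3_fun J c = 0" unfolding C3_fun_def arg using assms c by simp
  with ge C3_fun_pos[OF assms mid] have "a \<noteq> c" by auto
  then have ar: "a \<in> C3_range J" using a e by (auto simp: range)
  have max: "C3_fun J b \<le> C3_fun J a" if b: "b \<in> C3_range J" for b
  proof (cases "b < e")
    case True
    have pos: "(b * ln (c / b)) ^ (J - 1) \<ge> 0" using b by (auto simp: range)
    have "C3_fun J b \<le> 1 * (b * ln (c / b)) ^ (J - 1)"
      unfolding C3_fun_def arg using b by (intro mult_right_mono dickman_le_1 pos) (auto simp: range)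
    also have "\<dots> < C3_fun J (c / 2)" using d(2)[of b] True e b by (auto simp: range)
    finally show ?thesis using ge by linarith
  qed (use a b in \<open>auto simp: range\<close>)
  have "C3 J = C3_fun J a"
    unfolding C3_def using ar max by (intro Greatest_equality) auto
  with ar max show ?thesis by auto
qed

lemma C3_pos: "J \<ge> 3 \<Longrightarrow> C3 J > 0"
  using C3_attained C3_fun_pos by metis

section \<open>Smooth numbers\<close>

definition smooth :: "real \<Rightarrow> nat \<Rightarrow> bool" where
  "smooth y m \<longleftrightarrow> m > 0 \<and> (\<forall>p. prime p \<longrightarrow> p dvd m \<longrightarrow> real p \<le> y)"

definition Psi :: "real \<Rightarrow> real \<Rightarrow> real" where
  "Psi x y = real (card {m. smooth y m \<and> real m \<le> x})"

lemma finite_real_le [simp]: "finite {m::nat. P m \<and> real m \<le> x}"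
proof (rule finite_subset)
  show "{m::nat. P m \<and> real m \<le> x} \<subseteq> {..nat \<lfloor>x\<rfloor>}"
    by (auto intro: le_nat_floor)
qed simp

lemma smooth_mono: "smooth y m \<Longrightarrow> y \<le> z \<Longrightarrow> smooth z m"
  unfolding smooth_def by (meson order_trans)

lemma Psi_mono: "y \<le> z \<Longrightarrow> Psi x y \<le> Psi x z"
  unfolding Psi_def by (intro of_nat_mono card_mono) (auto intro: smooth_mono)

lemma pos_le_floor: "{m::nat. m > 0 \<and> real m \<le> x} = {1..nat \<lfloor>x\<rfloor>}"
proof (intro equalityI subsetI)
  fix m assume "m \<in> {1..nat \<lfloor>x\<rfloor>}"
  then show "m \<in> {m. m > 0 \<and> real m \<le> x}" by (cases "x \<ge> 0") (auto simp: le_nat_iff le_floor_iff)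
qed (auto simp: le_nat_floor)

lemma Psi_trivial:
  assumes "0 \<le> x" "x \<le> y" shows "Psi x y = real (nat \<lfloor>x\<rfloor>)"
proof -
  have "{m. smooth y m \<and> real m \<le> x} = {m::nat. m > 0 \<and> real m \<le> x}"
    using assms by (auto simp: smooth_def dest!: dvd_imp_le)
  then show ?thesis by (simp add: Psi_def pos_le_floor)
qed

lemma Psi_le: assumes "0 \<le> x" shows "Psi x y \<le> x"
proof -
  have "Psi x y \<le> Psi x (max x y)" by (rule Psi_mono) simp
  also have "\<dots> = real (nat \<lfloor>x\<rfloor>)" using assms by (intro Psi_trivial) auto
  also have "\<dots> \<le> x" using assms by simp
  finally show ?thesis .
qed

text \<open>The Buchstab identity: sort the new elements by their largest prime factor.\<close>

lemma Psi_diff: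
  assumes "y \<le> z"
  shows "Psi x z - Psi x y = (\<Sum>p\<in>primes_in y z. Psi (x / real p) (real p))"
proof -
  define S where "S = (\<lambda>x y. {m. smooth y m \<and> real m \<le> x})"
  define B where "B = (\<lambda>p. (\<lambda>k. p * k) ` S (x / real p) (real p))"
  have pos: "p > 0" if "p \<in> primes_in y z" for p using that prime_gt_0_nat by (auto simp: primes_in_def)
  have fin: "finite (S x y)" for x y by (simp add: S_def)
  have maxp: "q \<le> p" if "m \<in> B p" "prime q" "q dvd m" "p \<in> primes_in y z" for m p q
  proof -
    from that(1) obtain k where k: "m = p * k" "smooth (real p) k" by (auto simp: B_def S_def)
    from k(1) that have "q dvd p \<or> q dvd k" by (simp add: prime_dvd_mult_iff)
    then show ?thesis
    proof
      assume "q dvd p"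
      then show ?thesis using pos that by (intro dvd_imp_le) auto
    next
      assume "q dvd k"
      then show ?thesis using k that by (auto simp: smooth_def)
    qed
  qed
  have "S x z = S x y \<union> (\<Union>p\<in>primes_in y z. B p)"
  proof (intro equalityI subsetI)
    fix m assume m: "m \<in> S x z"
    then have m0: "m > 0" by (simp add: S_def smooth_def)
    show "m \<in> S x y \<union> (\<Union>p\<in>primes_in y z. B p)"
    proof (cases "smooth y m")
      case False
      then obtain q where q: "prime q" "q dvd m" "real q > y" using m0 by (force simp: smooth_def)
      define p where "p = Max (prime_factors m)"
      have qf: "q \<in> prime_factors m" using q m0 by (auto simp: in_prime_factors_iff)
      then have "p \<in> prime_factors m" unfolding p_def by (intro Max_in) auto
      then have p: "prime p" "p dvd m" by auto
      have "q \<le> p" unfolding p_def using qf by (intro Max_ge) auto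
      then have pin: "p \<in> primes_in y z" using p q m by (auto simp: primes_in_def S_def smooth_def)
      obtain k where k: "m = p * k" using p by (elim dvdE)
      have "smooth (real p) k" unfolding smooth_def
      proof (intro conjI allI impI)
        show "k > 0" using k m0 by simp
        fix r assume "prime r" "r dvd k"
        then have "r \<in> prime_factors m" using k m0 by (auto simp: in_prime_factors_iff)
        then show "real r \<le> real p" unfolding p_def by simp
      qed
      moreover have "real k \<le> x / real p" using m k pos[OF pin] by (simp add: S_def field_simps)
      ultimately show ?thesis using k pin by (auto simp: B_def S_def)
    qed (use m in \<open>auto simp: S_def\<close>)
  next
    fix m assume m: "m \<in> S x y \<union> (\<Union>p\<in>primes_in y z. B p)"
    then show "m \<in> S x z"
    proof
      assume "m \<in> S x y"
      then show ?thesis using assms by (auto simp: S_def intro: smooth_mono)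
    next
      assume "m \<in> (\<Union>p\<in>primes_in y z. B p)"
      then obtain p where p: "p \<in> primes_in y z" "m \<in> B p" by blast
      then obtain k where k: "m = p * k" "smooth (real p) k" "real k \<le> x / real p" by (auto simp: B_def S_def)
      have "real m \<le> x" using k pos[OF p(1)] by (simp add: field_simps)
      moreover have "smooth z m"
        unfolding smooth_def
      proof (intro conjI allI impI)
        show "m > 0" using k pos[OF p(1)] by (simp add: smooth_def)
        fix q assume "prime q" "q dvd m"
        then have "q \<le> p" using maxp p by blast
        then show "real q \<le> z" using p(1) by (simp add: primes_in_def)
      qed
      ultimately show ?thesis by (simp add: S_def)
    qed
  qed
  moreover have "S x y \<inter> (\<Union>p\<in>primes_in y z. B p) = {}"
  proof -
    have "m \<notin> S x y" if "p \<in> primes_in y z" "m \<in> B p" for m p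
      using that by (auto simp: B_def S_def smooth_def primes_in_def)
    then show ?thesis by blast
  qed
  moreover have finB: "finite (B p)" for p unfolding B_def by (intro finite_imageI fin)
  ultimately have "card (S x z) = card (S x y) + card (\<Union>p\<in>primes_in y z. B p)"
    using fin by (simp add: card_Un_disjoint)
  also have "card (\<Union>p\<in>primes_in y z. B p) = (\<Sum>p\<in>primes_in y z. card (B p))"
  proof (rule card_UN_disjoint)
    show "\<forall>p\<in>primes_in y z. \<forall>q\<in>primes_in y z. p \<noteq> q \<longrightarrow> B p \<inter> B q = {}"
    proof (intro ballI impI equals0I)
      fix p q m assume pq: "p \<in> primes_in y z" "q \<in> primes_in y z" "p \<noteq> q" "m \<in> B p \<inter> B q"
      have B_dvd: "r dvd m" if "m \<in> B r" for r using that by (auto simp: B_def)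
      have "p dvd m" "q dvd m" using pq B_dvd by auto
      moreover have "prime p" "prime q" using pq by (auto simp: primes_in_def)
      ultimately
      show False using maxp[of m p q] maxp[of m q p] pq by auto
    qed
  qed (use finB in auto)
  also have "\<dots> = (\<Sum>p\<in>primes_in y z. card (S (x / real p) (real p)))"
    unfolding B_def
  proof (intro sum.cong refl card_image)
    fix p assume "p \<in> primes_in y z"
    then have "p > 0" by (rule pos)
    then show "inj_on ((*) p) (S (x / real p) (real p))" by (intro inj_onI) simp
  qed
  finally show ?thesis by (simp add: Psi_def S_def)
qed

section \<open>The density of the smooth numbers, by induction on u\<close>

definition smooth_density :: "real \<Rightarrow> real \<Rightarrow> real" where
  "smooth_density u x = Psi x (x powr (1 / u)) / x"

lemma smooth_density_tendsto_le_1: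
  assumes "0 < u" "u \<le> 1" shows "(smooth_density u \<longlongrightarrow> 1) at_top"
proof (rule tendsto_sandwich)
  have eq: "smooth_density u x = real (nat \<lfloor>x\<rfloor>) / x" if "x \<ge> 1" for x
  proof -
    have "x powr 1 \<le> x powr (1 / u)" using that assms by (intro powr_mono) auto
    then show ?thesis using that by (simp add: smooth_density_def Psi_trivial)
  qed
  show "\<forall>\<^sub>F x in at_top. 1 - 1 / x \<le> smooth_density u x"
    using eventually_ge_at_top[of 1]
  proof eventually_elim
    case (elim x)
    have "x - 1 \<le> real (nat \<lfloor>x\<rfloor>)" using elim by linarith
    then have "(x - 1) / x \<le> real (nat \<lfloor>x\<rfloor>) / x" using elim by (intro divide_right_mono) auto
    then show ?case using elim by (simp add: eq diff_divide_distrib)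
  qed
  show "\<forall>\<^sub>F x in at_top. smooth_density u x \<le> 1"
    using eventually_ge_at_top[of 1] by eventually_elim (simp add: smooth_density_def Psi_le)
  show "((\<lambda>x::real. 1 - 1 / x) \<longlongrightarrow> 1) at_top" by real_asymp
qed simp

lemma smooth_density_diff:
  assumes "0 < u" "u \<le> v" "x \<ge> 1"
  shows "smooth_density u x - smooth_density v x =
    (\<Sum>p\<in>primes_in (x powr (1 / v)) (x powr (1 / u)). Psi (x / real p) (real p) / (x / real p) * (1 / real p))"
proof -
  have "x powr (1 / v) \<le> x powr (1 / u)" using assms by (intro powr_mono) (auto simp: field_simps)
  then have "smooth_density u x - smooth_density v x =
     (\<Sum>p\<in>primes_in (x powr (1 / v)) (x powr (1 / u)). Psi (x / real p) (real p)) / x"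
    by (simp add: smooth_density_def Psi_diff flip: diff_divide_distrib)
  also have "\<dots> = (\<Sum>p\<in>primes_in (x powr (1 / v)) (x powr (1 / u)). Psi (x / real p) (real p) / (x / real p) * (1 / real p))"
    unfolding sum_divide_distrib using prime_gt_0_nat by (intro sum.cong) (auto simp: primes_in_def)
  finally show ?thesis .
qed

lemma recip_sum_inverse_tendsto:
  assumes "0 < u" "u < v"
  shows "((\<lambda>x. recip_sum (primes_in (x powr (1 / v)) (x powr (1 / u)))) \<longlongrightarrow> ln (v / u)) at_top"
proof -
  have "((\<lambda>x. recip_sum (primes_in (x powr (1 / v)) (x powr (1 / u)))) \<longlongrightarrow> ln ((1 / u) / (1 / v))) at_top"
    using assms by (intro recip_sum_primes_tendsto) (auto simp: field_simps)
  then show ?thesis by simp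
qed

text \<open>The upper limit of the deviation is at most \<open>B\<close>. Carrying a bound instead
  of a limit allows errors to be added up over many short steps in \<open>u\<close>.\<close>

definition smooth_error :: "real \<Rightarrow> real \<Rightarrow> bool" where
  "smooth_error u B \<longleftrightarrow> (\<forall>\<delta>>0. \<forall>\<^sub>F x in at_top. \<bar>smooth_density u x - dickman u\<bar> \<le> B + \<delta>)"

text \<open>The chain of steps starts just above 1, where density and Dickman function both lie
  asymptotically between \<open>1 - ln u\<close> and 1. It cannot start at 1 itself, because a step
  uses the limit at \<open>u - 1\<close>, which is available for positive arguments only.\<close>

lemma smooth_error_first:
  assumes "u > 1" shows "smooth_error u (u - 1)"
  unfolding smooth_error_def
proof (intro allI impI)
  fix \<delta> :: real assume \<delta>: "\<delta> > 0"
  have ln: "0 \<le> ln u" "ln u \<le> u - 1" using assms ln_le_minus_one[of u] by auto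
  have dick: "dickman u \<le> 1" "1 - dickman u \<le> ln u"
    using dickman_le_1[of u] dickman_diff_bounds(2)[of 1 u] assms by (auto simp: dickman_eq_1)
  have "\<forall>\<^sub>F x in at_top. recip_sum (primes_in (x powr (1 / u)) (x powr (1 / 1))) < ln (u / 1) + \<delta> / 2"
    using \<delta> assms by (intro order_tendstoD(2)[OF recip_sum_inverse_tendsto]) auto
  moreover have "\<forall>\<^sub>F x in at_top. smooth_density 1 x > 1 - \<delta> / 2"
    using \<delta> by (intro order_tendstoD(1)[OF smooth_density_tendsto_le_1]) auto
  ultimately show "\<forall>\<^sub>F x in at_top. \<bar>smooth_density u x - dickman u\<bar> \<le> u - 1 + \<delta>"
    using eventually_ge_at_top[of 1]
  proof eventually_elim
    case (elim x)
    have "smooth_density 1 x - smooth_density u x \<le> recip_sum (primes_in (x powr (1 / u)) (x powr (1 / 1)))"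
      unfolding smooth_density_diff[OF zero_less_one less_imp_le[OF assms] elim(3)] recip_sum_def
    proof (rule sum_mono)
      fix p assume "p \<in> primes_in (x powr (1 / u)) (x powr (1 / 1))"
      then have "real p > 0" using prime_gt_0_nat by (auto simp: primes_in_def)
      then have "Psi (x / real p) (real p) / (x / real p) \<le> 1"
        using Psi_le[of "x / real p" "real p"] elim by (simp only: divide_le_eq_1) (simp add: field_simps)
      then have "Psi (x / real p) (real p) / (x / real p) * (1 / real p) \<le> 1 * (1 / real p)"
        by (rule mult_right_mono) simp
      then show "Psi (x / real p) (real p) / (x / real p) * (1 / real p) \<le> 1 / real p" by simp
    qed
    moreover have "smooth_density u x \<le> 1" using Psi_le[of x] elim by (simp add: smooth_density_def)
    ultimately show ?case using elim dick ln \<delta> by simp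
  qed
qed

text \<open>A prime \<open>p\<close> of the window is \<open>X powr (1 / w)\<close> with
  \<open>X = x / p\<close> and \<open>w\<close> between \<open>u - 1\<close> and
  \<open>v - 1\<close>, so its Buchstab term is caught between the two known limits times
  \<open>1 / p\<close>. The decrease of the density and that of the Dickman function then both fall,
  up to a vanishing error, between \<open>b * L\<close> and \<open>a * L\<close>; the length of this
  interval is the added error.\<close>

lemma smooth_error_step:
  assumes uv: "1 < u" "u < v"
    and lim_u: "(smooth_density (u - 1) \<longlongrightarrow> dickman (u - 1)) at_top"
    and lim_v: "(smooth_density (v - 1) \<longlongrightarrow> dickman (v - 1)) at_top"
    and err: "smooth_error u B"
  shows "smooth_error v (B + (dickman (u - 1) - dickman (v - 1)) * (v - u))"
  unfolding smooth_error_def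
proof (intro allI impI)
  fix \<delta> :: real assume \<delta>: "\<delta> > 0"
  define L where "L = ln (v / u)"
  define a where "a = dickman (u - 1)"
  define b where "b = dickman (v - 1)"
  have L: "0 < L" "L \<le> v - u"
  proof -
    show "0 < L" using uv by (simp add: L_def)
    have "L \<le> v / u - 1" unfolding L_def using uv by (intro ln_le_minus_one) auto
    also have "\<dots> = (v - u) / u" using uv by (simp add: field_simps)
    also have "\<dots> \<le> (v - u) / 1" using uv by (intro divide_left_mono) auto
    also have "\<dots> = v - u" by simp
    finally show "L \<le> v - u" .
  qed
  have ab: "b \<le> a" unfolding a_def b_def using uv by (intro dickman_antimono) auto
  define \<epsilon> where "\<epsilon> = \<delta> / (4 * L)"
  have \<epsilon>: "\<epsilon> > 0" using \<delta> L by (simp add: \<epsilon>_def)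
  define P where "P = (\<lambda>x. primes_in (x powr (1 / v)) (x powr (1 / u)))"
  define Q where "Q = (\<lambda>x. recip_sum (P x))"
  have Q: "(Q \<longlongrightarrow> L) at_top" unfolding Q_def P_def L_def using uv by (intro recip_sum_inverse_tendsto) auto
  have small: "\<epsilon> * L < \<delta> / 2" using L \<delta> by (simp add: \<epsilon>_def)
  have "((\<lambda>x. (a + \<epsilon>) * Q x - b * L) \<longlongrightarrow> (a + \<epsilon>) * L - b * L) at_top"
    by (intro tendsto_intros Q)
  moreover have "(a + \<epsilon>) * L - b * L < (a - b) * L + \<delta> / 2" using small by (simp add: algebra_simps)
  ultimately have up: "\<forall>\<^sub>F x in at_top. (a + \<epsilon>) * Q x - b * L < (a - b) * L + \<delta> / 2"
    by (rule order_tendstoD(2))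
  have "((\<lambda>x. a * L - (b - \<epsilon>) * Q x) \<longlongrightarrow> a * L - (b - \<epsilon>) * L) at_top"
    by (intro tendsto_intros Q)
  moreover have "a * L - (b - \<epsilon>) * L < (a - b) * L + \<delta> / 2" using small by (simp add: algebra_simps)
  ultimately have lo: "\<forall>\<^sub>F x in at_top. a * L - (b - \<epsilon>) * Q x < (a - b) * L + \<delta> / 2"
    by (rule order_tendstoD(2))
  have "\<forall>\<^sub>F X in at_top. smooth_density (u - 1) X < a + \<epsilon> \<and> smooth_density (v - 1) X > b - \<epsilon>"
    using \<epsilon> by (intro eventually_conj order_tendstoD(2)[OF lim_u] order_tendstoD(1)[OF lim_v]) (auto simp: a_def b_def)
  then obtain X0 where X0: "\<And>X. X \<ge> X0 \<Longrightarrow> smooth_density (u - 1) X < a + \<epsilon> \<and> smooth_density (v - 1) X > b - \<epsilon>"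
    by (auto simp: eventually_at_top_linorder)
  \<comment> \<open>Every \<open>X = x / p\<close> is at least this power of \<open>x\<close>, so
    the single threshold \<open>X0\<close> serves all primes of the window at once.\<close>
  have "filterlim (\<lambda>x::real. x powr (1 - 1 / u)) at_top at_top" using uv by real_asymp
  then have "\<forall>\<^sub>F x::real in at_top. x powr (1 - 1 / u) \<ge> X0" by (simp add: filterlim_at_top)
  moreover have "\<forall>\<^sub>F x in at_top. \<bar>smooth_density u x - dickman u\<bar> \<le> B + \<delta> / 2"
    using err \<delta> by (simp add: smooth_error_def)
  ultimately show "\<forall>\<^sub>F x in at_top. \<bar>smooth_density v x - dickman v\<bar> \<le> B + (dickman (u - 1) - dickman (v - 1)) * (v - u) + \<delta>"
    using up lo eventually_gt_at_top[of 1]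
  proof eventually_elim
    case (elim x)
    have bounds: "b - \<epsilon> \<le> Psi (x / real p) (real p) / (x / real p)" "Psi (x / real p) (real p) / (x / real p) \<le> a + \<epsilon>"
      "real p > 0" if p: "p \<in> P x" for p
    proof -
      have p': "x powr (1 / v) < real p" "real p \<le> x powr (1 / u)" using p by (auto simp: P_def primes_in_def)
      show p0: "real p > 0" using p' by (meson le_less_trans powr_ge_zero)
      define X where "X = x / real p"
      have X1: "x powr (1 - 1 / u) \<le> X"
      proof -
        have "x powr (1 - 1 / u) = x / x powr (1 / u)" using elim by (simp add: powr_diff)
        also have "\<dots> \<le> X" unfolding X_def using p' p0 elim by (intro divide_left_mono) auto
        finally show ?thesis .
      qed
      have X2: "X \<le> x powr (1 - 1 / v)"
      proof -
        have "X \<le> x / x powr (1 / v)" unfolding X_def using p' p0 elim by (intro divide_left_mono) auto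
        also have "\<dots> = x powr (1 - 1 / v)" using elim by (simp add: powr_diff)
        finally show ?thesis .
      qed
      have Xpos: "X > 0" using p0 elim by (simp add: X_def)
      have "real p \<le> x powr (1 / u)" by (rule p')
      also have "\<dots> = (x powr (1 - 1 / u)) powr (1 / (u - 1))"
        using uv by (simp add: powr_powr field_simps)
      also have "\<dots> \<le> X powr (1 / (u - 1))" using X1 uv by (intro powr_mono2) auto
      finally have "Psi X (real p) \<le> Psi X (X powr (1 / (u - 1)))" by (rule Psi_mono)
      then have "Psi X (real p) / X \<le> smooth_density (u - 1) X"
        unfolding smooth_density_def using Xpos by (intro divide_right_mono) auto
      then show "Psi (x / real p) (real p) / (x / real p) \<le> a + \<epsilon>"
        using X0[of X] X1 elim by (simp flip: X_def)
      have "X powr (1 / (v - 1)) \<le> (x powr (1 - 1 / v)) powr (1 / (v - 1))"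
        using X2 Xpos uv by (intro powr_mono2) auto
      also have "\<dots> = x powr (1 / v)" using uv by (simp add: powr_powr field_simps)
      also have "\<dots> \<le> real p" using p' by simp
      finally have "Psi X (X powr (1 / (v - 1))) \<le> Psi X (real p)" by (rule Psi_mono)
      then have "smooth_density (v - 1) X \<le> Psi X (real p) / X"
        unfolding smooth_density_def using Xpos by (intro divide_right_mono) auto
      then show "b - \<epsilon> \<le> Psi (x / real p) (real p) / (x / real p)"
        using X0[of X] X1 elim by (simp flip: X_def)
    qed
    have diff: "smooth_density u x - smooth_density v x =
       (\<Sum>p\<in>P x. Psi (x / real p) (real p) / (x / real p) * (1 / real p))"
      unfolding P_def using uv elim by (intro smooth_density_diff) auto
    have "smooth_density u x - smooth_density v x \<le> (a + \<epsilon>) * Q x"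
      unfolding diff Q_def recip_sum_def sum_distrib_left using bounds by (intro sum_mono mult_right_mono) auto
    moreover have "smooth_density u x - smooth_density v x \<ge> (b - \<epsilon>) * Q x"
      unfolding diff Q_def recip_sum_def sum_distrib_left using bounds by (intro sum_mono mult_right_mono) auto
    moreover have "b * L \<le> dickman u - dickman v" "dickman u - dickman v \<le> a * L"
      using dickman_diff_bounds[of u v] uv by (auto simp: a_def b_def L_def)
    ultimately have "\<bar>(smooth_density u x - smooth_density v x) - (dickman u - dickman v)\<bar> \<le> (a - b) * L + \<delta> / 2"
      using elim by linarith
    also have "\<dots> \<le> (a - b) * (v - u) + \<delta> / 2"
      using ab L by (intro add_right_mono mult_left_mono) auto
    finally show ?case using elim by (simp flip: a_def b_def)
  qed
qed

text \<open>Cutting the way from 1 to \<open>u\<close> into steps of length \<open>h\<close> costs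
  \<open>h\<close> for the first step and \<open>h\<close> times the decrease of
  \<open>dickman\<close> over one step for each later one. By monotonicity these decreases telescope
  to at most 1, so the total stays below \<open>2 * h\<close> however many steps there are.\<close>

lemma smooth_density_tendsto_step:
  assumes "u > 1" and IH: "\<And>w. 0 < w \<Longrightarrow> w \<le> u - 1 \<Longrightarrow> (smooth_density w \<longlongrightarrow> dickman w) at_top"
  shows "(smooth_density u \<longlongrightarrow> dickman u) at_top"
proof (rule tendstoI)
  fix \<epsilon> :: real assume \<epsilon>: "\<epsilon> > 0"
  obtain k :: nat where k: "real k > 4 * (u - 1) / \<epsilon>" using reals_Archimedean2 by blast
  then have k0: "k > 0" using \<epsilon> assms by (intro gr0I) (auto simp: not_less divide_simps)
  define h where "h = (u - 1) / real k"
  have h: "h > 0" "real k * h = u - 1" "4 * h < \<epsilon>"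
    using k k0 assms \<epsilon> by (auto simp: h_def field_simps)
  have "Suc i \<le> k \<Longrightarrow> smooth_error (1 + real (Suc i) * h) (h + h * (dickman h - dickman (real (Suc i) * h)))" for i
  proof (induction i)
    case 0
    then show ?case using smooth_error_first[of "1 + h"] h by simp
  next
    case (Suc i)
    have le: "real (Suc (Suc i)) * h \<le> u - 1" unfolding h(2)[symmetric] using Suc h by (intro mult_right_mono) auto
    have "smooth_error (1 + real (Suc (Suc i)) * h)
      ((h + h * (dickman h - dickman (real (Suc i) * h))) +
       (dickman ((1 + real (Suc i) * h) - 1) - dickman ((1 + real (Suc (Suc i)) * h) - 1)) *
       ((1 + real (Suc (Suc i)) * h) - (1 + real (Suc i) * h)))"
    proof (rule smooth_error_step)
      show "smooth_error (1 + real (Suc i) * h) (h + h * (dickman h - dickman (real (Suc i) * h)))"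
        using Suc by simp
      show "(smooth_density (1 + real (Suc i) * h - 1) \<longlongrightarrow> dickman (1 + real (Suc i) * h - 1)) at_top"
        using le h by (intro IH) (auto simp: algebra_simps add_pos_nonneg add_nonneg_pos)
      show "(smooth_density (1 + real (Suc (Suc i)) * h - 1) \<longlongrightarrow> dickman (1 + real (Suc (Suc i)) * h - 1)) at_top"
        using le h by (intro IH) (auto simp: algebra_simps add_pos_nonneg add_nonneg_pos)
    qed (use h in \<open>auto simp: algebra_simps add_pos_nonneg\<close>)
    also have "((h + h * (dickman h - dickman (real (Suc i) * h))) +
       (dickman ((1 + real (Suc i) * h) - 1) - dickman ((1 + real (Suc (Suc i)) * h) - 1)) *
       ((1 + real (Suc (Suc i)) * h) - (1 + real (Suc i) * h))) =
       h + h * (dickman h - dickman (real (Suc (Suc i)) * h))"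
      by (simp add: algebra_simps)
    finally show ?case .
  qed
  from this[of "k - 1"] k0 have err: "smooth_error u (h + h * (dickman h - dickman (u - 1)))"
    using h by simp
  have "h * (dickman h - dickman (u - 1)) \<le> h * 1"
    using h dickman_le_1[of h] dickman_pos[of "u - 1"] assms by (intro mult_left_mono) auto
  with h have small: "h + h * (dickman h - dickman (u - 1)) + \<epsilon> / 4 < \<epsilon>" by linarith
  have "\<forall>\<^sub>F x in at_top. \<bar>smooth_density u x - dickman u\<bar> \<le> h + h * (dickman h - dickman (u - 1)) + \<epsilon> / 4"
    using err \<epsilon> unfolding smooth_error_def by (meson zero_less_divide_iff zero_less_numeral)
  then show "\<forall>\<^sub>F x in at_top. dist (smooth_density u x) (dickman u) < \<epsilon>"
    by eventually_elim (use small in \<open>simp add: dist_real_def\<close>)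
qed

theorem smooth_density_tendsto:
  assumes "u > 0" shows "(smooth_density u \<longlongrightarrow> dickman u) at_top"
proof -
  have "\<forall>u. 0 < u \<longrightarrow> u \<le> real n + 1 \<longrightarrow> (smooth_density u \<longlongrightarrow> dickman u) at_top" for n
  proof (induction n)
    case 0
    then show ?case using smooth_density_tendsto_le_1 by (simp add: dickman_eq_1)
  next
    case (Suc n)
    show ?case
    proof (intro allI impI)
      fix u :: real assume u: "0 < u" "u \<le> real (Suc n) + 1"
      show "(smooth_density u \<longlongrightarrow> dickman u) at_top"
      proof (cases "u \<le> 1")
        case True
        then show ?thesis using smooth_density_tendsto_le_1[of u] u by (simp add: dickman_eq_1)
      next
        case False
        show ?thesis
        proof (rule smooth_density_tendsto_step)
          fix w assume w: "0 < w" "w \<le> u - 1"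
          then have "w \<le> real n + 1" using u by simp
          with w show "(smooth_density w \<longlongrightarrow> dickman w) at_top" using Suc by blast
        qed (use False in simp)
      qed
    qed
  qed
  moreover obtain n :: nat where "u < real n" using reals_Archimedean2 by blast
  then have "u \<le> real n + 1" by simp
  ultimately show ?thesis using assms by blast
qed

section \<open>Prime divisors of values of linear forms\<close>

lemma card_residue_class:
  assumes "R > 0"
  shows "\<bar>real (card {a\<in>{1..X}. [a = e] (mod R)}) - real X / real R\<bar> \<le> 1"
proof -
  let ?S = "{a\<in>{1..X}. [a = e] (mod R)}"
  \<comment> \<open>The representative is taken in \<open>{1..R}\<close> because the counting range
    starts at 1: each of the \<open>X div R\<close> full blocks then contains exactly one shift of
    it.\<close>
  define r where "r = (if e mod R = 0 then R else e mod R)"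
  have r: "1 \<le> r" "r \<le> R" "[r = e] (mod R)"
    using assms by (cases "e mod R = 0"; simp add: r_def Cong.cong_def less_imp_le)+
  have "(\<lambda>i. i * R + r) ` {..<X div R} \<subseteq> ?S"
  proof
    fix a assume "a \<in> (\<lambda>i. i * R + r) ` {..<X div R}"
    then obtain i where i: "a = i * R + r" "i < X div R" by auto
    have "a \<le> Suc i * R" using i r by simp
    also have "\<dots> \<le> X div R * R" using i by (intro mult_le_mono1) simp
    also have "\<dots> \<le> X" by (rule div_times_less_eq_dividend)
    finally have "a \<le> X" .
    moreover have "[i * R + r = 0 + e] (mod R)" using r by (intro cong_add) (simp_all add: Cong.cong_def)
    ultimately show "a \<in> ?S" using i r by simp
  qed
  moreover have "inj_on (\<lambda>i. i * R + r) {..<X div R}" using assms by (auto intro: inj_onI)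
  ultimately have "X div R \<le> card ?S"
    using card_inj_on_le[of "\<lambda>i. i * R + r" "{..<X div R}" ?S] by simp
  moreover have "real X / real R \<le> real (X div R) + 1"
  proof -
    have "X \<le> R + X div R * R" using assms by (intro less_imp_le dividend_less_div_times)
    then have "real X \<le> real R + real (X div R) * real R" by (simp flip: of_nat_mult of_nat_add)
    then show ?thesis using assms by (simp add: field_simps)
  qed
  moreover have "card ?S \<le> X div R + 1"
  proof -
    have "inj_on (\<lambda>a. (a - 1) div R) ?S"
    proof (rule inj_onI)
      fix a b assume ab: "a \<in> ?S" "b \<in> ?S" "(a - 1) div R = (b - 1) div R"
      then have "[(a - 1) + 1 = (b - 1) + 1] (mod R)" by (auto simp: Cong.cong_def)
      then have "[a - 1 = b - 1] (mod R)" by (simp only: cong_add_rcancel_nat)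
      then have "(a - 1) mod R = (b - 1) mod R" by (simp only: Cong.cong_def)
      with ab have "a - 1 = b - 1" by (metis div_mult_mod_eq)
      then show "a = b" using ab by auto
    qed
    moreover have "(\<lambda>a. (a - 1) div R) ` ?S \<subseteq> {..X div R}" by (auto intro!: div_le_mono)
    ultimately show ?thesis using card_inj_on_le[of "\<lambda>a. (a - 1) div R" ?S "{..X div R}"] by simp
  qed
  moreover have "real (X div R) \<le> real X / real R" by (rule of_nat_div_le_of_nat)
  ultimately show ?thesis by linarith
qed

lemma linear_congruence_solution:
  fixes p c :: nat and h :: int
  assumes "prime p" "\<not> p dvd c"
  shows "\<exists>u. \<forall>a. int p dvd int c * int a + h \<longleftrightarrow> [a = u] (mod p)"
proof -
  have "coprime p c" using assms by (rule prime_imp_coprime)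
  then have "coprime (int c) (int p)" by (simp add: ac_simps)
  then obtain d where d: "[int c * d = 1] (mod int p)" using cong_solve_coprime_int by blast
  have p: "int p > 0" using assms prime_gt_0_nat by simp
  define u where "u = nat ((- d * h) mod int p)"
  have u: "[int u = - d * h] (mod int p)" using p by (simp add: u_def Cong.cong_def)
  have "int p dvd int c * int a + h \<longleftrightarrow> [a = u] (mod p)" for a
  proof -
    have cu: "[int c * int u + h = 0] (mod int p)"
    proof -
      have "[int c * int u + h = int c * (- d * h) + h] (mod int p)" using u by (intro cong_add cong_mult) auto
      also have "int c * (- d * h) + h = (int c * d) * (- h) + h" by simp
      also have "[\<dots> = 1 * (- h) + h] (mod int p)" using d by (intro cong_add cong_mult) auto
      finally show ?thesis by simp
    qed
    have "int p dvd int c * int a + h \<longleftrightarrow> [int c * int a + h = int c * int u + h] (mod int p)"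
      using cu by (metis cong_0_iff cong_sym cong_trans)
    also have "\<dots> \<longleftrightarrow> [int a = int u] (mod int p)"
      using \<open>coprime (int c) (int p)\<close> by (simp add: cong_add_rcancel cong_mult_lcancel)
    finally show ?thesis by (simp add: cong_int_iff)
  qed
  then show ?thesis by blast
qed

text \<open>\<open>g\<close> assigns a prime to each linear form. A prime that misses the leading
  coefficient turns divisibility into one residue class; injectivity makes the moduli coprime, and
  the Chinese remainder theorem joins the classes.\<close>

lemma simultaneous_congruences:
  fixes T :: "(nat \<times> int) set"
  assumes "finite T" "inj_on g T" "\<And>t. t \<in> T \<Longrightarrow> prime (g t)" "\<And>t. t \<in> T \<Longrightarrow> \<not> g t dvd fst t"
  shows "\<exists>e. \<forall>a. (\<forall>t\<in>T. int (g t) dvd int (fst t) * int a + snd t) \<longleftrightarrow> [a = e] (mod (\<Prod>t\<in>T. g t))"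
proof -
  have "\<exists>u. \<forall>a. int (g t) dvd int (fst t) * int a + snd t \<longleftrightarrow> [a = u] (mod g t)" if "t \<in> T" for t
    using assms that by (intro linear_congruence_solution)
  then obtain u where u: "\<And>t a. t \<in> T \<Longrightarrow> int (g t) dvd int (fst t) * int a + snd t \<longleftrightarrow> [a = u t] (mod g t)"
    by metis
  have cop: "coprime (g s) (g t)" if "s \<in> T" "t \<in> T" "s \<noteq> t" for s t
    using assms that by (intro primes_coprime) (auto dest: inj_onD)
  then obtain e where e: "\<And>t. t \<in> T \<Longrightarrow> [e = u t] (mod g t)"
    using chinese_remainder_nat[OF assms(1), of g u] by blast
  have "(\<forall>t\<in>T. [a = u t] (mod g t)) \<longleftrightarrow> [a = e] (mod (\<Prod>t\<in>T. g t))" for a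
  proof
    assume "\<forall>t\<in>T. [a = u t] (mod g t)"
    then have "[a = e] (mod g t)" if "t \<in> T" for t
      using cong_trans[OF _ cong_sym[OF e[OF that]]] that by blast
    with cop show "[a = e] (mod (\<Prod>t\<in>T. g t))" by (intro coprime_cong_prod_nat)
  next
    assume a: "[a = e] (mod (\<Prod>t\<in>T. g t))"
    show "\<forall>t\<in>T. [a = u t] (mod g t)"
    proof
      fix t assume t: "t \<in> T"
      then have "g t dvd (\<Prod>t\<in>T. g t)" using assms(1) by (intro dvd_prodI)
      with a have "[a = e] (mod g t)" by (rule cong_dvd_modulus_nat)
      with e[OF t] show "[a = u t] (mod g t)" by (rule cong_trans[rotated])
    qed
  qed
  then show ?thesis using u by auto
qed

section \<open>Mean values of products of prime-divisor counts\<close>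

definition omega :: "nat set \<Rightarrow> int \<Rightarrow> real" where
  "omega I k = (\<Sum>r\<in>I. of_bool (int r dvd k))"

lemma omega_nonneg: "omega I k \<ge> 0" by (simp add: omega_def sum_nonneg)

lemma recip_sum_nonneg: "recip_sum I \<ge> 0" by (simp add: recip_sum_def sum_nonneg)

lemma recip_sum_power:
  assumes "finite I" "finite T"
  shows "(\<Sum>g\<in>T \<rightarrow>\<^sub>E I. \<Prod>t\<in>T. 1 / real (g t)) = recip_sum I ^ card T"
  using prod_sum_PiE[of T "\<lambda>_. I" "\<lambda>_ r. 1 / real r"] assms by (simp add: recip_sum_def)

lemma sum_collision_le:
  assumes "finite I" "finite T" "s \<in> T" "t \<in> T" "s \<noteq> t" "y > 0" "\<And>r. r \<in> I \<Longrightarrow> real r > y"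
  shows "(\<Sum>g\<in>{g \<in> T \<rightarrow>\<^sub>E I. g s = g t}. \<Prod>u\<in>T. 1 / real (g u)) \<le> recip_sum I ^ (card T - 1) / y"
proof -
  let ?E = "{g \<in> T \<rightarrow>\<^sub>E I. g s = g t}"
  let ?T = "T - {t}"
  have "(\<Sum>g\<in>?E. \<Prod>u\<in>T. 1 / real (g u)) \<le> (\<Sum>g\<in>?E. (\<Prod>u\<in>?T. 1 / real (g u)) * (1 / y))"
  proof (rule sum_mono)
    fix g assume g: "g \<in> ?E"
    then have "real (g t) > y" using assms by (auto simp: PiE_iff)
    then have "1 / real (g t) \<le> 1 / y" using assms by (intro divide_left_mono) auto
    then have "(\<Prod>u\<in>?T. 1 / real (g u)) * (1 / real (g t)) \<le> (\<Prod>u\<in>?T. 1 / real (g u)) * (1 / y)"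
      by (intro mult_left_mono prod_nonneg) auto
    then show "(\<Prod>u\<in>T. 1 / real (g u)) \<le> (\<Prod>u\<in>?T. 1 / real (g u)) * (1 / y)"
      using assms by (subst prod.remove[of T t]) (auto simp: mult.commute)
  qed
  also have "\<dots> = (\<Sum>g\<in>?E. \<Prod>u\<in>?T. 1 / real (g u)) / y"
    by (simp add: sum_divide_distrib)
  also have "(\<Sum>g\<in>?E. \<Prod>u\<in>?T. 1 / real (g u)) = (\<Sum>g\<in>(\<lambda>g. restrict g ?T) ` ?E. \<Prod>u\<in>?T. 1 / real (g u))"
  proof (subst sum.reindex)
    show "inj_on (\<lambda>g. restrict g ?T) ?E"
    proof (rule inj_onI)
      fix g h assume gh: "g \<in> ?E" "h \<in> ?E" "restrict g ?T = restrict h ?T"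
      have eq: "g u = h u" if "u \<in> ?T" for u using fun_cong[OF gh(3), of u] that by simp
      have "g u = h u" for u
      proof (cases "u \<in> T")
        case True
        then show ?thesis using eq[of u] eq[of s] gh assms by (cases "u = t") auto
      next
        case False
        then show ?thesis using gh by (auto simp: PiE_iff extensional_def)
      qed
      then show "g = h" by blast
    qed
  qed simp
  also have "\<dots> \<le> (\<Sum>g\<in>?T \<rightarrow>\<^sub>E I. \<Prod>u\<in>?T. 1 / real (g u))"
  proof (rule sum_mono2)
    show "(\<lambda>g. restrict g ?T) ` ?E \<subseteq> ?T \<rightarrow>\<^sub>E I"
    proof
      fix h assume "h \<in> (\<lambda>g. restrict g ?T) ` ?E"
      then obtain g where h: "h = restrict g ?T" and g: "g \<in> T \<rightarrow>\<^sub>E I" by blast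
      show "h \<in> ?T \<rightarrow>\<^sub>E I" unfolding h restrict_PiE_iff using PiE_mem[OF g] by blast
    qed
  qed (use assms in \<open>auto intro!: finite_PiE prod_nonneg\<close>)
  also have "\<dots> = recip_sum I ^ (card T - 1)"
    using assms by (subst recip_sum_power) auto
  finally show ?thesis using assms by (simp add: divide_right_mono)
qed

text \<open>The linear form \<open>c a + h\<close> is encoded as the pair \<open>(c, h)\<close>. A prime dividing two different
  forms at once divides their resultant, so the choices of equal primes contribute nothing.\<close>

lemma sum_prod_omega:
  fixes T :: "(nat \<times> int) set"
  assumes fin: "finite I" "finite T" and y: "y > 0"
    and I: "\<And>r. r \<in> I \<Longrightarrow> prime r \<and> real r > y"
    and lead: "\<And>r t. r \<in> I \<Longrightarrow> t \<in> T \<Longrightarrow> \<not> r dvd fst t"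
    and res: "\<And>r s t. r \<in> I \<Longrightarrow> s \<in> T \<Longrightarrow> t \<in> T \<Longrightarrow> s \<noteq> t \<Longrightarrow>
      \<not> int r dvd int (fst s) * snd t - int (fst t) * snd s"
  shows "\<bar>(\<Sum>a=1..X. \<Prod>t\<in>T. omega I (int (fst t) * int a + snd t)) - real X * recip_sum I ^ card T\<bar>
    \<le> real (card I) ^ card T + real X * (real (card T) ^ 2 * recip_sum I ^ (card T - 1) / y)"
proof -
  define G where "G = (T \<rightarrow>\<^sub>E I)"
  define w where "w = (\<lambda>g. \<Prod>t\<in>T. 1 / real (g t))"
  define N where "N = (\<lambda>g. real (card {a\<in>{1..X}. \<forall>t\<in>T. int (g t) dvd int (fst t) * int a + snd t}))"
  have finG: "finite G" unfolding G_def using fin by (intro finite_PiE)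
  have w: "w g \<ge> 0" for g unfolding w_def by (intro prod_nonneg) auto
  \<comment> \<open>Expanding the product yields one term for each choice \<open>g\<close> of a
    prime per form.\<close>
  have "(\<Sum>a=1..X. \<Prod>t\<in>T. omega I (int (fst t) * int a + snd t)) =
    (\<Sum>a=1..X. \<Sum>g\<in>G. \<Prod>t\<in>T. of_bool (int (g t) dvd int (fst t) * int a + snd t))"
    unfolding omega_def G_def using fin by (subst prod_sum_PiE) auto
  also have "\<dots> = (\<Sum>g\<in>G. \<Sum>a=1..X. \<Prod>t\<in>T. of_bool (int (g t) dvd int (fst t) * int a + snd t))"
    by (rule sum.swap)
  also have "\<dots> = (\<Sum>g\<in>G. N g)"
  proof (rule sum.cong[OF refl])
    fix g
    have "(\<Prod>t\<in>T. of_bool (int (g t) dvd int (fst t) * int a + snd t) :: real) =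
      of_bool (\<forall>t\<in>T. int (g t) dvd int (fst t) * int a + snd t)" for a
      using fin by (auto simp: prod_zero_iff)
    then show "(\<Sum>a=1..X. \<Prod>t\<in>T. of_bool (int (g t) dvd int (fst t) * int a + snd t)) = N g"
      by (simp add: N_def sum_of_bool_eq Int_def)
  qed
  finally have lhs: "(\<Sum>a=1..X. \<Prod>t\<in>T. omega I (int (fst t) * int a + snd t)) = (\<Sum>g\<in>G. N g)" .
  have rhs: "real X * recip_sum I ^ card T = (\<Sum>g\<in>G. real X * w g)"
    unfolding G_def w_def sum_distrib_left[symmetric] recip_sum_power[OF fin] ..
  \<comment> \<open>An injective \<open>g\<close> costs only the rounding error 1 of a residue
    class. For any other \<open>g\<close> the count \<open>N g\<close> is 0, so its share
    \<open>X * w g\<close> of the main term is itself the error, and the sum over colliding pairs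
    dominates it.\<close>
  have each: "\<bar>N g - real X * w g\<bar> \<le> 1 + real X * (\<Sum>(s,t)\<in>{(s,t)\<in>T \<times> T. s \<noteq> t}. of_bool (g s = g t) * w g)"
    if g: "g \<in> G" for g
  proof (cases "inj_on g T")
    case True
    have gt: "g t \<in> I" if "t \<in> T" for t using g that by (auto simp: G_def)
    obtain e where e: "\<And>a. (\<forall>t\<in>T. int (g t) dvd int (fst t) * int a + snd t) \<longleftrightarrow> [a = e] (mod (\<Prod>t\<in>T. g t))"
      using simultaneous_congruences[OF fin(2) True] I lead gt by blast
    have "(\<Prod>t\<in>T. g t) > 0" using I gt by (intro prod_pos) (auto intro: prime_gt_0_nat)
    from card_residue_class[OF this, of X e]
    have "\<bar>N g - real X * w g\<bar> \<le> 1" by (simp add: N_def e w_def prod_dividef)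
    moreover have "0 \<le> (\<Sum>(s,t)\<in>{(s,t)\<in>T \<times> T. s \<noteq> t}. of_bool (g s = g t) * w g)"
      using w by (intro sum_nonneg) auto
    ultimately show ?thesis by (smt (verit) mult_nonneg_nonneg of_nat_0_le_iff)
  next
    case False
    then obtain s t where st: "s \<in> T" "t \<in> T" "s \<noteq> t" "g s = g t" by (auto simp: inj_on_def)
    have gs: "g s \<in> I" using g st by (auto simp: G_def)
    have "\<not> (\<forall>t\<in>T. int (g t) dvd int (fst t) * int a + snd t)" for a
    proof
      assume "\<forall>t\<in>T. int (g t) dvd int (fst t) * int a + snd t"
      then have "int (g s) dvd int (fst s) * int a + snd s" "int (g s) dvd int (fst t) * int a + snd t"
        using st by metis+
      then have "int (g s) dvd int (fst s) * (int (fst t) * int a + snd t) - int (fst t) * (int (fst s) * int a + snd s)"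
        by (intro dvd_diff dvd_mult)
      also have "\<dots> = int (fst s) * snd t - int (fst t) * snd s" by (simp add: algebra_simps)
      finally show False using res[OF gs st(1-3)] by blast
    qed
    then have "N g = 0" by (simp add: N_def)
    moreover have "w g \<le> (\<Sum>(s,t)\<in>{(s,t)\<in>T \<times> T. s \<noteq> t}. of_bool (g s = g t) * w g)"
    proof -
      have "w g = (\<Sum>(s,t)\<in>{(s,t)}. of_bool (g s = g t) * w g)" using st by simp
      also have "\<dots> \<le> (\<Sum>(s,t)\<in>{(s,t)\<in>T \<times> T. s \<noteq> t}. of_bool (g s = g t) * w g)"
        using st w fin by (intro sum_mono2) (auto intro: finite_subset[of _ "T \<times> T"])
      finally show ?thesis .
    qed
    then have "real X * w g \<le> real X * (\<Sum>(s,t)\<in>{(s,t)\<in>T \<times> T. s \<noteq> t}. of_bool (g s = g t) * w g)"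
      by (rule mult_left_mono) simp
    ultimately show ?thesis using w[of g] by simp
  qed
  have "\<bar>(\<Sum>g\<in>G. N g) - (\<Sum>g\<in>G. real X * w g)\<bar> \<le> (\<Sum>g\<in>G. \<bar>N g - real X * w g\<bar>)"
    by (simp add: sum_abs flip: sum_subtractf)
  also have "\<dots> \<le> (\<Sum>g\<in>G. 1 + real X * (\<Sum>(s,t)\<in>{(s,t)\<in>T \<times> T. s \<noteq> t}. of_bool (g s = g t) * w g))"
    by (rule sum_mono) (rule each)
  also have "\<dots> = real (card G) + real X * (\<Sum>g\<in>G. \<Sum>(s,t)\<in>{(s,t)\<in>T \<times> T. s \<noteq> t}. of_bool (g s = g t) * w g)"
    by (simp add: sum.distrib sum_distrib_left)
  also have "(\<Sum>g\<in>G. \<Sum>(s,t)\<in>{(s,t)\<in>T \<times> T. s \<noteq> t}. of_bool (g s = g t) * w g) =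
      (\<Sum>(s,t)\<in>{(s,t)\<in>T \<times> T. s \<noteq> t}. \<Sum>g\<in>G. of_bool (g s = g t) * w g)"
    unfolding case_prod_beta by (rule sum.swap)
  also have "\<dots> \<le> (\<Sum>(s,t)\<in>{(s,t)\<in>T \<times> T. s \<noteq> t}. recip_sum I ^ (card T - 1) / y)"
  proof (rule sum_mono)
    fix q assume "q \<in> {(s,t)\<in>T \<times> T. s \<noteq> t}"
    then obtain s t where st: "q = (s,t)" "s \<in> T" "t \<in> T" "s \<noteq> t" by (cases q) auto
    have "(\<Sum>g\<in>G. of_bool (g s = g t) * w g) = (\<Sum>g\<in>{g\<in>G. g s = g t}. w g)"
      unfolding sum.inter_filter[OF finG] by (rule sum.cong) auto
    also have "\<dots> \<le> recip_sum I ^ (card T - 1) / y"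
      unfolding G_def w_def by (rule sum_collision_le) (use fin st y I in auto)
    finally show "(case q of (s,t) \<Rightarrow> \<Sum>g\<in>G. of_bool (g s = g t) * w g) \<le> (case q of (s,t) \<Rightarrow> recip_sum I ^ (card T - 1) / y)"
      by (simp add: st(1))
  qed
  also have "\<dots> \<le> (\<Sum>(s,t)\<in>T \<times> T. recip_sum I ^ (card T - 1) / y)"
    using fin y by (intro sum_mono2) (auto simp: recip_sum_nonneg)
  also have "\<dots> = real (card T) ^ 2 * recip_sum I ^ (card T - 1) / y"
    by (simp add: card_cartesian_product power2_eq_square)
  finally show ?thesis
    unfolding lhs rhs using fin by (simp add: G_def card_PiE mult_left_mono)
qed

section \<open>Windows of primes between two powers of N\<close>

lemma card_primes_in_le: "a \<ge> 0 \<Longrightarrow> b \<ge> 0 \<Longrightarrow> real (card (primes_in a b)) \<le> b"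
proof -
  assume "a \<ge> 0" "b \<ge> 0"
  then have "primes_in a b \<subseteq> {1..nat \<lfloor>b\<rfloor>}"
    using prime_ge_1_nat by (auto simp: primes_in_def le_nat_floor)
  then have "card (primes_in a b) \<le> nat \<lfloor>b\<rfloor>" using card_mono[of "{1..nat \<lfloor>b\<rfloor>}"] by fastforce
  then show ?thesis using \<open>b \<ge> 0\<close> by linarith
qed

definition prime_window :: "real \<Rightarrow> real \<Rightarrow> nat \<Rightarrow> nat set" where
  "prime_window \<alpha> \<beta> N = primes_in (real N powr \<alpha>) (real N powr \<beta>)"

lemma recip_sum_prime_window:
  assumes "0 < \<alpha>" "\<alpha> < \<beta>"
  shows "(\<lambda>N. recip_sum (prime_window \<alpha> \<beta> N)) \<longlonglongrightarrow> ln (\<beta> / \<alpha>)"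
  unfolding prime_window_def
  using filterlim_compose[OF recip_sum_primes_tendsto[OF assms] filterlim_real_sequentially] .

lemma prime_window_large:
  assumes "0 < \<alpha>"
  shows "\<forall>\<^sub>F N in sequentially. \<forall>r\<in>prime_window \<alpha> \<beta> N. r > k"
proof -
  have "filterlim (\<lambda>N. real N powr \<alpha>) at_top sequentially" using assms by real_asymp
  then have "\<forall>\<^sub>F N in sequentially. real N powr \<alpha> > real k" by (rule filterlim_at_top_dense[THEN iffD1, rule_format])
  then show ?thesis by eventually_elim (force simp: prime_window_def primes_in_def)
qed

text \<open>The rounding errors number at most N^(\<beta> card T), which is o(N) by the condition on
  \<beta>, and a collision saves N^\<alpha>. Both bounds involve \<open>N\<close> alone, hence the
  uniformity in \<open>X\<close>; it matters because sums over dilates stop at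
  \<open>N div p\<close>.\<close>

lemma prime_window_correlation:
  fixes T :: "(nat \<times> int) set"
  assumes ab: "0 < \<alpha>" "\<alpha> < \<beta>" and fin: "finite T" and T: "\<beta> * real (card T) < 1"
    and lead: "\<And>t. t \<in> T \<Longrightarrow> fst t > 0"
    and res: "\<And>s t. s \<in> T \<Longrightarrow> t \<in> T \<Longrightarrow> s \<noteq> t \<Longrightarrow> int (fst s) * snd t \<noteq> int (fst t) * snd s"
    and \<epsilon>: "\<epsilon> > 0"
  shows "\<forall>\<^sub>F N in sequentially. \<forall>X\<le>N.
    \<bar>(\<Sum>a=1..X. \<Prod>t\<in>T. omega (prime_window \<alpha> \<beta> N) (int (fst t) * int a + snd t))
       - real X * recip_sum (prime_window \<alpha> \<beta> N) ^ card T\<bar> \<le> \<epsilon> * real N"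
proof -
  define I where "I = prime_window \<alpha> \<beta>"
  \<comment> \<open>\<open>k\<close> dominates all leading coefficients and resultants. As
    \<open>T\<close> is fixed while \<open>N\<close> grows, the primes of the window eventually
    exceed \<open>k\<close> and divide none of these nonzero numbers.\<close>
  define k where "k = Max (insert 0 (fst ` T \<union> (\<lambda>(s,t). nat \<bar>int (fst s) * snd t - int (fst t) * snd s\<bar>) ` (T \<times> T)))"
  have k1: "fst t \<le> k" if "t \<in> T" for t unfolding k_def using fin that by (intro Max_ge) auto
  have k2: "nat \<bar>int (fst s) * snd t - int (fst t) * snd s\<bar> \<le> k" if "s \<in> T" "t \<in> T" for s t
    unfolding k_def using fin that by (intro Max_ge) force+
  have "(\<lambda>N. real N powr (\<beta> * real (card T)) / real N +
      real (card T) ^ 2 * recip_sum (I N) ^ (card T - 1) / real N powr \<alpha>) \<longlonglongrightarrow> 0 + 0"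
  proof (rule tendsto_add)
    show "(\<lambda>N. real N powr (\<beta> * real (card T)) / real N) \<longlonglongrightarrow> 0" using T by real_asymp
    show "(\<lambda>N. real (card T) ^ 2 * recip_sum (I N) ^ (card T - 1) / real N powr \<alpha>) \<longlonglongrightarrow> 0"
    proof (rule real_tendsto_divide_at_top)
      show "(\<lambda>N. real (card T) ^ 2 * recip_sum (I N) ^ (card T - 1)) \<longlonglongrightarrow> real (card T) ^ 2 * ln (\<beta> / \<alpha>) ^ (card T - 1)"
        unfolding I_def by (intro tendsto_intros recip_sum_prime_window ab)
      show "filterlim (\<lambda>N. real N powr \<alpha>) at_top sequentially" using ab by real_asymp
    qed
  qed
  then have "\<forall>\<^sub>F N in sequentially. real N powr (\<beta> * real (card T)) / real N +
      real (card T) ^ 2 * recip_sum (I N) ^ (card T - 1) / real N powr \<alpha> < \<epsilon>"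
    using \<epsilon> by (intro order_tendstoD(2)) auto
  moreover have "\<forall>\<^sub>F N in sequentially. \<forall>r\<in>I N. r > k" unfolding I_def using ab by (intro prime_window_large)
  ultimately show ?thesis
    using eventually_gt_at_top[of 0] unfolding I_def[symmetric]
  proof eventually_elim
    case (elim N)
    show ?case
    proof (intro allI impI)
      fix X assume X: "X \<le> N"
      have "\<bar>(\<Sum>a=1..X. \<Prod>t\<in>T. omega (I N) (int (fst t) * int a + snd t)) - real X * recip_sum (I N) ^ card T\<bar>
        \<le> real (card (I N)) ^ card T + real X * (real (card T) ^ 2 * recip_sum (I N) ^ (card T - 1) / real N powr \<alpha>)"
      proof (rule sum_prod_omega)
        show "finite (I N)" by (simp add: I_def prime_window_def)
        show "prime r \<and> real r > real N powr \<alpha>" if "r \<in> I N" for r using that by (auto simp: I_def prime_window_def primes_in_def)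
        show "\<not> r dvd fst t" if "r \<in> I N" "t \<in> T" for r t
          using elim that k1[of t] lead[of t] by (auto dest!: dvd_imp_le)
        show "\<not> int r dvd int (fst s) * snd t - int (fst t) * snd s" if "r \<in> I N" "s \<in> T" "t \<in> T" "s \<noteq> t" for r s t
        proof
          assume "int r dvd int (fst s) * snd t - int (fst t) * snd s"
          then have "r dvd nat \<bar>int (fst s) * snd t - int (fst t) * snd s\<bar>" by (simp only: dvd_nat_abs_iff)
          moreover have "nat \<bar>int (fst s) * snd t - int (fst t) * snd s\<bar> > 0" using res[of s t] that by simp
          ultimately have "r \<le> nat \<bar>int (fst s) * snd t - int (fst t) * snd s\<bar>" by (rule dvd_imp_le)
          also have "\<dots> \<le> k" using k2 that by blast
          finally show False using elim that by auto
        qed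
      qed (use elim fin in auto)
      also have "\<dots> \<le> real N * (real N powr (\<beta> * real (card T)) / real N) +
          real N * (real (card T) ^ 2 * recip_sum (I N) ^ (card T - 1) / real N powr \<alpha>)"
      proof (intro add_mono mult_right_mono)
        have "real (card (I N)) ^ card T \<le> (real N powr \<beta>) ^ card T"
          unfolding I_def prime_window_def by (intro power_mono card_primes_in_le) auto
        also have "\<dots> = real N powr (\<beta> * real (card T))"
          using elim by (simp add: powr_powr flip: powr_realpow)
        finally show "real (card (I N)) ^ card T \<le> real N * (real N powr (\<beta> * real (card T)) / real N)"
          using elim by simp
      qed (use X in \<open>auto simp: recip_sum_nonneg\<close>)
      also have "\<dots> \<le> real N * \<epsilon>"
        unfolding distrib_left[symmetric] using elim by (intro mult_left_mono) auto
      finally show "\<bar>(\<Sum>a=1..X. \<Prod>t\<in>T. omega (I N) (int (fst t) * int a + snd t)) - real X * recip_sum (I N) ^ card T\<bar> \<le> \<epsilon> * real N"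
        by (simp add: mult.commute)
    qed
  qed
qed

section \<open>An orthogonality criterion\<close>

lemma card_common_multiples:
  assumes "prime p" "prime q" "p \<noteq> q"
  shows "card {m\<in>{1..N}. p dvd m \<and> q dvd m} = N div (p * q)"
proof -
  have "coprime p q" using assms by (intro primes_coprime) auto
  then have "p dvd m \<and> q dvd m \<longleftrightarrow> p * q dvd m" for m by (auto intro: divides_mult dvd_mult_left dvd_mult_right)
  then have "{m\<in>{1..N}. p dvd m \<and> q dvd m} = {m\<in>{1..N}. p * q dvd m}" by simp
  then show ?thesis using assms card_multiples[of "p * q"] prime_gt_0_nat by simp
qed

text \<open>After opening the square, the products \<open>1 / p * 1 / q\<close> in the second moment
  sum to \<open>N * s * s\<close>, which cancels against the mean, and the diagonal leaves
  \<open>N * s\<close>. The first moment needs a lower bound, whose rounding costs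
  \<open>2 * s * card P\<close>.\<close>

lemma turan_kubilius:
  assumes fin: "finite P" and P: "\<And>p. p \<in> P \<Longrightarrow> prime p"
  defines "s \<equiv> recip_sum P"
  shows "(\<Sum>m=1..N. ((\<Sum>p\<in>P. of_bool (p dvd m)) - s)\<^sup>2) \<le> real N * s + 2 * s * real (card P)"
proof -
  define w :: "nat \<Rightarrow> real" where "w = (\<lambda>m. \<Sum>p\<in>P. of_bool (p dvd m))"
  have pos: "p > 0" if "p \<in> P" for p using P[OF that] prime_gt_0_nat by simp
  have s: "s \<ge> 0" by (simp add: s_def recip_sum_nonneg)
  have "(\<Sum>m=1..N. w m) = (\<Sum>p\<in>P. \<Sum>m=1..N. of_bool (p dvd m))" unfolding w_def by (rule sum.swap)
  also have "\<dots> = (\<Sum>p\<in>P. real (N div p))"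
    using card_multiples[OF pos] by (intro sum.cong) (auto simp: sum_of_bool_eq Int_def)
  also have "\<dots> \<ge> (\<Sum>p\<in>P. real N * (1 / real p) - 1)"
  proof (rule sum_mono)
    fix p assume "p \<in> P"
    then have p: "p > 0" by (rule pos)
    then have "N \<le> p + N div p * p" by (intro less_imp_le dividend_less_div_times)
    then have "real N \<le> real p + real (N div p) * real p" by (simp flip: of_nat_mult of_nat_add)
    with p show "real N * (1 / real p) - 1 \<le> real (N div p)" by (simp add: field_simps)
  qed
  also have "(\<Sum>p\<in>P. real N * (1 / real p) - 1) = real N * s - real (card P)"
    unfolding s_def recip_sum_def sum_distrib_left by (simp add: sum_subtractf)
  finally have w1: "(\<Sum>m=1..N. w m) \<ge> real N * s - real (card P)" .
  have "(\<Sum>m=1..N. (w m)\<^sup>2) = (\<Sum>m=1..N. \<Sum>p\<in>P. \<Sum>q\<in>P. of_bool (p dvd m \<and> q dvd m))"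
    unfolding w_def power2_eq_square sum_product by (simp add: of_bool_conj)
  also have "\<dots> = (\<Sum>p\<in>P. \<Sum>q\<in>P. \<Sum>m=1..N. of_bool (p dvd m \<and> q dvd m))"
    by (subst sum.swap) (intro sum.cong refl sum.swap)
  also have "\<dots> \<le> (\<Sum>p\<in>P. \<Sum>q\<in>P. real N * ((1 / real p) * (1 / real q)) + (if p = q then real N * (1 / real p) else 0))"
  proof (intro sum_mono)
    fix p q assume pq: "p \<in> P" "q \<in> P"
    have "(\<Sum>m=1..N. of_bool (p dvd m \<and> q dvd m)) = real (card {m\<in>{1..N}. p dvd m \<and> q dvd m})"
      by (simp add: sum_of_bool_eq Int_def)
    also have "\<dots> \<le> real N * ((1 / real p) * (1 / real q)) + (if p = q then real N * (1 / real p) else 0)"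
    proof (cases "p = q")
      case True
      have "real (card {m\<in>{1..N}. p dvd m \<and> q dvd m}) = real (N div p)"
        using card_multiples[OF pos[OF pq(1)]] True by simp
      also have "\<dots> \<le> real N / real p" by (rule of_nat_div_le_of_nat)
      finally have "real (card {m\<in>{1..N}. p dvd m \<and> q dvd m}) \<le> real N * (1 / real p)" by simp
      moreover have "0 \<le> real N * ((1 / real p) * (1 / real q))" by simp
      moreover have "(if p = q then real N * (1 / real p) else 0) = real N * (1 / real p)" using True by simp
      ultimately show ?thesis by linarith
    next
      case False
      have "real (card {m\<in>{1..N}. p dvd m \<and> q dvd m}) = real (N div (p * q))"
        using card_common_multiples[OF P[OF pq(1)] P[OF pq(2)] False] by simp
      also have "\<dots> \<le> real N / real (p * q)" by (rule of_nat_div_le_of_nat)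
      finally show ?thesis using False by simp
    qed
    finally show "(\<Sum>m=1..N. of_bool (p dvd m \<and> q dvd m)) \<le> real N * ((1 / real p) * (1 / real q)) + (if p = q then real N * (1 / real p) else 0)" .
  qed
  also have "\<dots> = (\<Sum>p\<in>P. \<Sum>q\<in>P. real N * ((1 / real p) * (1 / real q))) + (\<Sum>p\<in>P. real N * (1 / real p))"
    using fin by (simp add: sum.distrib)
  also have "\<dots> = real N * (s * s) + real N * s"
    by (simp only: s_def recip_sum_def sum_product) (simp only: sum_distrib_left)
  also have "\<dots> = real N * s * s + real N * s" by simp
  finally have w2: "(\<Sum>m=1..N. (w m)\<^sup>2) \<le> real N * s * s + real N * s" .
  have "(\<Sum>m=1..N. (w m - s)\<^sup>2) = (\<Sum>m=1..N. (w m)\<^sup>2 - 2 * s * w m + s\<^sup>2)"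
    by (intro sum.cong refl) (simp add: power2_diff)
  also have "\<dots> = (\<Sum>m=1..N. (w m)\<^sup>2) - 2 * s * (\<Sum>m=1..N. w m) + real N * s\<^sup>2"
    by (simp add: sum.distrib sum_subtractf sum_distrib_left)
  also have "\<dots> \<le> (real N * s * s + real N * s) - 2 * s * (real N * s - real (card P)) + real N * s\<^sup>2"
    using w1 w2 s by (intro add_right_mono diff_mono mult_left_mono) auto
  also have "\<dots> = real N * s + 2 * s * real (card P)" by (simp add: algebra_simps power2_eq_square)
  finally show ?thesis by (simp add: w_def)
qed

lemma abs_sum_le_sqrt:
  fixes x :: "'a \<Rightarrow> real"
  shows "(\<Sum>i\<in>A. \<bar>x i\<bar>) \<le> sqrt (real (card A) * (\<Sum>i\<in>A. (x i)\<^sup>2))"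
proof (rule real_le_rsqrt)
  show "(\<Sum>i\<in>A. \<bar>x i\<bar>)\<^sup>2 \<le> real (card A) * (\<Sum>i\<in>A. (x i)\<^sup>2)"
    using Cauchy_Schwarz_ineq_sum[of "\<lambda>_. 1" "\<lambda>i. \<bar>x i\<bar>" A] by simp
qed

text \<open>The orthogonality criterion of Daboussi, Katai and Bourgain--Sarnak--Ziegler: by Turan--Kubilius
  \<open>m\<close> may be weighted by its number of prime factors in \<open>P\<close>; after writing \<open>m = p a\<close>
  the multiplicative factor depends on \<open>a\<close> only and Cauchy's inequality removes it.\<close>

lemma katai_inequality:
  fixes f F :: "nat \<Rightarrow> real"
  assumes fin: "finite P" and P: "\<And>p. p \<in> P \<Longrightarrow> prime p"
    and f: "\<And>m. \<bar>f m\<bar> \<le> 1" and fp: "\<And>p a. p \<in> P \<Longrightarrow> a > 0 \<Longrightarrow> f (p * a) = f a"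
    and F: "\<And>m. m \<in> {1..N} \<Longrightarrow> \<bar>F m\<bar> \<le> K"
    and corr: "\<And>p q. p \<in> P \<Longrightarrow> q \<in> P \<Longrightarrow> p \<noteq> q \<Longrightarrow>
       \<bar>\<Sum>a=1..min (N div p) (N div q). F (p * a) * F (q * a)\<bar> \<le> \<eta> * real N"
    and K: "K \<ge> 0" and \<eta>: "\<eta> \<ge> 0"
  defines "s \<equiv> recip_sum P"
  shows "s * \<bar>\<Sum>m=1..N. f m * F m\<bar> \<le>
    sqrt (real N * (K\<^sup>2 * s * real N + real (card P) ^ 2 * \<eta> * real N)) + K * sqrt (real N * (real N * s + 2 * s * real (card P)))"
proof -
  define w :: "nat \<Rightarrow> real" where "w = (\<lambda>m. \<Sum>p\<in>P. of_bool (p dvd m))"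
  have pos: "p > 0" if "p \<in> P" for p using P[OF that] prime_gt_0_nat by simp
  have s: "s \<ge> 0" by (simp add: s_def recip_sum_nonneg)
  \<comment> \<open>After writing \<open>m = p * a\<close>, all terms with the same \<open>a\<close>
    share the factor \<open>f a\<close>; \<open>H a\<close> collects what remains.\<close>
  define H where "H = (\<lambda>a. \<Sum>p\<in>P. of_bool (a \<le> N div p) * F (p * a))"
  have "(\<Sum>m=1..N. f m * F m * w m) = (\<Sum>p\<in>P. \<Sum>m=1..N. f m * F m * of_bool (p dvd m))"
    unfolding w_def sum_distrib_left by (rule sum.swap)
  also have "\<dots> = (\<Sum>p\<in>P. \<Sum>a=1..N. f a * (of_bool (a \<le> N div p) * F (p * a)))"
  proof (rule sum.cong[OF refl])
    fix p assume p: "p \<in> P"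
    have img: "{m\<in>{1..N}. p dvd m} = (\<lambda>a. p * a) ` {a\<in>{1..N}. a \<le> N div p}"
    proof (intro equalityI subsetI)
      fix m assume "m \<in> {m\<in>{1..N}. p dvd m}"
      then obtain a where a: "m = p * a" "1 \<le> m" "m \<le> N" by auto
      then have "a \<le> N div p" using pos[OF p] by (simp add: less_eq_div_iff_mult_less_eq mult.commute)
      moreover have "a \<ge> 1" using a by (simp add: Suc_le_eq)
      moreover have "N div p \<le> N" by simp
      ultimately have "a \<in> {a\<in>{1..N}. a \<le> N div p}" by (auto intro: order_trans)
      then show "m \<in> (\<lambda>a. p * a) ` {a\<in>{1..N}. a \<le> N div p}" using a(1) by blast
    next
      fix m assume "m \<in> (\<lambda>a. p * a) ` {a\<in>{1..N}. a \<le> N div p}"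
      then show "m \<in> {m\<in>{1..N}. p dvd m}" using pos[OF p]
        by (auto simp: less_eq_div_iff_mult_less_eq mult.commute Suc_le_eq)
    qed
    have "(\<Sum>m=1..N. f m * F m * of_bool (p dvd m)) = (\<Sum>m\<in>{m\<in>{1..N}. p dvd m}. f m * F m)"
      unfolding sum.inter_filter[OF finite_atLeastAtMost] by (intro sum.cong) auto
    also have "\<dots> = (\<Sum>a\<in>{a\<in>{1..N}. a \<le> N div p}. f (p * a) * F (p * a))"
      unfolding img using pos[OF p] by (subst sum.reindex) (auto intro: inj_onI)
    also have "\<dots> = (\<Sum>a\<in>{a\<in>{1..N}. a \<le> N div p}. f a * F (p * a))"
      using fp[OF p] by (intro sum.cong) auto
    also have "\<dots> = (\<Sum>a=1..N. f a * (of_bool (a \<le> N div p) * F (p * a)))"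
      unfolding sum.inter_filter[OF finite_atLeastAtMost] by (intro sum.cong) auto
    finally show "(\<Sum>m=1..N. f m * F m * of_bool (p dvd m)) = (\<Sum>a=1..N. f a * (of_bool (a \<le> N div p) * F (p * a)))" .
  qed
  also have "\<dots> = (\<Sum>a=1..N. f a * H a)" unfolding H_def sum_distrib_left by (rule sum.swap)
  finally have fFw: "(\<Sum>m=1..N. f m * F m * w m) = (\<Sum>a=1..N. f a * H a)" .
  have "(\<Sum>a=1..N. (H a)\<^sup>2) = (\<Sum>a=1..N. \<Sum>p\<in>P. \<Sum>q\<in>P. of_bool (a \<le> min (N div p) (N div q)) * (F (p * a) * F (q * a)))"
    unfolding H_def power2_eq_square sum_product by (intro sum.cong refl) (auto simp: min_def)
  also have "\<dots> = (\<Sum>p\<in>P. \<Sum>q\<in>P. \<Sum>a=1..N. of_bool (a \<le> min (N div p) (N div q)) * (F (p * a) * F (q * a)))"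
    by (subst sum.swap) (intro sum.cong refl sum.swap)
  also have "\<dots> = (\<Sum>p\<in>P. \<Sum>q\<in>P. \<Sum>a=1..min (N div p) (N div q). F (p * a) * F (q * a))"
  proof (rule sum.cong[OF refl], rule sum.cong[OF refl])
    fix p q
    let ?m = "min (N div p) (N div q)"
    have "N div p \<le> N" by simp
    then have set: "{a\<in>{1..N}. a \<le> ?m} = {1..?m}" by (auto intro: order_trans)
    have "(\<Sum>a=1..N. of_bool (a \<le> ?m) * (F (p * a) * F (q * a))) = (\<Sum>a=1..N. if a \<le> ?m then F (p * a) * F (q * a) else 0)"
      by (intro sum.cong refl) simp
    also have "\<dots> = (\<Sum>a\<in>{a\<in>{1..N}. a \<le> ?m}. F (p * a) * F (q * a))"
      by (rule sum.inter_filter[symmetric]) simp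
    finally show "(\<Sum>a=1..N. of_bool (a \<le> ?m) * (F (p * a) * F (q * a))) = (\<Sum>a=1..?m. F (p * a) * F (q * a))"
      unfolding set .
  qed
  \<comment> \<open>Off the diagonal the correlation hypothesis applies. On it only the bound
    \<open>K\<close> is known, but \<open>a\<close> runs up to \<open>N div p\<close> there, so the
    total is \<open>K\<^sup>2 * s * N\<close>: linear in \<open>s\<close>, against the square of
    \<open>s\<close> on the left of the claim.\<close>
  also have "\<dots> \<le> (\<Sum>p\<in>P. \<Sum>q\<in>P. (if p = q then K\<^sup>2 * real N * (1 / real p) else 0) + \<eta> * real N)"
  proof (intro sum_mono)
    fix p q assume pq: "p \<in> P" "q \<in> P"
    show "(\<Sum>a=1..min (N div p) (N div q). F (p * a) * F (q * a)) \<le> (if p = q then K\<^sup>2 * real N * (1 / real p) else 0) + \<eta> * real N"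
    proof (cases "p = q")
      case True
      have "(\<Sum>a=1..N div p. F (p * a) * F (p * a)) \<le> (\<Sum>a=1..N div p. K\<^sup>2)"
      proof (rule sum_mono)
        fix a assume a: "a \<in> {1..N div p}"
        then have "p * a \<in> {1..N}" using pos[OF pq(1)]
          by (auto simp: less_eq_div_iff_mult_less_eq mult.commute Suc_le_eq)
        then have "\<bar>F (p * a)\<bar>\<^sup>2 \<le> K\<^sup>2" using F by (intro power_mono) auto
        then show "F (p * a) * F (p * a) \<le> K\<^sup>2" by (simp add: power2_eq_square)
      qed
      also have "\<dots> = real (N div p) * K\<^sup>2" by simp
      also have "\<dots> \<le> real N / real p * K\<^sup>2" by (intro mult_right_mono of_nat_div_le_of_nat) auto
      finally have "(\<Sum>a=1..N div p. F (p * a) * F (p * a)) \<le> K\<^sup>2 * real N * (1 / real p)" by (simp add: mult.commute)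
      moreover have "0 \<le> \<eta> * real N" using \<eta> by simp
      ultimately have "(\<Sum>a=1..N div p. F (p * a) * F (p * a)) \<le> K\<^sup>2 * real N * (1 / real p) + \<eta> * real N" by linarith
      then show ?thesis using True by simp
    next
      case False
      then show ?thesis using corr[OF pq False] by simp
    qed
  qed
  also have "\<dots> = K\<^sup>2 * s * real N + real (card P) ^ 2 * \<eta> * real N"
    using fin by (simp add: sum.distrib s_def recip_sum_def sum_distrib_left sum_distrib_right power2_eq_square mult_ac)
  finally have H2: "(\<Sum>a=1..N. (H a)\<^sup>2) \<le> K\<^sup>2 * s * real N + real (card P) ^ 2 * \<eta> * real N" .
  have "\<bar>\<Sum>a=1..N. f a * H a\<bar> \<le> (\<Sum>a=1..N. \<bar>f a * H a\<bar>)" by (rule sum_abs)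
  also have "\<dots> \<le> (\<Sum>a=1..N. \<bar>H a\<bar>)"
    using f by (intro sum_mono) (simp add: abs_mult mult_left_le_one_le)
  also have "\<dots> \<le> sqrt (real N * (\<Sum>a=1..N. (H a)\<^sup>2))" using abs_sum_le_sqrt[of H "{1..N}"] by simp
  also have "\<dots> \<le> sqrt (real N * (K\<^sup>2 * s * real N + real (card P) ^ 2 * \<eta> * real N))"
    using H2 by (intro real_sqrt_le_mono mult_left_mono) auto
  finally have A: "\<bar>\<Sum>m=1..N. f m * F m * w m\<bar> \<le> sqrt (real N * (K\<^sup>2 * s * real N + real (card P) ^ 2 * \<eta> * real N))"
    unfolding fFw .
  \<comment> \<open>Replacing the weight \<open>w m\<close> by its mean \<open>s\<close> is paid for
    by Turan-Kubilius, with \<open>f\<close> and \<open>F\<close> bounded trivially.\<close>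
  have "\<bar>\<Sum>m=1..N. f m * F m * (w m - s)\<bar> \<le> (\<Sum>m=1..N. \<bar>f m * F m * (w m - s)\<bar>)" by (rule sum_abs)
  also have "\<dots> \<le> (\<Sum>m=1..N. K * \<bar>w m - s\<bar>)"
  proof (rule sum_mono)
    fix m assume m: "m \<in> {1..N}"
    have "\<bar>f m\<bar> * \<bar>F m\<bar> \<le> 1 * K" using f F[OF m] by (intro mult_mono) auto
    then show "\<bar>f m * F m * (w m - s)\<bar> \<le> K * \<bar>w m - s\<bar>" by (simp add: abs_mult mult_right_mono)
  qed
  also have "\<dots> = K * (\<Sum>m=1..N. \<bar>w m - s\<bar>)" by (simp add: sum_distrib_left)
  also have "\<dots> \<le> K * sqrt (real N * (\<Sum>m=1..N. (w m - s)\<^sup>2))"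
    using abs_sum_le_sqrt[of "\<lambda>m. w m - s" "{1..N}"] K by (intro mult_left_mono) auto
  also have "\<dots> \<le> K * sqrt (real N * (real N * s + 2 * s * real (card P)))"
    using turan_kubilius[OF fin P, of N] K unfolding w_def s_def
    by (intro mult_left_mono real_sqrt_le_mono) auto
  finally have B: "\<bar>\<Sum>m=1..N. f m * F m * (w m - s)\<bar> \<le> K * sqrt (real N * (real N * s + 2 * s * real (card P)))" .
  have "s * (\<Sum>m=1..N. f m * F m) = (\<Sum>m=1..N. f m * F m * w m) - (\<Sum>m=1..N. f m * F m * (w m - s))"
    by (simp add: sum_distrib_left algebra_simps flip: sum_subtractf)
  then have "s * \<bar>\<Sum>m=1..N. f m * F m\<bar> = \<bar>(\<Sum>m=1..N. f m * F m * w m) - (\<Sum>m=1..N. f m * F m * (w m - s))\<bar>"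
    using s by (metis abs_mult abs_of_nonneg)
  with A B show ?thesis by linarith
qed

text \<open>In \<open>katai_inequality\<close> the right side grows like \<open>sqrt s\<close> and
  the left like \<open>s\<close>, so a set \<open>P\<close> with large reciprocal sum settles any
  given accuracy. Since \<open>P\<close> is fixed before \<open>N\<close>, finitely many eventual
  statements about primes and pairs are combined, and \<open>f\<close> and \<open>F\<close> may vary
  with \<open>N\<close>.\<close>

lemma katai_criterion:
  fixes f F :: "nat \<Rightarrow> nat \<Rightarrow> real"
  assumes f: "\<And>N m. \<bar>f N m\<bar> \<le> 1"
    and fp: "\<And>p. prime p \<Longrightarrow> \<forall>\<^sub>F N in sequentially. \<forall>a>0. f N (p * a) = f N a"
    and F: "\<forall>\<^sub>F N in sequentially. \<forall>m\<in>{1..N}. \<bar>F N m\<bar> \<le> K"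
    and corr: "\<And>p q \<eta>. prime p \<Longrightarrow> prime q \<Longrightarrow> p \<noteq> q \<Longrightarrow> p > k \<Longrightarrow> q > k \<Longrightarrow> \<eta> > 0 \<Longrightarrow>
       \<forall>\<^sub>F N in sequentially. \<bar>\<Sum>a=1..min (N div p) (N div q). F N (p * a) * F N (q * a)\<bar> \<le> \<eta> * real N"
  shows "(\<lambda>N. (\<Sum>m=1..N. f N m * F N m) / real N) \<longlonglongrightarrow> 0"
proof (rule tendstoI)
  fix \<epsilon> :: real assume \<epsilon>: "\<epsilon> > 0"
  \<comment> \<open>With \<open>\<eta>\<close> as below and \<open>N\<close> beyond
    \<open>2 * card P\<close>, the two terms on the right of \<open>katai_inequality\<close> are at
    most \<open>N * sqrt s\<close> times the two summands of \<open>c\<close>.\<close>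
  define c where "c = sqrt (K\<^sup>2 + 1) + \<bar>K\<bar> * sqrt 2"
  have c: "c > 0" unfolding c_def by (intro add_pos_nonneg) (auto simp: add_nonneg_pos)
  obtain P where P: "finite P" "\<And>p. p \<in> P \<Longrightarrow> prime p \<and> p > k" "recip_sum P > (c / \<epsilon>)\<^sup>2"
    using recip_sum_primes_unbounded[of k "(c / \<epsilon>)\<^sup>2"] by auto
  define s where "s = recip_sum P"
  have "(c / \<epsilon>)\<^sup>2 > 0" using c \<epsilon> by simp
  then have s: "s > 0" "s > (c / \<epsilon>)\<^sup>2" unfolding s_def using P(3) by (rule less_trans) (rule P(3))
  \<comment> \<open>Small enough that all pairs from \<open>P\<close> together contribute no more
    than \<open>s * N\<close>, the order of the diagonal.\<close>
  define \<eta> where "\<eta> = s / (real (card P) ^ 2 + 1)"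
  have \<eta>: "\<eta> > 0" "real (card P) ^ 2 * \<eta> \<le> s"
  proof -
    have d: "real (card P) ^ 2 + 1 > 0" by (simp add: add_nonneg_pos)
    then show "\<eta> > 0" unfolding \<eta>_def using s by (intro divide_pos_pos)
    have "real (card P) ^ 2 * \<eta> = s * real (card P) ^ 2 / (real (card P) ^ 2 + 1)" by (simp add: \<eta>_def)
    also have "\<dots> \<le> s" using s by (simp only: pos_divide_le_eq[OF d]) (simp add: algebra_simps)
    finally show "real (card P) ^ 2 * \<eta> \<le> s" .
  qed
  have "\<forall>\<^sub>F N in sequentially. \<forall>p\<in>P. \<forall>a>0. f N (p * a) = f N a"
    using P fp by (intro eventually_ball_finite) auto
  moreover have "\<forall>\<^sub>F N in sequentially. \<forall>p\<in>P. \<forall>q\<in>P. p \<noteq> q \<longrightarrow>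
     \<bar>\<Sum>a=1..min (N div p) (N div q). F N (p * a) * F N (q * a)\<bar> \<le> \<eta> * real N"
  proof (intro eventually_ball_finite P(1) ballI)
    fix p q assume "p \<in> P" "q \<in> P"
    then show "\<forall>\<^sub>F N in sequentially. p \<noteq> q \<longrightarrow> \<bar>\<Sum>a=1..min (N div p) (N div q). F N (p * a) * F N (q * a)\<bar> \<le> \<eta> * real N"
      using corr[of p q \<eta>] P(2) \<eta> by (cases "p = q") (auto elim: eventually_mono)
  qed
  ultimately show "\<forall>\<^sub>F N in sequentially. dist ((\<Sum>m=1..N. f N m * F N m) / real N) 0 < \<epsilon>"
    using F eventually_gt_at_top[of "2 * card P"]
  proof eventually_elim
    case (elim N)
    have N: "real N > 0" "2 * real (card P) \<le> real N" using elim(4) by auto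
    have "s * \<bar>\<Sum>m=1..N. f N m * F N m\<bar> \<le>
       sqrt (real N * (\<bar>K\<bar>\<^sup>2 * s * real N + real (card P) ^ 2 * \<eta> * real N)) + \<bar>K\<bar> * sqrt (real N * (real N * s + 2 * s * real (card P)))"
      unfolding s_def
    proof (rule katai_inequality)
      show "\<bar>F N m\<bar> \<le> \<bar>K\<bar>" if "m \<in> {1..N}" for m using elim(3) that by force
    qed (use P f elim \<eta> in auto)
    also have "\<dots> \<le> sqrt (real N * (K\<^sup>2 * s * real N + s * real N)) + \<bar>K\<bar> * sqrt (real N * (real N * s + real N * s))"
    proof -
      have 1: "\<bar>K\<bar>\<^sup>2 * s * real N + real (card P) ^ 2 * \<eta> * real N \<le> K\<^sup>2 * s * real N + s * real N"
        using \<eta> N by (simp add: mult_right_mono)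
      have "s * (2 * real (card P)) \<le> s * real N" using N s by (intro mult_left_mono) auto
      then have 2: "real N * s + 2 * s * real (card P) \<le> real N * s + real N * s" by (simp add: mult_ac)
      show ?thesis by (intro 1 2 add_mono[of "sqrt _"] mult_left_mono real_sqrt_le_mono) auto
    qed
    also have "real N * (K\<^sup>2 * s * real N + s * real N) = (real N)\<^sup>2 * (s * (K\<^sup>2 + 1))"
      by (simp add: algebra_simps power2_eq_square)
    also have "real N * (real N * s + real N * s) = (real N)\<^sup>2 * (s * 2)"
      by (simp add: algebra_simps power2_eq_square)
    also have "sqrt ((real N)\<^sup>2 * (s * (K\<^sup>2 + 1))) + \<bar>K\<bar> * sqrt ((real N)\<^sup>2 * (s * 2)) = real N * sqrt s * c"
      by (simp only: real_sqrt_mult real_sqrt_abs abs_of_nat c_def) (simp add: algebra_simps)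
    finally have "s * (\<bar>\<Sum>m=1..N. f N m * F N m\<bar> / real N) \<le> sqrt s * c"
      using N by (simp add: field_simps)
    also have "sqrt s * c < sqrt s * (sqrt s * \<epsilon>)"
    proof (rule mult_strict_left_mono)
      have "c / \<epsilon> < sqrt s" using s by (intro real_less_rsqrt)
      then show "c < sqrt s * \<epsilon>" using \<epsilon> by (simp add: field_simps)
    qed (use s in simp)
    also have "\<dots> = s * \<epsilon>" using s by (simp flip: mult.assoc)
    finally have "\<bar>\<Sum>m=1..N. f N m * F N m\<bar> / real N < \<epsilon>" by (simp only: mult_less_cancel_left_pos[OF s(1)])
    then show ?case by (simp add: dist_real_def)
  qed
qed

section \<open>The counting function\<close>

text \<open>With \<open>m = n + j0\<close> the other entries \<open>n + j\<close> are
  \<open>m + h\<close> for \<open>h\<close> in this set. A shift may be negative, hence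
  integers.\<close>

definition shifts :: "nat \<Rightarrow> nat \<Rightarrow> int set" where
  "shifts J j0 = (\<lambda>j. int j - int j0) ` ({..<J} - {j0})"

lemma finite_shifts [simp]: "finite (shifts J j0)"
  by (simp add: shifts_def)

lemma card_shifts: "j0 < J \<Longrightarrow> card (shifts J j0) = J - 1"
  unfolding shifts_def by (subst card_image) (auto intro: inj_onI)

lemma shifts_bounds:
  assumes "h \<in> shifts J j0" "j0 < J"
  shows "h \<noteq> 0" "\<bar>h\<bar> < int J"
  using assms by (auto simp: shifts_def)

definition omega_prod :: "int set \<Rightarrow> nat set \<Rightarrow> nat \<Rightarrow> real" where
  "omega_prod H I m = (\<Prod>h\<in>H. omega I (int m + h))"

text \<open>The primes of \<open>I\<close> dividing \<open>k\<close> multiply to a divisor of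
  \<open>k\<close>, and each exceeds \<open>y\<close>; so \<open>y\<close> to the power of their
  number is at most \<open>B\<close>.\<close>

lemma omega_le:
  assumes fin: "finite I" and I: "\<And>r. r \<in> I \<Longrightarrow> prime r \<and> real r > y"
    and y: "y > 1" and k: "k > 0" "real_of_int k \<le> B"
  shows "omega I k \<le> ln B / ln y"
proof -
  define D where "D = {r\<in>I. int r dvd k}"
  have finD: "finite D" using fin by (simp add: D_def)
  have om: "omega I k = real (card D)"
    using fin by (simp add: omega_def D_def sum_of_bool_eq Int_def)
  have "\<Prod>D dvd nat \<bar>k\<bar>"
    using I finD by (intro prod_primes_dvd) (auto simp: D_def)
  then have "\<Prod>D \<le> nat \<bar>k\<bar>" using k by (intro dvd_imp_le) auto
  then have "real (\<Prod>D) \<le> real (nat \<bar>k\<bar>)" by (rule of_nat_mono)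
  also have "\<dots> \<le> B" using k by simp
  finally have prodle: "real (\<Prod>D) \<le> B" .
  have "y ^ card D = (\<Prod>r\<in>D. y)" by simp
  also have "\<dots> \<le> (\<Prod>r\<in>D. real r)" using I y by (intro prod_mono) (auto simp: D_def less_imp_le)
  also have "\<dots> = real (\<Prod>D)" by simp
  also note prodle
  finally have le: "y ^ card D \<le> B" .
  moreover have "0 < y ^ card D" using y by simp
  ultimately have "ln (y ^ card D) \<le> ln B" by (subst ln_le_cancel_iff) auto
  then show ?thesis using y by (simp add: om ln_realpow field_simps)
qed

text \<open>The quotient of \<open>ln (N + J)\<close> and \<open>ln (N powr \<alpha>)\<close> tends
  to \<open>1 / \<alpha>\<close>, which the shift by \<open>J\<close> allows it to exceed slightly;
  \<open>\<kappa>\<close> absorbs this.\<close>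

lemma omega_prime_window_le:
  assumes "0 < \<alpha>" "\<kappa> > 1 / \<alpha>"
  shows "\<forall>\<^sub>F N in sequentially. \<forall>k>0. k \<le> int (N + J) \<longrightarrow> omega (prime_window \<alpha> \<beta> N) k \<le> \<kappa>"
proof -
  have "(\<lambda>N. ln (real N + real J) / ln (real N powr \<alpha>)) \<longlonglongrightarrow> inverse \<alpha>"
    using assms by real_asymp
  then have "\<forall>\<^sub>F N in sequentially. ln (real N + real J) / ln (real N powr \<alpha>) < \<kappa>"
    using assms by (intro order_tendstoD(2)) (auto simp: inverse_eq_divide)
  with eventually_gt_at_top[of 1] show ?thesis
  proof eventually_elim
    case (elim N)
    show ?case
    proof (intro allI impI)
      fix k :: int assume k: "k > 0" "k \<le> int (N + J)"
      then have "real_of_int k \<le> real_of_int (int (N + J))" by (simp only: of_int_le_iff)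
      then have "omega (prime_window \<alpha> \<beta> N) k \<le> ln (real N + real J) / ln (real N powr \<alpha>)"
        using assms elim k by (intro omega_le) (auto simp: prime_window_def primes_in_def)
      then show "omega (prime_window \<alpha> \<beta> N) k \<le> \<kappa>" using elim by simp
    qed
  qed
qed

lemma omega_prod_bounds:
  assumes J: "j0 < J" and m: "J < m" "m \<le> N"
    and om: "\<And>k. 0 < k \<Longrightarrow> k \<le> int (N + J) \<Longrightarrow> omega I k \<le> \<kappa>"
  shows "0 \<le> omega_prod (shifts J j0) I m" "omega_prod (shifts J j0) I m \<le> \<kappa> ^ (J - 1)"
proof -
  show "0 \<le> omega_prod (shifts J j0) I m"
    unfolding omega_prod_def by (intro prod_nonneg omega_nonneg)
  have "omega_prod (shifts J j0) I m \<le> (\<Prod>h\<in>shifts J j0. \<kappa>)"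
    unfolding omega_prod_def
  proof (rule prod_mono)
    fix h assume "h \<in> shifts J j0"
    then have "\<bar>h\<bar> < int J" using J by (rule shifts_bounds)
    then show "0 \<le> omega I (int m + h) \<and> omega I (int m + h) \<le> \<kappa>"
      using m by (intro conjI omega_nonneg om) auto
  qed
  then show "omega_prod (shifts J j0) I m \<le> \<kappa> ^ (J - 1)" using J by (simp add: card_shifts)
qed

text \<open>For \<open>m \<le> J\<close> some \<open>m + h\<close> may be 0, where
  \<open>omega\<close> counts the entire window. Setting these few values to 0 keeps the function
  bounded as the window grows.\<close>

definition centred :: "nat \<Rightarrow> nat \<Rightarrow> nat set \<Rightarrow> nat \<Rightarrow> real" where
  "centred J j0 I m = (if m \<le> J then 0 else omega_prod (shifts J j0) I m - recip_sum I ^ (J - 1))"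

lemma prod_omega_dilates:
  assumes "p \<noteq> q"
  shows "(\<Prod>t\<in>{p, q} \<times> H. omega I (int (fst t) * int a + snd t)) = omega_prod H I (p * a) * omega_prod H I (q * a)"
    and "(\<Prod>t\<in>{p} \<times> H. omega I (int (fst t) * int a + snd t)) = omega_prod H I (p * a)"
proof -
  have *: "(\<Prod>t\<in>P \<times> H. omega I (int (fst t) * int a + snd t)) = (\<Prod>p\<in>P. omega_prod H I (p * a))" for P
    by (simp add: prod.cartesian_product case_prod_beta omega_prod_def)
  show "(\<Prod>t\<in>{p, q} \<times> H. omega I (int (fst t) * int a + snd t)) = omega_prod H I (p * a) * omega_prod H I (q * a)"
    unfolding * using assms by simp
  show "(\<Prod>t\<in>{p} \<times> H. omega I (int (fst t) * int a + snd t)) = omega_prod H I (p * a)"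
    unfolding * by simp
qed

text \<open>Expanding the product of differences leads to one mean value over
  \<open>2 * (J - 1)\<close> forms, the source of the condition on \<beta>, and two over
  \<open>J - 1\<close> forms; their main terms cancel. Distinct forms \<open>p * a + h\<close> and
  \<open>q * a + h'\<close> are not proportional, since otherwise \<open>p\<close> would divide
  \<open>h\<close>, a nonzero number smaller than \<open>J\<close> in absolute value.\<close>

lemma centred_correlation:
  assumes ab: "0 < \<alpha>" "\<alpha> < \<beta>" and b: "\<beta> * real (2 * (J - 1)) < 1" and J: "j0 < J"
    and pq: "prime p" "prime q" "p \<noteq> q" "p > J" "q > J" and \<eta>: "\<eta> > 0"
  shows "\<forall>\<^sub>F N in sequentially. \<bar>\<Sum>a=1..min (N div p) (N div q).
      centred J j0 (prime_window \<alpha> \<beta> N) (p * a) * centred J j0 (prime_window \<alpha> \<beta> N) (q * a)\<bar> \<le> \<eta> * real N"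
proof -
  define H where "H = shifts J j0"
  define I where "I = prime_window \<alpha> \<beta>"
  define L where "L = ln (\<beta> / \<alpha>) ^ (J - 1) + 1"
  have L: "L > 0" using ab by (auto simp: L_def intro!: add_nonneg_pos)
  \<comment> \<open>Of the three mean values one enters with coefficient 1 and two with a
    coefficient of size at most \<open>L\<close>, so their errors add up to
    \<open>\<eta>\<close>.\<close>
  define \<delta> where "\<delta> = \<eta> / (1 + 2 * L)"
  have \<delta>: "\<delta> > 0" using \<eta> L by (simp add: \<delta>_def)
  have res: "int (fst s) * snd t \<noteq> int (fst t) * snd s"
    if st: "s \<in> {p, q} \<times> H" "t \<in> {p, q} \<times> H" "s \<noteq> t" for s t
  proof
    assume eq: "int (fst s) * snd t = int (fst t) * snd s"
    have Hb: "\<not> int r dvd h" if "h \<in> H" "r > J" for h :: int and r :: nat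
    proof
      assume "int r dvd h"
      moreover have "h \<noteq> 0" "\<bar>h\<bar> < int J" using that J by (auto simp: H_def dest: shifts_bounds)
      ultimately show False using that dvd_imp_le_int[of h "int r"] by simp
    qed
    have primes: "prime (fst s)" "prime (fst t)" "fst s > J" "fst t > J" "snd s \<in> H" "snd t \<in> H" using st pq by auto
    show False
    proof (cases "fst s = fst t")
      case True
      then have "snd s = snd t" using eq primes by auto
      with True st show False by (simp add: prod_eq_iff)
    next
      case False
      have "int (fst s) dvd int (fst t) * snd s" using eq by (metis dvd_triv_left)
      moreover have "prime (int (fst s))" using primes by simp
      ultimately have "int (fst s) dvd int (fst t) \<or> int (fst s) dvd snd s" by (simp only: prime_dvd_mult_iff)
      then show False
        using Hb[of "snd s" "fst s"] primes False by (auto dest: primes_dvd_imp_eq)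
    qed
  qed
  have cardH: "card H = J - 1" unfolding H_def using J by (rule card_shifts)
  have finH: "finite H" by (simp add: H_def)
  have c2: "card ({p, q} \<times> H) = 2 * (J - 1)" using pq by (simp add: card_cartesian_product cardH)
  have c1: "card ({r} \<times> H) = J - 1" for r :: nat by (simp add: card_cartesian_product cardH)
  have b1: "\<beta> * real (J - 1) < 1"
  proof -
    have "\<beta> * real (J - 1) \<le> \<beta> * real (2 * (J - 1))" using ab by (intro mult_left_mono) auto
    with b show ?thesis by linarith
  qed
  have both: "\<forall>\<^sub>F N in sequentially. \<forall>X\<le>N. \<bar>(\<Sum>a=1..X. \<Prod>t\<in>{p, q} \<times> H. omega (prime_window \<alpha> \<beta> N) (int (fst t) * int a + snd t))
       - real X * recip_sum (prime_window \<alpha> \<beta> N) ^ card ({p, q} \<times> H)\<bar> \<le> \<delta> * real N"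
  proof (rule prime_window_correlation[OF ab _ _ _ res \<delta>])
    show "\<beta> * real (card ({p, q} \<times> H)) < 1" unfolding c2 by (rule b)
  qed (use pq prime_gt_0_nat finH in auto)
  have single: "\<forall>\<^sub>F N in sequentially. \<forall>X\<le>N. \<bar>(\<Sum>a=1..X. \<Prod>t\<in>{r} \<times> H. omega (prime_window \<alpha> \<beta> N) (int (fst t) * int a + snd t))
       - real X * recip_sum (prime_window \<alpha> \<beta> N) ^ card ({r} \<times> H)\<bar> \<le> \<delta> * real N" if "r \<in> {p, q}" for r
  proof (rule prime_window_correlation[OF ab _ _ _ _ \<delta>])
    fix s t assume "s \<in> {r} \<times> H" "t \<in> {r} \<times> H" "s \<noteq> t"
    then show "int (fst s) * snd t \<noteq> int (fst t) * snd s" using that by (intro res) auto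
  qed (use that pq prime_gt_0_nat b1 finH in \<open>auto simp: c1\<close>)
  have "(\<lambda>N. recip_sum (I N) ^ (J - 1)) \<longlonglongrightarrow> ln (\<beta> / \<alpha>) ^ (J - 1)"
    unfolding I_def by (intro tendsto_intros recip_sum_prime_window ab)
  then have Lam: "\<forall>\<^sub>F N in sequentially. recip_sum (I N) ^ (J - 1) < L"
    by (rule order_tendstoD(2)) (simp add: L_def)
  from both single[of p, simplified] single[of q, simplified] Lam show ?thesis
    unfolding I_def[symmetric]
  proof eventually_elim
    case (elim N)
    define X where "X = min (N div p) (N div q)"
    have X: "X \<le> N" unfolding X_def by (intro min.coboundedI1) simp
    define \<Lambda> where "\<Lambda> = recip_sum (I N) ^ (J - 1)"
    have Lam: "0 \<le> \<Lambda>" "\<Lambda> \<le> L" using elim(4) by (auto simp: \<Lambda>_def recip_sum_nonneg)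
    define g where "g = (\<lambda>r a. omega_prod H (I N) (r * a))"
    have e1: "\<bar>(\<Sum>a=1..X. g p a * g q a) - real X * \<Lambda>\<^sup>2\<bar> \<le> \<delta> * real N"
      using elim(1) X unfolding prod_omega_dilates[OF pq(3)] c2 g_def \<Lambda>_def
      by (simp add: mult.commute flip: power_mult)
    have e2: "\<bar>(\<Sum>a=1..X. g p a) - real X * \<Lambda>\<bar> \<le> \<delta> * real N"
      using elim(2)[rule_format, OF X] unfolding prod_omega_dilates(2)[OF pq(3)] c1 g_def \<Lambda>_def by simp
    have e3: "\<bar>(\<Sum>a=1..X. g q a) - real X * \<Lambda>\<bar> \<le> \<delta> * real N"
      using elim(3)[rule_format, OF X] unfolding prod_omega_dilates(2)[OF pq(3)[symmetric]] c1 g_def \<Lambda>_def by simp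
    have big: "\<not> r * a \<le> J" if "r > J" "a \<ge> 1" for r a :: nat
    proof -
      have "r * 1 \<le> r * a" using that by (intro mult_le_mono2) auto
      with that show ?thesis by linarith
    qed
    have "(\<Sum>a=1..X. centred J j0 (I N) (p * a) * centred J j0 (I N) (q * a)) = (\<Sum>a=1..X. (g p a - \<Lambda>) * (g q a - \<Lambda>))"
      using big pq by (intro sum.cong refl) (auto simp: centred_def g_def \<Lambda>_def H_def)
    also have "\<dots> = (\<Sum>a=1..X. g p a * g q a - \<Lambda> * g p a - \<Lambda> * g q a + \<Lambda>\<^sup>2)"
      by (intro sum.cong refl) (simp add: algebra_simps power2_eq_square)
    also have "\<dots> = (\<Sum>a=1..X. g p a * g q a) - \<Lambda> * (\<Sum>a=1..X. g p a) - \<Lambda> * (\<Sum>a=1..X. g q a) + real X * \<Lambda>\<^sup>2"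
      by (simp add: sum.distrib sum_subtractf sum_distrib_left)
    also have "\<dots> = ((\<Sum>a=1..X. g p a * g q a) - real X * \<Lambda>\<^sup>2) - \<Lambda> * ((\<Sum>a=1..X. g p a) - real X * \<Lambda>)
        - \<Lambda> * ((\<Sum>a=1..X. g q a) - real X * \<Lambda>)"
      by (simp add: algebra_simps power2_eq_square)
    finally have eq: "(\<Sum>a=1..X. centred J j0 (I N) (p * a) * centred J j0 (I N) (q * a)) = \<dots>" .
    have l2: "\<bar>\<Lambda> * ((\<Sum>a=1..X. g p a) - real X * \<Lambda>)\<bar> \<le> L * (\<delta> * real N)"
      unfolding abs_mult using Lam L e2 by (intro mult_mono) auto
    have l3: "\<bar>\<Lambda> * ((\<Sum>a=1..X. g q a) - real X * \<Lambda>)\<bar> \<le> L * (\<delta> * real N)"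
      unfolding abs_mult using Lam L e3 by (intro mult_mono) auto
    have "\<bar>\<Sum>a=1..X. centred J j0 (I N) (p * a) * centred J j0 (I N) (q * a)\<bar> \<le> \<delta> * real N + L * (\<delta> * real N) + L * (\<delta> * real N)"
      unfolding eq using e1 l2 l3 by linarith
    also have "\<dots> = \<delta> * (1 + 2 * L) * real N" by (simp add: algebra_simps)
    also have "\<dots> = \<eta> * real N" using L by (simp add: \<delta>_def)
    finally show ?case by (simp add: X_def)
  qed
qed

section \<open>The weight summed over smooth numbers\<close>

lemma smooth_dilate:
  assumes "prime p" "real p \<le> y" "a > 0"
  shows "smooth y (p * a) \<longleftrightarrow> smooth y a"
proof -
  have "real q \<le> y" if "prime q" "q dvd p" for q
    using primes_dvd_imp_eq[OF that(1) assms(1) that(2)] assms(2) by simp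
  then show ?thesis using assms prime_gt_0_nat[OF assms(1)] by (auto simp: smooth_def prime_dvd_mult_iff)
qed

lemma smooth_count_tendsto:
  assumes "\<alpha> > 0"
  shows "(\<lambda>N. (\<Sum>m=1..N. of_bool (smooth (real N powr \<alpha>) m)) / real N) \<longlonglongrightarrow> dickman (1 / \<alpha>)"
proof -
  have "(\<lambda>N. smooth_density (1 / \<alpha>) (real N)) \<longlonglongrightarrow> dickman (1 / \<alpha>)"
    using assms by (intro filterlim_compose[OF smooth_density_tendsto filterlim_real_sequentially]) auto
  moreover have "smooth_density (1 / \<alpha>) (real N) = (\<Sum>m=1..N. of_bool (smooth (real N powr \<alpha>) m)) / real N" for N
  proof -
    have "{m. smooth (real N powr \<alpha>) m \<and> real m \<le> real N} = {m\<in>{1..N}. smooth (real N powr \<alpha>) m}"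
      by (auto simp: smooth_def)
    then show ?thesis by (simp add: smooth_density_def Psi_def sum_of_bool_eq Int_def)
  qed
  ultimately show ?thesis by simp
qed

text \<open>Beyond \<open>J\<close> the weight is its centred version plus the mean
  \<open>\<Lambda> N\<close>. The Katai criterion removes the centred part, and the mean is
  multiplied by the density of the smooth numbers.\<close>

lemma weighted_smooth_sum_tendsto:
  assumes ab: "0 < \<alpha>" "\<alpha> < \<beta>" and b: "\<beta> * real (2 * (J - 1)) < 1" and J: "j0 < J"
  shows "(\<lambda>N. (\<Sum>m=1..N. of_bool (smooth (real N powr \<alpha>) m) *
      (if m \<le> J then 0 else omega_prod (shifts J j0) (prime_window \<alpha> \<beta> N) m)) / real N)
    \<longlonglongrightarrow> ln (\<beta> / \<alpha>) ^ (J - 1) * dickman (1 / \<alpha>)"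
proof -
  define I where "I = prime_window \<alpha> \<beta>"
  define f where "f = (\<lambda>N m. of_bool (smooth (real N powr \<alpha>) m) :: real)"
  define F where "F = (\<lambda>N m. centred J j0 (I N) m)"
  define \<Lambda> where "\<Lambda> = (\<lambda>N. recip_sum (I N) ^ (J - 1))"
  have Lam: "\<Lambda> \<longlonglongrightarrow> ln (\<beta> / \<alpha>) ^ (J - 1)"
    unfolding \<Lambda>_def I_def by (intro tendsto_intros recip_sum_prime_window ab)
  define \<kappa> where "\<kappa> = 1 / \<alpha> + 1"
  define K where "K = \<kappa> ^ (J - 1) + (ln (\<beta> / \<alpha>) ^ (J - 1) + 1)"
  have main: "(\<lambda>N. (\<Sum>m=1..N. f N m * F N m) / real N) \<longlonglongrightarrow> 0"
  proof (rule katai_criterion)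
    show "\<bar>f N m\<bar> \<le> 1" for N m by (simp add: f_def)
  next
    fix p :: nat assume p: "prime p"
    \<comment> \<open>Multiplication by \<open>p\<close> preserves smoothness once
      \<open>N powr \<alpha>\<close> has passed \<open>p\<close>, which for a fixed prime happens
      eventually.\<close>
    have "filterlim (\<lambda>N. real N powr \<alpha>) at_top sequentially" using ab by real_asymp
    then have "\<forall>\<^sub>F N in sequentially. real N powr \<alpha> > real p" by (rule filterlim_at_top_dense[THEN iffD1, rule_format])
    then show "\<forall>\<^sub>F N in sequentially. \<forall>a>0. f N (p * a) = f N a"
      by eventually_elim (use p in \<open>simp add: f_def smooth_dilate\<close>)
  next
    have "\<forall>\<^sub>F N in sequentially. \<Lambda> N < ln (\<beta> / \<alpha>) ^ (J - 1) + 1" using Lam by (rule order_tendstoD(2)) simp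
    moreover have "\<forall>\<^sub>F N in sequentially. \<forall>k>0. k \<le> int (N + J) \<longrightarrow> omega (I N) k \<le> \<kappa>"
      unfolding I_def using ab by (intro omega_prime_window_le) (auto simp: \<kappa>_def)
    ultimately show "\<forall>\<^sub>F N in sequentially. \<forall>m\<in>{1..N}. \<bar>F N m\<bar> \<le> K"
    proof eventually_elim
      case (elim N)
      have L0: "0 \<le> \<Lambda> N" by (simp add: \<Lambda>_def recip_sum_nonneg)
      have K0: "\<kappa> ^ (J - 1) \<ge> 0" "ln (\<beta> / \<alpha>) ^ (J - 1) \<ge> 0" using ab by (auto simp: \<kappa>_def)
      show ?case
      proof
        fix m assume m: "m \<in> {1..N}"
        show "\<bar>F N m\<bar> \<le> K"
        proof (cases "m \<le> J")
          case True
          then show ?thesis using K0 by (simp add: F_def centred_def K_def)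
        next
          case False
          then have "0 \<le> omega_prod (shifts J j0) (I N) m" "omega_prod (shifts J j0) (I N) m \<le> \<kappa> ^ (J - 1)"
            using omega_prod_bounds[OF J, of m N "I N" \<kappa>] elim(2) m by auto
          moreover have "F N m = omega_prod (shifts J j0) (I N) m - \<Lambda> N" using False by (simp add: F_def centred_def \<Lambda>_def)
          ultimately show ?thesis unfolding K_def using L0 elim(1) K0 by linarith
        qed
      qed
    qed
  next
    fix p q :: nat and \<eta> :: real
    assume "prime p" "prime q" "p \<noteq> q" "p > J" "q > J" "\<eta> > 0"
    then show "\<forall>\<^sub>F N in sequentially. \<bar>\<Sum>a=1..min (N div p) (N div q). F N (p * a) * F N (q * a)\<bar> \<le> \<eta> * real N"
      unfolding F_def I_def by (rule centred_correlation[OF ab b J])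
  qed
  \<comment> \<open>Weight and \<open>centred\<close> both vanish for \<open>m \<le> J\<close>, so
    adding the mean everywhere overcounts there, by at most \<open>J\<close> terms.\<close>
  have small: "(\<lambda>N. (\<Sum>m=1..N. f N m * of_bool (m \<le> J)) / real N) \<longlonglongrightarrow> 0"
  proof (rule tendsto_sandwich[of "\<lambda>_. 0" _ _ "\<lambda>N. real J / real N"])
    show "(\<lambda>N. real J / real N) \<longlonglongrightarrow> 0" by real_asymp
    show "\<forall>\<^sub>F N in sequentially. (\<Sum>m=1..N. f N m * of_bool (m \<le> J)) / real N \<le> real J / real N"
    proof (intro always_eventually allI divide_right_mono)
      fix N
      have "(\<Sum>m=1..N. f N m * of_bool (m \<le> J)) \<le> (\<Sum>m=1..N. of_bool (m \<le> J))"
        by (intro sum_mono) (simp add: f_def)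
      also have "\<dots> = real (card {m\<in>{1..N}. m \<le> J})" by (simp add: sum_of_bool_eq Int_def)
      also have "\<dots> \<le> real (card {1..J})" by (intro of_nat_mono card_mono) auto
      finally show "(\<Sum>m=1..N. f N m * of_bool (m \<le> J)) \<le> real J" by simp
    qed simp
    show "\<forall>\<^sub>F N in sequentially. 0 \<le> (\<Sum>m=1..N. f N m * of_bool (m \<le> J)) / real N"
      by (intro always_eventually allI divide_nonneg_nonneg sum_nonneg) (auto simp: f_def)
  qed simp
  have "(\<lambda>N. (\<Sum>m=1..N. f N m * F N m) / real N + \<Lambda> N * ((\<Sum>m=1..N. f N m) / real N)
      - \<Lambda> N * ((\<Sum>m=1..N. f N m * of_bool (m \<le> J)) / real N))
    \<longlonglongrightarrow> 0 + ln (\<beta> / \<alpha>) ^ (J - 1) * dickman (1 / \<alpha>) - ln (\<beta> / \<alpha>) ^ (J - 1) * 0"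
    unfolding f_def
    by (intro tendsto_diff tendsto_add tendsto_mult Lam smooth_count_tendsto ab main[unfolded f_def] small[unfolded f_def])
  moreover have "(\<Sum>m=1..N. f N m * (if m \<le> J then 0 else omega_prod (shifts J j0) (I N) m)) / real N =
    (\<Sum>m=1..N. f N m * F N m) / real N + \<Lambda> N * ((\<Sum>m=1..N. f N m) / real N)
      - \<Lambda> N * ((\<Sum>m=1..N. f N m * of_bool (m \<le> J)) / real N)" for N
  proof -
    have "(\<Sum>m=1..N. f N m * (if m \<le> J then 0 else omega_prod (shifts J j0) (I N) m)) =
       (\<Sum>m=1..N. f N m * F N m + \<Lambda> N * f N m - \<Lambda> N * (f N m * of_bool (m \<le> J)))"
      by (intro sum.cong refl) (simp add: F_def centred_def \<Lambda>_def algebra_simps)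
    then show ?thesis
      by (simp only: sum.distrib sum_subtractf add_divide_distrib diff_divide_distrib times_divide_eq_right flip: sum_distrib_left)
  qed
  ultimately show ?thesis unfolding f_def I_def by simp
qed

section \<open>From the weighted sum to the counting function\<close>

lemma Pplus_le:
  assumes "smooth y m" "m > 1" shows "real (Pplus m) \<le> y"
proof -
  obtain p where "prime p" "p dvd m" using assms prime_factor_nat[of m] by auto
  then have "p \<in> prime_factors m" using assms by (simp add: in_prime_factors_iff)
  then have "prime_factors m \<noteq> {}" by blast
  then have "Max (prime_factors m) \<in> prime_factors m" by (intro Max_in) auto
  then show ?thesis using assms by (auto simp: Pplus_def smooth_def in_prime_factors_iff)
qed

lemma le_Pplus:
  assumes "prime p" "p dvd m" "m > 0" shows "p \<le> Pplus m"
proof -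
  have "m > 1" using assms prime_gt_1_nat[OF assms(1)] dvd_imp_le[of p m] by linarith
  moreover have "p \<in> prime_factors m" using assms by (simp add: in_prime_factors_iff)
  ultimately show ?thesis by (simp add: Pplus_def)
qed

lemma omega_pos_obtain:
  assumes "omega I k > 0" obtains r where "r \<in> I" "int r dvd k"
proof -
  have "\<exists>r\<in>I. int r dvd k"
  proof (rule ccontr)
    assume "\<not> ?thesis"
    then have "omega I k = 0" by (simp add: omega_def)
    with assms show False by simp
  qed
  then show ?thesis using that by blast
qed

text \<open>A nonzero term certifies that \<open>m = n + j0\<close> is smooth while every other
  \<open>n + j\<close> has a prime factor above the smoothness bound, so that \<open>n\<close> is
  counted. Each such term is at most \<open>\<kappa> ^ (J - 1)\<close>, which is the loss.\<close>

lemma weighted_sum_le_count: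
  assumes J: "J \<ge> 2" "j0 < J"
    and om: "\<And>k. 0 < k \<Longrightarrow> k \<le> int (N + J) \<Longrightarrow> omega (prime_window \<alpha> \<beta> N) k \<le> \<kappa>"
    and \<kappa>: "\<kappa> \<ge> 0"
  shows "(\<Sum>m=1..N. of_bool (smooth (real N powr \<alpha>) m) *
      (if m \<le> J then 0 else omega_prod (shifts J j0) (prime_window \<alpha> \<beta> N) m))
    \<le> \<kappa> ^ (J - 1) * real (min_at_count J j0 (real N))"
proof -
  define y where "y = real N powr \<alpha>"
  define I where "I = prime_window \<alpha> \<beta> N"
  define A where "A = {m\<in>{1..N}. m > J \<and> smooth y m \<and> (\<forall>h\<in>shifts J j0. omega I (int m + h) > 0)}"
  define S where "S = {n. 1 \<le> n \<and> real n \<le> real N \<and> Pplus (n + j0) = Min ((\<lambda>j. Pplus (n + j)) ` {0..J - 1})}"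
  have "(\<Sum>m=1..N. of_bool (smooth y m) * (if m \<le> J then 0 else omega_prod (shifts J j0) I m))
     \<le> (\<Sum>m=1..N. \<kappa> ^ (J - 1) * of_bool (m \<in> A))"
  proof (rule sum_mono)
    fix m assume m: "m \<in> {1..N}"
    show "of_bool (smooth y m) * (if m \<le> J then 0 else omega_prod (shifts J j0) I m) \<le> \<kappa> ^ (J - 1) * of_bool (m \<in> A)"
    proof (cases "m \<in> A")
      case True
      then have "J < m" "m \<le> N" by (auto simp: A_def)
      then have "omega_prod (shifts J j0) I m \<le> \<kappa> ^ (J - 1)"
        using om unfolding I_def by (intro omega_prod_bounds[OF J(2)])
      then show ?thesis using True by (auto simp: A_def)
    next
      case False
      have "omega_prod (shifts J j0) I m = 0" if mJ: "m > J" "smooth y m"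
      proof -
        obtain h where "h \<in> shifts J j0" "\<not> omega I (int m + h) > 0" using False mJ m by (auto simp: A_def)
        then have "h \<in> shifts J j0" "omega I (int m + h) = 0" using omega_nonneg[of I "int m + h"] by auto
        then show ?thesis unfolding omega_prod_def by (intro prod_zero) auto
      qed
      then show ?thesis using False by auto
    qed
  qed
  also have "\<dots> = \<kappa> ^ (J - 1) * real (card A)"
  proof -
    have "{m\<in>{1..N}. m \<in> A} = A" by (auto simp: A_def)
    then show ?thesis by (simp add: sum_of_bool_eq Int_def flip: sum_distrib_left)
  qed
  also have "\<dots> \<le> \<kappa> ^ (J - 1) * real (card S)"
  proof (intro mult_left_mono of_nat_mono)
    have "finite S" by (rule finite_subset[of _ "{..N}"]) (auto simp: S_def)
    \<comment> \<open>On \<open>A\<close> we have \<open>m > J > j0\<close>, so the subtraction of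
      naturals is not truncated and gives \<open>n \<ge> 1\<close>.\<close>
    moreover have "inj_on (\<lambda>m. m - j0) A" using J by (auto intro!: inj_onI simp: A_def)
    moreover have "(\<lambda>m. m - j0) ` A \<subseteq> S"
    proof
      fix n assume "n \<in> (\<lambda>m. m - j0) ` A"
      then obtain m where m: "m \<in> A" "n = m - j0" by auto
      then have mJ: "m > J" "m \<le> N" "smooth y m" by (auto simp: A_def)
      then have nj: "n + j0 = m" "n \<ge> 1" "n \<le> N" using m J by auto
      have up: "real (Pplus (n + j0)) \<le> y" using mJ J nj by (intro Pplus_le) auto
      have lo: "Pplus (n + j0) \<le> Pplus (n + j)" if "j \<in> {0..J - 1}" for j
      proof (cases "j = j0")
        case False
        then have "int j - int j0 \<in> shifts J j0" using that J by (auto simp: shifts_def)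
        then have "omega I (int m + (int j - int j0)) > 0" using m(1) by (auto simp: A_def)
        moreover have "int m + (int j - int j0) = int (n + j)" using nj by simp
        ultimately obtain r where r: "r \<in> I" "int r dvd int (n + j)" by (metis omega_pos_obtain)
        then have "r dvd n + j" by (simp only: int_dvd_int_iff)
        moreover have "prime r" "real r > y" using r by (auto simp: I_def prime_window_def primes_in_def y_def)
        ultimately have "r \<le> Pplus (n + j)" using nj by (intro le_Pplus) auto
        with up \<open>real r > y\<close> show ?thesis by linarith
      qed simp
      have "Min ((\<lambda>j. Pplus (n + j)) ` {0..J - 1}) = Pplus (n + j0)"
        using J lo by (intro Min_eqI) auto
      then show "n \<in> S" using nj by (simp add: S_def)
    qed
    ultimately show "card A \<le> card S" by (intro card_inj_on_le[of "\<lambda>m. m - j0" A S])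
  qed (use \<kappa> in auto)
  finally show ?thesis unfolding S_def min_at_count_def y_def I_def .
qed

lemma min_at_count_lower:
  assumes ab: "0 < \<alpha>" "\<alpha> < \<beta>" and b: "\<beta> * real (2 * (J - 1)) < 1" and J: "J \<ge> 2" "j0 < J"
    and \<kappa>: "\<kappa> > 1 / \<alpha>" and c: "c < ln (\<beta> / \<alpha>) ^ (J - 1) * dickman (1 / \<alpha>) / \<kappa> ^ (J - 1)"
  shows "\<forall>\<^sub>F N in sequentially. c * real N \<le> real (min_at_count J j0 (real N))"
proof -
  have "1 / \<alpha> > 0" using ab by simp
  with \<kappa> have \<kappa>0: "\<kappa> > 0" by linarith
  then have "c * \<kappa> ^ (J - 1) < ln (\<beta> / \<alpha>) ^ (J - 1) * dickman (1 / \<alpha>)"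
    using c by (simp add: pos_less_divide_eq)
  then have "\<forall>\<^sub>F N in sequentially. c * \<kappa> ^ (J - 1) < (\<Sum>m=1..N. of_bool (smooth (real N powr \<alpha>) m) *
      (if m \<le> J then 0 else omega_prod (shifts J j0) (prime_window \<alpha> \<beta> N) m)) / real N"
    using weighted_smooth_sum_tendsto[OF ab b J(2)] by (intro order_tendstoD(1))
  with omega_prime_window_le[OF ab(1) \<kappa>, of J \<beta>] eventually_gt_at_top[of 0] show ?thesis
  proof eventually_elim
    case (elim N)
    have "c * \<kappa> ^ (J - 1) * real N \<le> (\<Sum>m=1..N. of_bool (smooth (real N powr \<alpha>) m) *
      (if m \<le> J then 0 else omega_prod (shifts J j0) (prime_window \<alpha> \<beta> N) m))"
      using elim(2,3) by (simp add: pos_less_divide_eq less_imp_le)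
    also have "\<dots> \<le> \<kappa> ^ (J - 1) * real (min_at_count J j0 (real N))"
      using elim(1) \<kappa>0 by (intro weighted_sum_le_count J) auto
    finally have "\<kappa> ^ (J - 1) * (c * real N) \<le> \<kappa> ^ (J - 1) * real (min_at_count J j0 (real N))"
      by (simp add: mult_ac)
    then show ?case using \<kappa>0 by (simp only: mult_le_cancel_left_pos zero_less_power)
  qed
qed

lemma min_at_count_C3:
  assumes J: "J \<ge> 3" "j0 < J" and c: "c < C3 J"
  shows "\<forall>\<^sub>F N in sequentially. c * real N \<le> real (min_at_count J j0 (real N))"
proof -
  obtain \<alpha> where a: "\<alpha> \<in> C3_range J" "C3 J = C3_fun J \<alpha>" using C3_attained[OF J(1)] by blast
  define b where "b = 1 / (2 * (real J - 1))"
  have b: "b > 0" "b * real (2 * (J - 1)) = 1" using J by (auto simp: b_def of_nat_diff)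
  have ab: "0 < \<alpha>" "\<alpha> < b" using a by (auto simp: C3_range_def b_def)
  \<comment> \<open>One parameter moves both strict inequalities of
    \<open>min_at_count_lower\<close>: \<open>\<beta> = b * (1 - t)\<close> stays below
    \<open>b\<close> and \<open>\<kappa> = (1 + t) / \<alpha>\<close> above
    \<open>1 / \<alpha>\<close>. At \<open>t = 0\<close> the constant is \<open>C3 J\<close>, and
    continuity leaves it above \<open>c\<close> for small \<open>t\<close>.\<close>
  define g where "g = (\<lambda>t. ln (b * (1 - t) / \<alpha>) ^ (J - 1) * dickman (1 / \<alpha>) / ((1 + t) / \<alpha>) ^ (J - 1))"
  have "C3 J = ln (b / \<alpha>) ^ (J - 1) * dickman (1 / \<alpha>) / (1 / \<alpha>) ^ (J - 1)"
  proof -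
    have "1 / (2 * \<alpha> * (real J - 1)) = b / \<alpha>" by (simp add: b_def)
    then show ?thesis by (simp add: a(2) C3_fun_def power_mult_distrib power_one_over)
  qed
  moreover have "(g \<longlongrightarrow> ln (b * (1 - 0) / \<alpha>) ^ (J - 1) * dickman (1 / \<alpha>) / ((1 + 0) / \<alpha>) ^ (J - 1)) (at_right 0)"
    unfolding g_def using ab by (intro tendsto_intros) auto
  ultimately have "(g \<longlongrightarrow> C3 J) (at_right 0)" by simp
  then have "\<forall>\<^sub>F t in at_right 0. c < g t" using c by (rule order_tendstoD(1))
  moreover have "\<forall>\<^sub>F t in at_right 0. t < 1 - \<alpha> / b"
    using ab by (intro eventually_at_right_real[THEN eventually_mono, of 0 "1 - \<alpha> / b"]) (auto simp: field_simps)
  moreover have "\<forall>\<^sub>F t in at_right (0::real). t > 0" by (rule eventually_at_right_less)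
  ultimately have "\<forall>\<^sub>F t in at_right 0. c < g t \<and> t < 1 - \<alpha> / b \<and> t > 0" by eventually_elim simp
  then obtain t where t: "c < g t" "t < 1 - \<alpha> / b" "t > 0"
    by (auto dest!: eventually_happens'[OF trivial_limit_at_right_real])
  show ?thesis
  proof (rule min_at_count_lower[of \<alpha> "b * (1 - t)" J j0 "(1 + t) / \<alpha>"])
    show "\<alpha> < b * (1 - t)" using t ab b by (simp add: field_simps)
    have "b * (1 - t) * real (2 * (J - 1)) = (b * real (2 * (J - 1))) * (1 - t)" by simp
    also have "\<dots> < 1" unfolding b(2) using t by simp
    finally show "b * (1 - t) * real (2 * (J - 1)) < 1" .
    show "1 / \<alpha> < (1 + t) / \<alpha>" using t ab by (intro divide_strict_right_mono) auto
  qed (use ab J t in \<open>auto simp: g_def\<close>)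
qed

lemma min_at_count_floor:
  "x \<ge> 0 \<Longrightarrow> min_at_count J j0 x = min_at_count J j0 (real (nat \<lfloor>x\<rfloor>))"
proof -
  assume "x \<ge> 0"
  then have "real n \<le> x \<longleftrightarrow> real n \<le> real (nat \<lfloor>x\<rfloor>)" for n
    by (simp only: of_nat_le_iff) (simp add: le_nat_iff le_floor_iff)
  then show ?thesis by (simp add: min_at_count_def)
qed

lemma min_at_count_ratio:
  assumes J: "J \<ge> 3" "j0 < J" and c: "c < C3 J"
  shows "\<forall>\<^sub>F x in at_top. c < real (min_at_count J j0 x) / x"
proof -
  \<comment> \<open>The gap between \<open>c\<close> and \<open>d\<close> absorbs the rounding of
    \<open>x\<close>: \<open>c * x < d * (x - 1)\<close> as soon as \<open>x > d / (d - c)\<close>.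
    The maximum with \<open>C3 J / 2\<close> keeps \<open>d\<close> positive when \<open>c\<close>
    is negative.\<close>
  define d where "d = max (C3 J / 2) ((c + C3 J) / 2)"
  have d: "d > 0" "c < d" "d < C3 J" using C3_pos[OF J(1)] c by (auto simp: d_def less_max_iff_disj)
  have "filterlim (\<lambda>x::real. nat \<lfloor>x\<rfloor>) sequentially at_top"
    by (intro filterlim_compose[OF filterlim_nat_sequentially] filterlim_floor_sequentially)
  then have "\<forall>\<^sub>F x::real in at_top. d * real (nat \<lfloor>x\<rfloor>) \<le> real (min_at_count J j0 (real (nat \<lfloor>x\<rfloor>)))"
    by (rule eventually_compose_filterlim[OF min_at_count_C3[OF J d(3)]])
  moreover have "\<forall>\<^sub>F x in at_top. x > max 1 (d / (d - c))" by (rule eventually_gt_at_top)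
  ultimately show ?thesis
  proof eventually_elim
    case (elim x)
    then have x: "x > 1" "x > d / (d - c)" by auto
    then have "d < (d - c) * x" using d by (simp add: pos_divide_less_eq mult.commute)
    then have "c * x < d * (x - 1)" by (simp add: algebra_simps)
    also have "\<dots> \<le> d * real (nat \<lfloor>x\<rfloor>)" using d x by (intro mult_left_mono) linarith+
    also have "\<dots> \<le> real (min_at_count J j0 x)" using elim x by (simp add: min_at_count_floor[of x])
    finally show ?case using x by (simp add: pos_less_divide_eq)
  qed
qed

theorem theorem3:
  fixes J j0 :: nat
  assumes "J \<ge> 3" and "j0 \<in> {0..J - 1}"
  shows "(\<exists>\<alpha>\<in>C3_range J. C3 J = C3_fun J \<alpha> \<and> (\<forall>\<beta>\<in>C3_range J. C3_fun J \<beta> \<le> C3 J)) \<and>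
         C3 J > 0 \<and>
         (\<exists>e :: real \<Rightarrow> real. e \<in> o[at_top](\<lambda>_. 1) \<and>
            (\<forall>\<^sub>F x in at_top. real (min_at_count J j0 x) \<ge> (C3 J + e x) * x))"
proof (intro conjI)
  show "\<exists>\<alpha>\<in>C3_range J. C3 J = C3_fun J \<alpha> \<and> (\<forall>\<beta>\<in>C3_range J. C3_fun J \<beta> \<le> C3 J)"
    using assms(1) by (rule C3_attained)
  show "C3 J > 0" using assms(1) by (rule C3_pos)
  have J: "j0 < J" using assms by auto
  \<comment> \<open>The required inequality holds by construction, and thanks to the cut-off at 0
    the lower bound for the ratio alone forces \<open>e\<close> to tend to 0.\<close>
  define e where "e = (\<lambda>x. min 0 (real (min_at_count J j0 x) / x - C3 J))"
  have "(e \<longlongrightarrow> 0) at_top"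
  proof (rule tendstoI)
    fix \<epsilon> :: real assume \<epsilon>: "\<epsilon> > 0"
    have "\<forall>\<^sub>F x in at_top. C3 J - \<epsilon> < real (min_at_count J j0 x) / x"
      using \<epsilon> by (intro min_at_count_ratio assms J) simp
    then show "\<forall>\<^sub>F x in at_top. dist (e x) 0 < \<epsilon>"
      by eventually_elim (use \<epsilon> in \<open>auto simp: e_def dist_real_def min_def\<close>)
  qed
  then have "e \<in> o[at_top](\<lambda>_. 1)" by (intro smalloI_tendsto) auto
  moreover have "\<forall>\<^sub>F x in at_top. real (min_at_count J j0 x) \<ge> (C3 J + e x) * x"
    using eventually_gt_at_top[of 0]
  proof eventually_elim
    case (elim x)
    have "C3 J + e x \<le> real (min_at_count J j0 x) / x" by (simp add: e_def)
    then show ?case using elim by (simp add: pos_le_divide_eq)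
  qed
  ultimately show "\<exists>e :: real \<Rightarrow> real. e \<in> o[at_top](\<lambda>_. 1) \<and>
            (\<forall>\<^sub>F x in at_top. real (min_at_count J j0 x) \<ge> (C3 J + e x) * x)" by blast
qed

end
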